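(* Let $M$ be a complete locally homogeneous $3$-manifold of Heisenberg type with initial homogeneous metric $g_0=A_0f^1\otimes f^1+B_0f^2\otimes f^2+C_0f^3\otimes f^3$ ($A_0,B_0,C_0>0$) and associated Milnor frame $(f_1,f_2,f_3)$. Let $T_0=B_0^2C_0^2/(28A_0^2)$, let $g(t)$, $t\in(-T_0,\infty)$, be the maximal solution of the negative cross curvature flow $\frac{\partial}{\partial t}g=-2h$ with $g(0)=g_0$, and set $$\bar g(t)=(1+t/T_0)^{-3/14}g(t).$$ 1. If $M$ is compact, as $t$ tends to infinity, the metric space $(M,g(t))$ converges in the Gromov–Hausdorff sense to $\mathbb R^2$ with a flat metric (the sectional curvature tends to $0$). If $M=\mathbb H_3$ is the Heisenberg group, with identity $e$, then, as $t$ tends to infinity, the pointed metric space $(\mathbb H_3,e,g(t))$ converges in the Gromov–Hausdorff sense to $\mathbb R^3$ with a flat metric. 2. As $t$ tends to $-T_0$, the metric space $(M,\bar g(t))$ converges uniformly to the sub-Riemannian metric space $(M,\,B_0^{-1}f_2\otimes f_2+C_0^{-1}f_3\otimes f_3)$.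
   Context: **Setting.** $\mathbb H_3$ is the simply connected $3$-dimensional Heisenberg group. "Of Heisenberg type" means that the universal cover of $M$ is $\mathbb H_3$, the metric lifting to a left-invariant one. A Milnor frame for $g_0$ is a frame of left-invariant fields with $[f_2,f_3]=2f_1$, $[f_3,f_1]=[f_1,f_2]=0$ in which $g_0$ is diagonal; $(f^i)$ is the dual frame. Tensors on $M$ are expressed in this frame via the universal cover. **Cross curvature.** In an orthonormal frame diagonalizing the Ricci tensor with principal sectional curvatures $k_1,k_2,k_3$ ($k_i$ is the curvature of the plane orthogonal to the $i$-th vector), the cross curvature tensor $h$ is diagonal with $h_{ii}=k_jk_l$, $\{i,j,l\}=\{1,2,3\}$. The flow preserves the diagonal form $g(t)=A(t)f^1\otimes f^1+B(t)f^2\otimes f^2+C(t)f^3\otimes f^3$ and is an ODE in $(A,B,C)$, whose maximal solution through $g_0$ is defined on $(-T_0,\infty)$. **Convergence.** Uniform convergence of metric spaces on the same space $M$ means uniform convergence of the distance functions on compact subsets of $M\times M$. Gromov–Hausdorff convergence is that of pointed metric spaces; for length spaces it means that, for each $r>0$, the balls of radius $r$ around the base points converge in the Gromov–Hausdorff sense to the ball of radius $r$ around the base point of the limit. **Sub-Riemannian metric space.** $(M,bf_2\otimes f_2+cf_3\otimes f_3)$ with $b,c>0$ denotes $M$ with the distance $d(x,y)=\inf\tau$ over absolutely continuous curves $\gamma:[0,\tau]\to M$ from $x$ to $y$ with $\dot\gamma=a_2\sqrt b\,f_2+a_3\sqrt c\,f_3$, $a_2^2+a_3^2\le1$.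
   Formalization: In the compact case the pointed convergence to R^2 is stated for base points in some open dense subset of M, and for every base point if the deck group consists of left translations; at a point of an exceptional fibre the limit can be a cone R^2/Z_k instead. *)

theory Defs
  imports "HOL-Analysis.Analysis"
begin

section \<open>The Heisenberg group and Milnor frames\<close>

text \<open>The coordinates \<open>(x\<^sub>1, x\<^sub>2, x\<^sub>3)\<close> stand for the unipotent upper triangular matrix with
  entries \<open>x\<^sub>1\<close> and \<open>x\<^sub>2\<close> above the diagonal and \<open>x\<^sub>3\<close> in the corner. The identity is \<open>0\<close>.\<close>

definition heis_mult :: "real^3 \<Rightarrow> real^3 \<Rightarrow> real^3" where
  "heis_mult x y = vector [x$1 + y$1, x$2 + y$2, x$3 + y$3 + x$1 * y$2]"

primrec differentiable_order :: "nat \<Rightarrow> (real^3 \<Rightarrow> 'b::real_normed_vector) \<Rightarrow> bool" where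
  "differentiable_order 0 F \<longleftrightarrow> continuous_on UNIV F"
| "differentiable_order (Suc k) F \<longleftrightarrow>
     (\<forall>x. F differentiable (at x)) \<and>
     (\<forall>v. differentiable_order k (\<lambda>x. frechet_derivative F (at x) v))"

definition smooth :: "(real^3 \<Rightarrow> 'b::real_normed_vector) \<Rightarrow> bool" where
  "smooth F \<longleftrightarrow> (\<forall>k. differentiable_order k F)"

type_synonym vfield = "real^3 \<Rightarrow> real^3"

definition left_invariant :: "vfield \<Rightarrow> bool" where
  "left_invariant X \<longleftrightarrow>
     (\<forall>h x. frechet_derivative (heis_mult h) (at x) (X x) = X (heis_mult h x))"

text \<open>Sign convention: as a derivation, \<open>[X,Y] = X Y - Y X\<close>.\<close>

definition lie_bracket :: "vfield \<Rightarrow> vfield \<Rightarrow> vfield" where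
  "lie_bracket X Y = (\<lambda>x. frechet_derivative Y (at x) (X x) - frechet_derivative X (at x) (Y x))"

text \<open>The index type \<open>3\<close> has elements \<open>1, 2, 3\<close> with arithmetic modulo three.\<close>

definition milnor_frame :: "(3 \<Rightarrow> vfield) \<Rightarrow> bool" where
  "milnor_frame f \<longleftrightarrow>
     (\<forall>i. left_invariant (f i)) \<and>
     (\<forall>x. inj (\<lambda>i. f i x) \<and> independent (range (\<lambda>i. f i x))) \<and>
     lie_bracket (f 2) (f 3) = (\<lambda>x. 2 *\<^sub>R f 1 x) \<and>
     lie_bracket (f 3) (f 1) = (\<lambda>x. 0) \<and>
     lie_bracket (f 1) (f 2) = (\<lambda>x. 0)"

definition dual_frame :: "(3 \<Rightarrow> vfield) \<Rightarrow> 3 \<Rightarrow> real^3 \<Rightarrow> real^3 \<Rightarrow> real" where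
  "dual_frame f i x u = (THE c :: real^3. u = (\<Sum>j\<in>UNIV. (c$j) *\<^sub>R f j x)) $ i"


section \<open>Riemannian metrics and curvature\<close>

type_synonym tensor2 = "real^3 \<Rightarrow> real^3 \<Rightarrow> real^3 \<Rightarrow> real"

definition diag_metric :: "(3 \<Rightarrow> vfield) \<Rightarrow> real \<Rightarrow> real \<Rightarrow> real \<Rightarrow> tensor2" where
  "diag_metric f a b c x u v =
     a * dual_frame f 1 x u * dual_frame f 1 x v +
     b * dual_frame f 2 x u * dual_frame f 2 x v +
     c * dual_frame f 3 x u * dual_frame f 3 x v"

definition riemannian_metric :: "tensor2 \<Rightarrow> bool" where
  "riemannian_metric g \<longleftrightarrow>
     (\<forall>x. bilinear (g x)) \<and> (\<forall>x u v. g x u v = g x v u) \<and>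
     (\<forall>x u. u \<noteq> 0 \<longrightarrow> 0 < g x u u) \<and> (\<forall>u v. smooth (\<lambda>x. g x u v))"

text \<open>The Levi-Civita derivative \<open>\<nabla>\<^sub>X Y\<close>, given by the Koszul formula.\<close>

definition levi_civita :: "tensor2 \<Rightarrow> vfield \<Rightarrow> vfield \<Rightarrow> vfield" where
  "levi_civita g X Y = (\<lambda>x. THE w. \<forall>Z. smooth Z \<longrightarrow>
     2 * g x w (Z x) =
       frechet_derivative (\<lambda>y. g y (Y y) (Z y)) (at x) (X x)
     + frechet_derivative (\<lambda>y. g y (X y) (Z y)) (at x) (Y x)
     - frechet_derivative (\<lambda>y. g y (X y) (Y y)) (at x) (Z x)
     + g x (lie_bracket X Y x) (Z x)
     - g x (lie_bracket X Z x) (Y x)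
     - g x (lie_bracket Y Z x) (X x))"

definition curvature :: "tensor2 \<Rightarrow> vfield \<Rightarrow> vfield \<Rightarrow> vfield \<Rightarrow> vfield" where
  "curvature g X Y Z = (\<lambda>x.
       levi_civita g X (levi_civita g Y Z) x
     - levi_civita g Y (levi_civita g X Z) x
     - levi_civita g (lie_bracket X Y) Z x)"

text \<open>As the curvature is tensorial, tangent vectors may be extended to constant fields.\<close>

definition curvature_at :: "tensor2 \<Rightarrow> real^3 \<Rightarrow> real^3 \<Rightarrow> real^3 \<Rightarrow> real^3 \<Rightarrow> real^3" where
  "curvature_at g x u v w = curvature g (\<lambda>_. u) (\<lambda>_. v) (\<lambda>_. w) x"

definition sectional_curvature :: "tensor2 \<Rightarrow> real^3 \<Rightarrow> real^3 \<Rightarrow> real^3 \<Rightarrow> real" where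
  "sectional_curvature g x u v =
     g x (curvature_at g x u v v) u / (g x u u * g x v v - (g x u v)\<^sup>2)"

definition ricci :: "tensor2 \<Rightarrow> tensor2" where
  "ricci g x u v = (\<Sum>i\<in>UNIV. curvature_at g x (axis i 1) u v $ i)"

definition ricci_frame :: "tensor2 \<Rightarrow> real^3 \<Rightarrow> (3 \<Rightarrow> real^3) \<Rightarrow> bool" where
  "ricci_frame g x e \<longleftrightarrow>
     (\<forall>i j. g x (e i) (e j) = (if i = j then 1 else 0)) \<and>
     (\<forall>i j. i \<noteq> j \<longrightarrow> ricci g x (e i) (e j) = 0)"

text \<open>The plane orthogonal to \<open>e i\<close> is spanned by the two cyclically following vectors.\<close>

definition principal_curvature :: "tensor2 \<Rightarrow> real^3 \<Rightarrow> (3 \<Rightarrow> real^3) \<Rightarrow> 3 \<Rightarrow> real" where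
  "principal_curvature g x e i = sectional_curvature g x (e (i + 1)) (e (i + 2))"

definition cross_curvature :: "tensor2 \<Rightarrow> tensor2" where
  "cross_curvature g x = (THE h. bilinear h \<and>
     (\<forall>e. ricci_frame g x e \<longrightarrow>
       (\<forall>i j. h (e i) (e j) =
          (if i = j then \<Prod>k\<in>UNIV - {i}. principal_curvature g x e k else 0))))"


section \<open>Manifolds of Heisenberg type\<close>

text \<open>A manifold \<open>M\<close> covered by the Heisenberg group is given by its universal covering
  \<open>p\<close>. Its smooth structure is the one making \<open>p\<close> a local diffeomorphism, and tensors on \<open>M\<close>
  are the tensors on the Heisenberg group that are invariant under deck transformations; these
  need not be left translations.\<close>

definition deck_transformations :: "(real^3 \<Rightarrow> 'm) \<Rightarrow> (real^3 \<Rightarrow> real^3) set" where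
  "deck_transformations p = {\<phi>. (\<exists>\<psi>. homeomorphism UNIV UNIV \<phi> \<psi>) \<and> p \<circ> \<phi> = p}"

definition preserves :: "(real^3 \<Rightarrow> real^3) \<Rightarrow> tensor2 \<Rightarrow> bool" where
  "preserves \<phi> g \<longleftrightarrow>
     (\<forall>x u v. g (\<phi> x) (frechet_derivative \<phi> (at x) u) (frechet_derivative \<phi> (at x) v) = g x u v)"

definition descends :: "(real^3 \<Rightarrow> 'm) \<Rightarrow> tensor2 \<Rightarrow> bool" where
  "descends p g \<longleftrightarrow> (\<forall>\<phi> \<in> deck_transformations p. preserves \<phi> g)"

definition heisenberg_type :: "(real^3 \<Rightarrow> 'm::t2_space) \<Rightarrow> 'm set \<Rightarrow> tensor2 \<Rightarrow> bool" where
  "heisenberg_type p M g \<longleftrightarrow>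
     covering_space UNIV p M \<and> (\<forall>\<phi> \<in> deck_transformations p. smooth \<phi>) \<and>
     riemannian_metric g \<and> (\<forall>h. preserves (heis_mult h) g) \<and> descends p g"


section \<open>The negative cross curvature flow\<close>

definition neg_xcf_solution ::
    "(real^3 \<Rightarrow> 'm) \<Rightarrow> (3 \<Rightarrow> vfield) \<Rightarrow> tensor2 \<Rightarrow> real set \<Rightarrow> (real \<Rightarrow> tensor2) \<Rightarrow> bool" where
  "neg_xcf_solution p f g0 I g \<longleftrightarrow>
     open I \<and> is_interval I \<and> 0 \<in> I \<and> g 0 = g0 \<and>
     (\<forall>t\<in>I.
        (\<exists>a b c. 0 < a \<and> 0 < b \<and> 0 < c \<and> g t = diag_metric f a b c) \<and>
        descends p (g t) \<and>
        (\<forall>x u v. ((\<lambda>s. g s x u v) has_real_derivative - 2 * cross_curvature (g t) x u v) (at t)))"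

definition maximal_neg_xcf_solution ::
    "(real^3 \<Rightarrow> 'm) \<Rightarrow> (3 \<Rightarrow> vfield) \<Rightarrow> tensor2 \<Rightarrow> real set \<Rightarrow> (real \<Rightarrow> tensor2) \<Rightarrow> bool" where
  "maximal_neg_xcf_solution p f g0 I g \<longleftrightarrow>
     neg_xcf_solution p f g0 I g \<and>
     (\<forall>J g'. neg_xcf_solution p f g0 J g' \<and> I \<subseteq> J \<and> (\<forall>t\<in>I. g' t = g t) \<longrightarrow> J = I)"


section \<open>Riemannian and sub-Riemannian distances\<close>

definition speed :: "tensor2 \<Rightarrow> (real \<Rightarrow> real^3) \<Rightarrow> real \<Rightarrow> real" where
  "speed g \<gamma> s = sqrt (g (\<gamma> s) (vector_derivative \<gamma> (at s)) (vector_derivative \<gamma> (at s)))"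

text \<open>Curves in \<open>M\<close> are the projections of curves in the universal cover. A \<open>valid_path\<close>
  may have unbounded derivative near its finitely many break points, hence infinite length; the
  integrability condition excludes these.\<close>

definition riem_dist :: "(real^3 \<Rightarrow> 'm) \<Rightarrow> tensor2 \<Rightarrow> 'm \<Rightarrow> 'm \<Rightarrow> real" where
  "riem_dist p g x y = Inf {integral {0..1} (speed g \<gamma>) | \<gamma>.
     valid_path \<gamma> \<and> speed g \<gamma> integrable_on {0..1} \<and> p (\<gamma> 0) = x \<and> p (\<gamma> 1) = y}"

definition abs_continuous_on :: "real set \<Rightarrow> (real \<Rightarrow> 'b::real_normed_vector) \<Rightarrow> bool" where
  "abs_continuous_on S \<gamma> \<longleftrightarrow> (\<forall>\<epsilon>>0. \<exists>\<delta>>0. \<forall>D.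
     D division_of \<Union>D \<and> \<Union>D \<subseteq> S \<and> (\<Sum>K\<in>D. Sup K - Inf K) < \<delta> \<longrightarrow>
     (\<Sum>K\<in>D. norm (\<gamma> (Sup K) - \<gamma> (Inf K))) < \<epsilon>)"

definition horizontal_curve ::
    "(3 \<Rightarrow> vfield) \<Rightarrow> real \<Rightarrow> real \<Rightarrow> real \<Rightarrow> (real \<Rightarrow> real^3) \<Rightarrow> bool" where
  "horizontal_curve f b c \<tau> \<gamma> \<longleftrightarrow>
     abs_continuous_on {0..\<tau>} \<gamma> \<and>
     (AE s in lebesgue. s \<in> {0..\<tau>} \<longrightarrow>
       (\<exists>a2 a3. a2\<^sup>2 + a3\<^sup>2 \<le> 1 \<and>
         (\<gamma> has_vector_derivative
            (a2 * sqrt b) *\<^sub>R f 2 (\<gamma> s) + (a3 * sqrt c) *\<^sub>R f 3 (\<gamma> s)) (at s)))"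

definition subriem_dist ::
    "(real^3 \<Rightarrow> 'm) \<Rightarrow> (3 \<Rightarrow> vfield) \<Rightarrow> real \<Rightarrow> real \<Rightarrow> 'm \<Rightarrow> 'm \<Rightarrow> real" where
  "subriem_dist p f b c x y = Inf {\<tau>. 0 \<le> \<tau> \<and>
     (\<exists>\<gamma>. horizontal_curve f b c \<tau> \<gamma> \<and> p (\<gamma> 0) = x \<and> p (\<gamma> \<tau>) = y)}"


section \<open>Convergence of metric spaces\<close>

definition uniformly_convergent_metrics ::
    "'m::topological_space set \<Rightarrow> ('t \<Rightarrow> 'm \<Rightarrow> 'm \<Rightarrow> real) \<Rightarrow> ('m \<Rightarrow> 'm \<Rightarrow> real) \<Rightarrow> 't filter \<Rightarrow> bool" where
  "uniformly_convergent_metrics M d d' F \<longleftrightarrow>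
     (\<forall>K. compact K \<and> K \<subseteq> M \<times> M \<longrightarrow>
        uniform_limit K (\<lambda>t (x, y). d t x y) (\<lambda>(x, y). d' x y) F)"

text \<open>Pointed Gromov--Hausdorff distance less than \<open>\<epsilon>\<close>: some metric on the disjoint union extends
  both metrics, with the Hausdorff distance of the two parts and the distance of the two base
  points less than \<open>\<epsilon>\<close>.\<close>

definition GH_close ::
    "real \<Rightarrow> 'a set \<Rightarrow> 'a \<Rightarrow> ('a \<Rightarrow> 'a \<Rightarrow> real) \<Rightarrow> 'b set \<Rightarrow> 'b \<Rightarrow> ('b \<Rightarrow> 'b \<Rightarrow> real) \<Rightarrow> bool" where
  "GH_close \<epsilon> X x0 dX Y y0 dY \<longleftrightarrow>
     (\<exists>\<delta>. Metric_space (X <+> Y) \<delta> \<and>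
        (\<forall>x\<in>X. \<forall>x'\<in>X. \<delta> (Inl x) (Inl x') = dX x x') \<and>
        (\<forall>y\<in>Y. \<forall>y'\<in>Y. \<delta> (Inr y) (Inr y') = dY y y') \<and>
        (\<exists>\<epsilon>'<\<epsilon>. (\<forall>x\<in>X. \<exists>y\<in>Y. \<delta> (Inl x) (Inr y) < \<epsilon>') \<and>
                (\<forall>y\<in>Y. \<exists>x\<in>X. \<delta> (Inl x) (Inr y) < \<epsilon>') \<and>
                \<delta> (Inl x0) (Inr y0) < \<epsilon>'))"

definition pointed_GH_convergent ::
    "'a set \<Rightarrow> 'a \<Rightarrow> ('t \<Rightarrow> 'a \<Rightarrow> 'a \<Rightarrow> real) \<Rightarrow>
     'b set \<Rightarrow> 'b \<Rightarrow> ('b \<Rightarrow> 'b \<Rightarrow> real) \<Rightarrow> 't filter \<Rightarrow> bool" where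
  "pointed_GH_convergent X x0 d Y y0 dY F \<longleftrightarrow>
     (\<forall>r>0. \<forall>\<epsilon>>0. eventually (\<lambda>t.
        GH_close \<epsilon> {x\<in>X. d t x0 x < r} x0 (d t) {y\<in>Y. dY y0 y < r} y0 dY) F)"

end

theory Submission
  imports Defs
begin

text \<open>For a diagonal metric with coefficients \<open>a, b, c\<close> let \<open>N x x'\<close> be the norm of the exponential
  coordinates of \<open>x\<^sup>-\<^sup>1 x'\<close>. Segments show that \<open>N\<close> bounds the distance from above; conversely a path
  of length \<open>L\<close> has end points with \<open>N \<le> L + \<lambda> L\<^sup>2\<close>, where \<open>\<lambda> = sqrt (a / (b c))\<close>.

  The flow is explicit: with \<open>s = 1 + t / T0\<close> the coefficient \<open>A\<close> is multiplied by \<open>s\<close> to the power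
  \<open>-1/14\<close>, and \<open>B\<close> and \<open>C\<close> by \<open>s\<close> to the power \<open>3/14\<close>. So \<open>\<lambda>\<close> tends to \<open>0\<close> as \<open>t\<close> tends to infinity,
  and on balls of fixed radius the distance approaches \<open>N\<close>, which itself approaches a Euclidean
  distance. If \<open>M\<close> is compact, the deck group contains a vertical translation, whose length tends to
  \<open>0\<close>, and acts on the plane by a discrete group of isometries. The plane is scaled by a factor
  tending to infinity, which leaves the whole plane unless the base point lies below a fixed point
  of a non-trivial isometry.

  After rescaling, \<open>b\<close> and \<open>c\<close> are constant and \<open>a\<close> tends to infinity as \<open>t\<close> tends to \<open>-T0\<close>. The
  Riemannian distance lies below the sub-Riemannian one because horizontal curves keep their length.
  Conversely a path of length \<open>L\<close> is followed by a chain of horizontal segments; the vertical gap that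
  remains has order \<open>L / sqrt a\<close> and is closed by a loop whose length is of the order of its square
  root.\<close>

section \<open>Milnor frames in coordinates\<close>

text \<open>Every error term stems from the identity \<open>dy1 = th1 + th2 dth3 - th3 dth2\<close>
  in exponential coordinates: apart from what \<open>th1\<close> contributes, the vertical
  displacement along a path is, up to a constant, the area swept out by its projection to the plane,
  and a path of length L sweeps out area of order L^2. The same area form makes loops close vertical
  gaps and turns commutators of lifted plane translations into vertical translations.

  The obstacle is that deck transformations are only known to be smooth and to preserve every g(t);
  they may rotate or reflect the plane and reverse the fibres. As the ratio of the vertical and the
  horizontal coefficients varies with t, both parts are preserved separately. So the deck group acts
  on the plane by isometries and on vertical displacements by signs, and all that is needed about it
  can be read off in the plane. Base points over fixed points of rotations or reflections are
  excluded because no scaling removes the stabiliser there; the remaining ones form an open dense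
  set, and a group of left translations excludes none.\<close>

lemma vec3_eq_iff: "(x :: real^3) = y \<longleftrightarrow> x$1 = y$1 \<and> x$2 = y$2 \<and> x$3 = y$3"
  by (simp add: vec_eq_iff forall_3)

lemma axis_3_nth [simp]: "axis 3 (1::real) $ (1::3) = 0" "axis 3 (1::real) $ (2::3) = 0" "axis 3 (1::real) $ (3::3) = 1"
  by (simp_all add: axis_def)

lemmas has_derivative_vec_nth = bounded_linear.has_derivative[OF bounded_linear_vec_nth]

lemmas frechet_derivative_eq = frechet_derivative_at[symmetric]

lemma heis_mult_affine: "heis_mult h x = h + x + (h$1 * x$2) *\<^sub>R axis 3 1"
  by (simp add: heis_mult_def vec3_eq_iff)

text \<open>Left translation by \<open>x\<close> carries the identity to \<open>x\<close>, so
  invariance expresses \<open>X x\<close> by \<open>X 0\<close> and the differential of the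
  multiplication at \<open>0\<close>; that differential only adds \<open>x$1\<close> times the
  second component to the third coordinate.\<close>

lemma left_invariant_formula:
  assumes "left_invariant X"
  shows "X x = X 0 + (x$1 * X 0 $ 2) *\<^sub>R axis 3 1"
proof -
  have "(heis_mult x has_derivative (\<lambda>u. u + (x$1 * u$2) *\<^sub>R axis 3 1)) (at 0)"
    unfolding heis_mult_affine[abs_def]
    by (rule derivative_eq_intros has_derivative_vec_nth refl | simp)+
  then have "frechet_derivative (heis_mult x) (at 0) (X 0) = X 0 + (x$1 * X 0 $ 2) *\<^sub>R axis 3 1"
    by (simp add: frechet_derivative_eq)
  moreover have "heis_mult x 0 = x" by (simp add: heis_mult_affine)
  ultimately show ?thesis using assms unfolding left_invariant_def by metis
qed

locale milnor =
  fixes f :: "3 \<Rightarrow> real^3 \<Rightarrow> real^3"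
  assumes milnor_frame: "milnor_frame f"
begin

definition F0 :: "3 \<Rightarrow> real^3" where "F0 i = f i 0"

definition kap :: real where "kap = F0 1 $ 3"

text \<open>Dual forms by Cramer's rule, with the determinant of \<open>det\<close>. The first two
  components of a left-invariant field are constant, so \<open>th2\<close> and \<open>th3\<close> do
  not depend on the base point; only the contact form \<open>th1\<close> does, through
  \<open>x$1\<close>.\<close>

definition th2 :: "real^3 \<Rightarrow> real" where
  "th2 u = (F0 3 $ 2 * u$1 - F0 3 $ 1 * u$2) / (2 * kap)"

definition th3 :: "real^3 \<Rightarrow> real" where
  "th3 u = (F0 2 $ 1 * u$2 - F0 2 $ 2 * u$1) / (2 * kap)"

definition th1 :: "real^3 \<Rightarrow> real^3 \<Rightarrow> real" where
  "th1 x u = (u$3 - x$1 * u$2 - F0 2 $ 3 * th2 u - F0 3 $ 3 * th3 u) / kap"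

lemma frame_formula: "f i x = F0 i + (x$1 * F0 i $ 2) *\<^sub>R axis 3 1"
  unfolding F0_def by (rule left_invariant_formula) (use milnor_frame in \<open>simp add: milnor_frame_def\<close>)

lemma frame_nth: "f i x $ 1 = F0 i $ 1" "f i x $ 2 = F0 i $ 2" "f i x $ 3 = F0 i $ 3 + x$1 * F0 i $ 2"
  by (subst frame_formula, simp)+

lemma frame_has_derivative: "(f i has_derivative (\<lambda>u. (u$1 * F0 i $ 2) *\<^sub>R axis 3 1)) (at x)"
proof -
  have "((\<lambda>x. F0 i + (x$1 * F0 i $ 2) *\<^sub>R axis 3 1) has_derivative (\<lambda>u. (u$1 * F0 i $ 2) *\<^sub>R axis 3 1)) (at x)"
    by (rule derivative_eq_intros has_derivative_vec_nth refl | simp)+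
  moreover have "f i = (\<lambda>x. F0 i + (x$1 * F0 i $ 2) *\<^sub>R axis 3 1)"
    by (rule ext) (rule frame_formula)
  ultimately show ?thesis by simp
qed

lemma frame_bracket:
  "lie_bracket (f i) (f j) x = (F0 i $ 1 * F0 j $ 2 - F0 j $ 1 * F0 i $ 2) *\<^sub>R axis 3 1"
  unfolding lie_bracket_def frechet_derivative_eq[OF frame_has_derivative]
  by (simp add: frame_nth algebra_simps)

text \<open>Brackets of left-invariant fields point in the third coordinate direction. So the
  bracket of \<open>f 2\<close> and \<open>f 3\<close> makes \<open>f 1\<close> vertical, and its
  third component is the determinant.\<close>

lemma frame1: "F0 1 $ 1 = 0" "F0 1 $ 2 = 0"
  and det: "F0 2 $ 1 * F0 3 $ 2 - F0 3 $ 1 * F0 2 $ 2 = 2 * kap"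
proof -
  have "2 *\<^sub>R F0 1 = lie_bracket (f 2) (f 3) 0"
    using milnor_frame by (simp add: milnor_frame_def F0_def)
  then have *: "2 *\<^sub>R F0 1 = (F0 2 $ 1 * F0 3 $ 2 - F0 3 $ 1 * F0 2 $ 2) *\<^sub>R axis 3 1"
    by (simp add: frame_bracket)
  then show "F0 1 $ 1 = 0" "F0 1 $ 2 = 0" by (simp_all add: vec3_eq_iff)
  show "F0 2 $ 1 * F0 3 $ 2 - F0 3 $ 1 * F0 2 $ 2 = 2 * kap"
    using * by (simp add: vec3_eq_iff kap_def)
qed

lemma kap_nz: "kap \<noteq> 0"
proof
  assume "kap = 0"
  then have "F0 1 = 0" using frame1 by (simp add: vec3_eq_iff kap_def)
  moreover have "independent (range F0)" using milnor_frame by (simp add: milnor_frame_def F0_def[abs_def])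
  ultimately show False using dependent_zero by (metis rangeI)
qed

lemma nth_of_th:
  "u$1 = th2 u * F0 2 $ 1 + th3 u * F0 3 $ 1"
  "u$2 = th2 u * F0 2 $ 2 + th3 u * F0 3 $ 2"
  "u$3 = th1 x u * kap + th2 u * (F0 2 $ 3 + x$1 * F0 2 $ 2) + th3 u * (F0 3 $ 3 + x$1 * F0 3 $ 2)"
proof -
  have "2 * kap * u$1 = 2 * kap * (th2 u * F0 2 $ 1 + th3 u * F0 3 $ 1)"
    "2 * kap * u$2 = 2 * kap * (th2 u * F0 2 $ 2 + th3 u * F0 3 $ 2)"
    unfolding th2_def th3_def using kap_nz
    by (simp_all add: distrib_left det[symmetric]) (simp_all add: algebra_simps)
  then show 1: "u$1 = th2 u * F0 2 $ 1 + th3 u * F0 3 $ 1"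
    and 2: "u$2 = th2 u * F0 2 $ 2 + th3 u * F0 3 $ 2" using kap_nz by simp_all
  have "u$3 = th1 x u * kap + x$1 * u$2 + F0 2 $ 3 * th2 u + F0 3 $ 3 * th3 u"
    unfolding th1_def using kap_nz by simp
  then show "u$3 = th1 x u * kap + th2 u * (F0 2 $ 3 + x$1 * F0 2 $ 2) + th3 u * (F0 3 $ 3 + x$1 * F0 3 $ 2)"
    using 2 by (simp add: algebra_simps)
qed

lemma th23_linear:
  "th2 (u + v) = th2 u + th2 v" "th3 (u + v) = th3 u + th3 v"
  "th2 (u - v) = th2 u - th2 v" "th3 (u - v) = th3 u - th3 v"
  "th2 (r *\<^sub>R u) = r * th2 u" "th3 (r *\<^sub>R u) = r * th3 u" "th2 0 = 0" "th3 0 = 0"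
  by (simp_all add: th2_def th3_def diff_divide_distrib add_divide_distrib algebra_simps)

lemma th1_linear:
  "th1 x (u + v) = th1 x u + th1 x v" "th1 x (u - v) = th1 x u - th1 x v"
  "th1 x (r *\<^sub>R u) = r * th1 x u" "th1 x 0 = 0"
  by (simp_all add: th1_def th23_linear diff_divide_distrib add_divide_distrib algebra_simps)

lemmas th_linear = th23_linear th1_linear

lemma th_frame:
  "th1 x (f 1 x) = 1" "th1 x (f 2 x) = 0" "th1 x (f 3 x) = 0"
  "th2 (f 1 x) = 0" "th2 (f 2 x) = 1" "th2 (f 3 x) = 0"
  "th3 (f 1 x) = 0" "th3 (f 2 x) = 0" "th3 (f 3 x) = 1"
proof -
  show "th2 (f 1 x) = 0" "th3 (f 1 x) = 0" "th2 (f 3 x) = 0" "th3 (f 2 x) = 0"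
    by (simp_all add: th2_def th3_def frame_nth frame1)
  have d2: "F0 3 $ 2 * F0 2 $ 1 - F0 3 $ 1 * F0 2 $ 2 = 2 * kap"
    using det by (simp only: mult.commute)
  have d3: "F0 2 $ 1 * F0 3 $ 2 - F0 2 $ 2 * F0 3 $ 1 = 2 * kap"
    using det by (simp only: mult.commute)
  show "th2 (f 2 x) = 1" "th3 (f 3 x) = 1"
    unfolding th2_def th3_def frame_nth d2 d3 using kap_nz by simp_all
  then show "th1 x (f 1 x) = 1" "th1 x (f 2 x) = 0" "th1 x (f 3 x) = 0"
    using \<open>th2 (f 1 x) = 0\<close> \<open>th3 (f 1 x) = 0\<close> \<open>th2 (f 3 x) = 0\<close> \<open>th3 (f 2 x) = 0\<close> kap_nz
    by (simp_all add: th1_def frame_nth frame1 kap_def)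
qed

lemma frame_decomposition: "u = th1 x u *\<^sub>R f 1 x + th2 u *\<^sub>R f 2 x + th3 u *\<^sub>R f 3 x"
  using nth_of_th(1,2)[of u] nth_of_th(3)[of u x] by (simp add: vec3_eq_iff frame_nth frame1 kap_def)

lemma th_eqI: "th1 x u = th1 x v \<Longrightarrow> th2 u = th2 v \<Longrightarrow> th3 u = th3 v \<Longrightarrow> u = v"
  by (metis frame_decomposition)

lemma dual_frame_eq:
  "dual_frame f 1 x u = th1 x u" "dual_frame f 2 x u = th2 u" "dual_frame f 3 x u = th3 u"
proof -
  have "(THE c :: real^3. u = (\<Sum>j\<in>UNIV. (c$j) *\<^sub>R f j x)) = vector [th1 x u, th2 u, th3 u]"
  proof (rule the_equality)
    show "u = (\<Sum>j\<in>UNIV. ((vector [th1 x u, th2 u, th3 u] :: real^3)$j) *\<^sub>R f j x)"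
      by (simp add: sum_3 frame_decomposition[symmetric])
    fix c :: "real^3" assume c: "u = (\<Sum>j\<in>UNIV. (c$j) *\<^sub>R f j x)"
    show "c = vector [th1 x u, th2 u, th3 u]"
      by (subst (1 2 3) c) (simp add: sum_3 th_linear th_frame vec3_eq_iff)
  qed
  then show "dual_frame f 1 x u = th1 x u" "dual_frame f 2 x u = th2 u" "dual_frame f 3 x u = th3 u"
    by (simp_all add: dual_frame_def)
qed

lemma diag_metric_eq:
  "diag_metric f a b c x u v = a * th1 x u * th1 x v + b * th2 u * th2 v + c * th3 u * th3 v"
  by (simp add: diag_metric_def dual_frame_eq)

text \<open>The left side is \<open>- kap\<close> times the exterior derivative of
  \<open>th1\<close>, which comes from the \<open>x$1\<close> in its definition. This structure
  equation turns coordinate expressions into frame coefficients.\<close>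

lemma area_th: "u$1 * v$2 - u$2 * v$1 = 2 * kap * (th2 u * th3 v - th3 u * th2 v)"
  by (subst (1 2) nth_of_th(1), subst (1 2) nth_of_th(2), subst det[symmetric]) (simp add: algebra_simps)

lemma th2_has_derivative:
  assumes "(Y has_derivative Y') (at x)"
  shows "((\<lambda>y. th2 (Y y)) has_derivative (\<lambda>h. th2 (Y' h))) (at x)"
proof -
  have "linear th2" by (rule linearI) (simp_all add: th_linear)
  then show ?thesis
    using bounded_linear.has_derivative[OF linear_conv_bounded_linear[THEN iffD1] assms] by blast
qed

lemma th3_has_derivative:
  assumes "(Y has_derivative Y') (at x)"
  shows "((\<lambda>y. th3 (Y y)) has_derivative (\<lambda>h. th3 (Y' h))) (at x)"
proof -
  have "linear th3" by (rule linearI) (simp_all add: th_linear)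
  then show ?thesis
    using bounded_linear.has_derivative[OF linear_conv_bounded_linear[THEN iffD1] assms] by blast
qed

lemma th1_has_derivative:
  assumes "(Y has_derivative Y') (at x)"
  shows "((\<lambda>y. th1 y (Y y)) has_derivative (\<lambda>h. th1 x (Y' h) - h$1 * (Y x $ 2) / kap)) (at x)"
proof -
  have "((\<lambda>y. Y y $ 3 - y$1 * Y y $ 2 - F0 2 $ 3 * th2 (Y y) - F0 3 $ 3 * th3 (Y y)) has_derivative
     (\<lambda>h. Y' h $ 3 - (x$1 * Y' h $ 2 + h$1 * Y x $ 2) - F0 2 $ 3 * th2 (Y' h) - F0 3 $ 3 * th3 (Y' h))) (at x)"
    by (intro has_derivative_diff has_derivative_mult has_derivative_mult_right has_derivative_vec_nth
        assms has_derivative_ident th2_has_derivative[OF assms] th3_has_derivative[OF assms])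
  then have "((\<lambda>y. th1 y (Y y)) has_derivative (\<lambda>h. (Y' h $ 3 - (x$1 * Y' h $ 2 + h$1 * Y x $ 2)
      - F0 2 $ 3 * th2 (Y' h) - F0 3 $ 3 * th3 (Y' h)) / kap)) (at x)"
    unfolding th1_def by (rule bounded_linear.has_derivative[OF bounded_linear_divide])
  then show ?thesis
    by (rule has_derivative_eq_rhs) (simp add: fun_eq_iff th1_def diff_divide_distrib add_divide_distrib)
qed

section \<open>The Levi-Civita connection and the curvature of diagonal metrics\<close>

lemma diag_metric_has_derivative:
  assumes Y: "(Y has_derivative Y') (at x)" and Z: "(Z has_derivative Z') (at x)"
  shows "((\<lambda>y. diag_metric f a b c y (Y y) (Z y)) has_derivative
    (\<lambda>h. a * (th1 x (Y' h) - h$1 * (Y x $ 2) / kap) * th1 x (Z x)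
       + a * th1 x (Y x) * (th1 x (Z' h) - h$1 * (Z x $ 2) / kap)
       + b * th2 (Y' h) * th2 (Z x) + b * th2 (Y x) * th2 (Z' h)
       + c * th3 (Y' h) * th3 (Z x) + c * th3 (Y x) * th3 (Z' h))) (at x)"
  unfolding diag_metric_eq
  by (rule has_derivative_eq_rhs[OF has_derivative_add[OF has_derivative_add[
      OF has_derivative_mult[OF has_derivative_mult_right[OF th1_has_derivative[OF Y]] th1_has_derivative[OF Z]]
         has_derivative_mult[OF has_derivative_mult_right[OF th2_has_derivative[OF Y]] th2_has_derivative[OF Z]]]
         has_derivative_mult[OF has_derivative_mult_right[OF th3_has_derivative[OF Y]] th3_has_derivative[OF Z]]]])
    (simp add: fun_eq_iff algebra_simps)

lemma smooth_const: "smooth (\<lambda>_. z :: 'b::real_normed_vector)"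
proof -
  have "differentiable_order k (\<lambda>_::real^3. z)" for k and z :: 'b
  proof (induction k arbitrary: z)
    case (Suc k)
    have "frechet_derivative (\<lambda>_::real^3. z) (at x) v = 0" for x v
      by (simp add: frechet_derivative_const)
    then show ?case using Suc[of 0] by simp
  qed simp
  then show ?thesis by (simp add: smooth_def)
qed

lemma smooth_has_derivative:
  "smooth Z \<Longrightarrow> (Z has_derivative frechet_derivative Z (at x)) (at x)"
  unfolding smooth_def
  by (metis differentiable_order.simps(2) frechet_derivative_works)

definition vec :: "real^3 \<Rightarrow> real \<Rightarrow> real \<Rightarrow> real \<Rightarrow> real^3" where
  "vec x r s t = r *\<^sub>R f 1 x + s *\<^sub>R f 2 x + t *\<^sub>R f 3 x"

lemma th_vec [simp]: "th1 x (vec x r s t) = r" "th2 (vec x r s t) = s" "th3 (vec x r s t) = t"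
  by (simp_all add: vec_def th_linear th_frame)

text \<open>The Christoffel symbol of the coordinates of \<open>real^3\<close>, written in the
  frame. It is symmetric in \<open>u\<close> and \<open>v\<close> because constant fields commute.
  The first component stems from the symmetric part of the derivative of \<open>th1\<close>, the
  other two from its antisymmetric part.\<close>

definition Gam :: "real \<Rightarrow> real \<Rightarrow> real \<Rightarrow> real^3 \<Rightarrow> real^3 \<Rightarrow> real^3 \<Rightarrow> real^3" where
  "Gam a b c x u v = vec x (- (u$1 * v$2 + v$1 * u$2) / (2 * kap))
     (a / b * (th1 x v * th3 u + th1 x u * th3 v)) (- a / c * (th1 x v * th2 u + th1 x u * th2 v))"

text \<open>The left field is constant since \<open>curvature_at\<close> extends tangent vectors by
  constant fields. \<open>Y\<close> is any field differentiable at \<open>x\<close>, so that the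
  lemma applies once more to the fields \<open>Gam a b c y v w\<close> that the first derivative
  produces.\<close>

lemma levi_civita_const_left:
  assumes pos: "a > 0" "b > 0" "c > 0" and Y: "(Y has_derivative Y') (at x)"
  shows "levi_civita (diag_metric f a b c) (\<lambda>_. u) Y x = Y' u + Gam a b c x u (Y x)"
  unfolding levi_civita_def
proof (rule the_equality)
  let ?g = "diag_metric f a b c"
  have fd: "frechet_derivative (\<lambda>y. ?g y (S y) (T y)) (at x) h =
     a * (th1 x (S' h) - h$1 * (S x $ 2) / kap) * th1 x (T x)
       + a * th1 x (S x) * (th1 x (T' h) - h$1 * (T x $ 2) / kap)
       + b * th2 (S' h) * th2 (T x) + b * th2 (S x) * th2 (T' h)
       + c * th3 (S' h) * th3 (T x) + c * th3 (S x) * th3 (T' h)"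
    if "(S has_derivative S') (at x)" "(T has_derivative T') (at x)" for S T S' T' h
    by (subst frechet_derivative_eq[OF diag_metric_has_derivative[OF that]]) simp
  have br: "lie_bracket S T x = T' (S x) - S' (T x)"
    if "(S has_derivative S') (at x)" "(T has_derivative T') (at x)" for S T S' T'
    using frechet_derivative_eq[OF that(1)] frechet_derivative_eq[OF that(2)] by (simp add: lie_bracket_def)
  have C: "((\<lambda>_. u) has_derivative (\<lambda>_. 0)) (at x)" by simp
  show K: "\<forall>Z. smooth Z \<longrightarrow> 2 * ?g x (Y' u + Gam a b c x u (Y x)) (Z x) =
     frechet_derivative (\<lambda>y. ?g y (Y y) (Z y)) (at x) u
     + frechet_derivative (\<lambda>y. ?g y u (Z y)) (at x) (Y x)
     - frechet_derivative (\<lambda>y. ?g y u (Y y)) (at x) (Z x)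
     + ?g x (lie_bracket (\<lambda>_. u) Y x) (Z x)
     - ?g x (lie_bracket (\<lambda>_. u) Z x) (Y x)
     - ?g x (lie_bracket Y Z x) u"
  proof clarify
    fix Z :: "real^3 \<Rightarrow> real^3" assume "smooth Z"
    define Z' where "Z' = frechet_derivative Z (at x)"
    have Z: "(Z has_derivative Z') (at x)"
      using smooth_has_derivative[OF \<open>smooth Z\<close>] by (simp add: Z'_def)
    define y where "y = Y x"
    define z where "z = Z x"
    define o1 where "o1 = (u$1 * z$2 - u$2 * z$1) / kap"
    define o2 where "o2 = (y$1 * z$2 - y$2 * z$1) / kap"
    have o1: "o1 = 2 * (th2 u * th3 z - th3 u * th2 z)"
      unfolding o1_def area_th using kap_nz by simp
    have o2: "o2 = 2 * (th2 y * th3 z - th3 y * th2 z)"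
      unfolding o2_def area_th using kap_nz by simp
    have G: "2 * ?g x (Gam a b c x u y) z = - a * (u$1 * y$2 / kap + y$1 * u$2 / kap) * th1 x z
        - a * th1 x y * o1 - a * th1 x u * o2"
      unfolding o1 o2 diag_metric_eq Gam_def th_vec using pos kap_nz
      by (simp add: field_simps)
    have lhs: "2 * ?g x (Y' u + Gam a b c x u y) z = 2 * ?g x (Y' u) z + 2 * ?g x (Gam a b c x u y) z"
      by (simp add: diag_metric_eq th_linear algebra_simps)
    show "2 * ?g x (Y' u + Gam a b c x u (Y x)) (Z x) =
     frechet_derivative (\<lambda>y. ?g y (Y y) (Z y)) (at x) u
     + frechet_derivative (\<lambda>y. ?g y u (Z y)) (at x) (Y x)
     - frechet_derivative (\<lambda>y. ?g y u (Y y)) (at x) (Z x)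
     + ?g x (lie_bracket (\<lambda>_. u) Y x) (Z x)
     - ?g x (lie_bracket (\<lambda>_. u) Z x) (Y x)
     - ?g x (lie_bracket Y Z x) u"
      unfolding fd[OF Y Z] fd[OF C Z] fd[OF C Y] br[OF C Y] br[OF C Z] br[OF Y Z]
        y_def[symmetric] z_def[symmetric] lhs G o1_def o2_def
      by (simp add: diag_metric_eq th_linear algebra_simps add_divide_distrib diff_divide_distrib)
  qed
  fix w assume w: "\<forall>Z. smooth Z \<longrightarrow> 2 * ?g x w (Z x) =
     frechet_derivative (\<lambda>y. ?g y (Y y) (Z y)) (at x) u
     + frechet_derivative (\<lambda>y. ?g y u (Z y)) (at x) (Y x)
     - frechet_derivative (\<lambda>y. ?g y u (Y y)) (at x) (Z x)
     + ?g x (lie_bracket (\<lambda>_. u) Y x) (Z x)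
     - ?g x (lie_bracket (\<lambda>_. u) Z x) (Y x)
     - ?g x (lie_bracket Y Z x) u"
  let ?w = "Y' u + Gam a b c x u (Y x)"
  \<comment> \<open>Constant test fields are smooth and take every value \<open>z\<close>, and the
    metric is nondegenerate; this gives uniqueness for \<open>THE\<close>.\<close>
  have "2 * ?g x w z = 2 * ?g x ?w z" for z
    using K[rule_format, OF smooth_const, of z] w[rule_format, OF smooth_const, of z] by linarith
  then have eq: "?g x w z = ?g x ?w z" for z by simp
  show "w = ?w"
    using eq[of "f 1 x"] eq[of "f 2 x"] eq[of "f 3 x"] pos
    by (intro th_eqI[of x]) (simp_all add: diag_metric_eq th_frame)
qed

text \<open>The derivative of \<open>Gam\<close> along \<open>h\<close>: the first component
  collects the variation of \<open>f 2\<close> and \<open>f 3\<close>, which move in the direction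
  of \<open>f 1\<close>, the other two the variation of \<open>th1\<close>.\<close>

definition dGam :: "real \<Rightarrow> real \<Rightarrow> real \<Rightarrow> real^3 \<Rightarrow> real^3 \<Rightarrow> real^3 \<Rightarrow> real^3 \<Rightarrow> real^3" where
  "dGam a b c x u v h = (let G = Gam a b c x u v in vec x (h$1 * (G$2) / kap)
     (- a / b * (h$1 * v$2 * th3 u + h$1 * u$2 * th3 v) / kap)
     (a / c * (h$1 * v$2 * th2 u + h$1 * u$2 * th2 v) / kap))"

lemma vec_nth2: "vec x r s t $ 2 = s * F0 2 $ 2 + t * F0 3 $ 2"
  by (simp add: vec_def frame_nth frame1)

lemma Gam_has_derivative:
  "((\<lambda>y. Gam a b c y u v) has_derivative dGam a b c x u v) (at x)"
proof -
  let ?s = "\<lambda>y. a / b * (th1 y v * th3 u + th1 y u * th3 v)"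
  let ?t = "\<lambda>y. - a / c * (th1 y v * th2 u + th1 y u * th2 v)"
  have C: "((\<lambda>_. w) has_derivative (\<lambda>_. 0)) (at x)" for w :: "real^3" by simp
  have T: "((\<lambda>y. th1 y w) has_derivative (\<lambda>h. - (h$1 * (w $ 2) / kap))) (at x)" for w
    using th1_has_derivative[OF C[of w]] by (simp add: th_linear)
  have S: "(?s has_derivative (\<lambda>h. a / b * (- (h$1 * (v $ 2) / kap) * th3 u + - (h$1 * (u $ 2) / kap) * th3 v))) (at x)"
    by (intro has_derivative_mult_right has_derivative_add has_derivative_mult_left T)
  have U: "(?t has_derivative (\<lambda>h. - a / c * (- (h$1 * (v $ 2) / kap) * th2 u + - (h$1 * (u $ 2) / kap) * th2 v))) (at x)"
    by (intro has_derivative_mult_right has_derivative_add has_derivative_mult_left T)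
  let ?r = "- (u$1 * v$2 + v$1 * u$2) / (2 * kap)"
  show ?thesis
    unfolding Gam_def vec_def
  proof (rule has_derivative_eq_rhs[OF has_derivative_add[OF has_derivative_add[OF
      has_derivative_scaleR_right[OF frame_has_derivative]
      has_derivative_scaleR[OF S frame_has_derivative]] has_derivative_scaleR[OF U frame_has_derivative]]])
    have "F0 1 $ 3 = kap" by (simp add: kap_def)
    then have f1: "axis 3 1 = (1 / kap) *\<^sub>R f 1 x"
      using kap_nz by (simp add: vec3_eq_iff frame_nth frame1)
    show "(\<lambda>h. ?r *\<^sub>R (h $ 1 * F0 1 $ 2) *\<^sub>R axis 3 1 +
          (?s x *\<^sub>R (h $ 1 * F0 2 $ 2) *\<^sub>R axis 3 1 +
           (a / b * (- (h $ 1 * v $ 2 / kap) * th3 u + - (h $ 1 * u $ 2 / kap) * th3 v)) *\<^sub>R f 2 x) +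
          (?t x *\<^sub>R (h $ 1 * F0 3 $ 2) *\<^sub>R axis 3 1 +
           (- a / c * (- (h $ 1 * v $ 2 / kap) * th2 u + - (h $ 1 * u $ 2 / kap) * th2 v)) *\<^sub>R f 3 x)) = dGam a b c x u v"
      apply (rule ext, rule th_eqI[of x])
      unfolding dGam_def Let_def th_vec f1 th_linear th_frame Gam_def vec_nth2 frame1
      by (simp_all add: algebra_simps add_divide_distrib diff_divide_distrib)
  qed
qed


text \<open>\<open>m1\<close>, \<open>m2\<close>, \<open>m3\<close> are the frame coordinates of the
  bivector of \<open>u\<close> and \<open>v\<close>. The curvature operator is diagonal in them: the
  sectional curvature is \<open>-3 * a / (b * c)\<close> for the plane of \<open>f 2\<close> and
  \<open>f 3\<close>, and \<open>a / (b * c)\<close> for the two planes of \<open>f 1\<close> with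
  another frame vector.\<close>

definition Rm :: "real \<Rightarrow> real \<Rightarrow> real \<Rightarrow> real^3 \<Rightarrow> real^3 \<Rightarrow> real^3 \<Rightarrow> real^3 \<Rightarrow> real^3" where
  "Rm a b c x u v w = (let m1 = th2 u * th3 v - th3 u * th2 v; m2 = th3 u * th1 x v - th1 x u * th3 v;
      m3 = th1 x u * th2 v - th2 u * th1 x v in
    vec x (a / c * m3 * th2 w - a / b * m2 * th3 w)
      (- (3 * a / b * m1 * th3 w) - a\<^sup>2 / (b * c) * m3 * th1 x w)
      (3 * a / c * m1 * th2 w + a\<^sup>2 / (b * c) * m2 * th1 x w))"

lemma curvature_at_diag_metric:
  assumes pos: "a > 0" "b > 0" "c > 0"
  shows "curvature_at (diag_metric f a b c) x u v w = Rm a b c x u v w"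
proof -
  let ?g = "diag_metric f a b c"
  have C: "((\<lambda>_. w) has_derivative (\<lambda>_. 0)) (at x)" for w x :: "real^3" by simp
  have L1: "levi_civita ?g (\<lambda>_. v) (\<lambda>_. w) = (\<lambda>y. Gam a b c y v w)" for v w
    using levi_civita_const_left[OF pos C] by (simp add: fun_eq_iff)
  have L2: "levi_civita ?g (\<lambda>_. u) (\<lambda>y. Gam a b c y v w) x = dGam a b c x v w u + Gam a b c x u (Gam a b c x v w)" for u v w
    by (rule levi_civita_const_left[OF pos Gam_has_derivative])
  have "lie_bracket (\<lambda>_. u) (\<lambda>_. v) = (\<lambda>_. 0)"
    by (simp add: lie_bracket_def fun_eq_iff frechet_derivative_const)
  then have "curvature_at ?g x u v w =
     dGam a b c x v w u + Gam a b c x u (Gam a b c x v w)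
     - (dGam a b c x u w v + Gam a b c x v (Gam a b c x u w)) - Gam a b c x 0 w"
    unfolding curvature_at_def curvature_def L1 L2 by (simp add: L1)
  also have "Gam a b c x 0 w = 0" by (rule th_eqI[of x]) (simp_all add: Gam_def th_linear)
  finally have *: "curvature_at ?g x u v w =
     dGam a b c x v w u + Gam a b c x u (Gam a b c x v w)
     - (dGam a b c x u w v + Gam a b c x v (Gam a b c x u w))" by simp
  have area: "(u$1 * v$2 - u$2 * v$1) / kap = 2 * (th2 u * th3 v - th3 u * th2 v)" for u v
    unfolding area_th using kap_nz by simp
  \<comment> \<open>The derivative term contributes \<open>u$1 * ?G$2\<close> in full and
    \<open>Gam\<close> subtracts half of the symmetric expression; half of the antisymmetric one
    remains, to which \<open>area\<close> applies.\<close>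
  have t1: "th1 x (dGam a b c x v w u + Gam a b c x u (Gam a b c x v w))
      = th2 u * th3 (Gam a b c x v w) - th3 u * th2 (Gam a b c x v w)" for u v w
  proof -
    let ?G = "Gam a b c x v w"
    have "th1 x (dGam a b c x v w u + Gam a b c x u ?G)
      = u$1 * (?G$2) / kap - (u$1 * (?G$2) + ?G$1 * u$2) / (2 * kap)"
      unfolding th_linear dGam_def Let_def th_vec by (subst (2) Gam_def) (simp only: th_vec minus_divide_left[symmetric] diff_conv_add_uminus)
    also have "\<dots> = ((u$1 * (?G$2) - u$2 * (?G$1)) / kap) / 2"
      by (simp add: field_simps kap_nz)
    also have "\<dots> = th2 u * th3 ?G - th3 u * th2 ?G" unfolding area by simp
    finally show ?thesis .
  qed
  show ?thesis
  proof (rule th_eqI[of x])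
    show "th1 x (curvature_at ?g x u v w) = th1 x (Rm a b c x u v w)"
      unfolding * th1_linear(2) t1 unfolding Gam_def Rm_def Let_def th_vec
      by (simp add: algebra_simps)
    define o1 where "o1 = (u$1 * v$2 - u$2 * v$1) / kap"
    define o2 where "o2 = (u$1 * w$2 - u$2 * w$1) / kap"
    define o3 where "o3 = (v$1 * w$2 - v$2 * w$1) / kap"
    have o: "o1 = 2 * (th2 u * th3 v - th3 u * th2 v)" "o2 = 2 * (th2 u * th3 w - th3 u * th2 w)"
      "o3 = 2 * (th2 v * th3 w - th3 v * th2 w)"
      unfolding o1_def o2_def o3_def area by simp_all
    have "th2 (curvature_at ?g x u v w) = a / b * (- o1 * th3 w - o2 / 2 * th3 v + o3 / 2 * th3 u
       + th1 x u * th3 (Gam a b c x v w) - th1 x v * th3 (Gam a b c x u w))"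
      unfolding * th_linear dGam_def Let_def th_vec o1_def o2_def o3_def
      unfolding Gam_def th_vec
      by (simp add: algebra_simps add_divide_distrib diff_divide_distrib)
    also have "\<dots> = th2 (Rm a b c x u v w)"
      unfolding o unfolding Gam_def Rm_def Let_def th_vec using pos
      by (simp add: field_simps power2_eq_square)
    finally show "th2 (curvature_at ?g x u v w) = th2 (Rm a b c x u v w)" .
    have "th3 (curvature_at ?g x u v w) = a / c * (o1 * th2 w + o2 / 2 * th2 v - o3 / 2 * th2 u
       - th1 x u * th2 (Gam a b c x v w) + th1 x v * th2 (Gam a b c x u w))"
      unfolding * th_linear dGam_def Let_def th_vec o1_def o2_def o3_def
      unfolding Gam_def th_vec
      by (simp add: algebra_simps add_divide_distrib diff_divide_distrib)
    also have "\<dots> = th3 (Rm a b c x u v w)"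
      unfolding o unfolding Gam_def Rm_def Let_def th_vec using pos
      by (simp add: field_simps power2_eq_square)
    finally show "th3 (curvature_at ?g x u v w) = th3 (Rm a b c x u v w)" .
  qed
qed


text \<open>The Gram determinant is the sum of \<open>b * c * m1^2\<close>,
  \<open>a * c * m2^2\<close> and \<open>a * b * m3^2\<close>, and the curvature weights these by
  -3, 1 and 1, up to the factor \<open>a / (b * c)\<close>. The second claim keeps the ratio of the
  first square to the sum between 0 and 1.\<close>

lemma sectional_curvature_eq:
  assumes pos: "a > 0" "b > 0" "c > 0"
  defines "m1 \<equiv> \<lambda>u v. th2 u * th3 v - th3 u * th2 v"
  shows "sectional_curvature (diag_metric f a b c) x u v = (let g = diag_metric f a b c x;
      D = g u u * g v v - (g u v)\<^sup>2 in a / (b * c) * (D - 4 * (b * c * (m1 u v)\<^sup>2)) / D)"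
    and "b * c * (m1 u v)\<^sup>2 \<le> diag_metric f a b c x u u * diag_metric f a b c x v v - (diag_metric f a b c x u v)\<^sup>2"
proof -
  let ?g = "diag_metric f a b c x"
  define m2 where "m2 = th3 u * th1 x v - th1 x u * th3 v"
  define m3 where "m3 = th1 x u * th2 v - th2 u * th1 x v"
  have D: "?g u u * ?g v v - (?g u v)\<^sup>2 = b * c * (m1 u v)\<^sup>2 + a * c * m2\<^sup>2 + a * b * m3\<^sup>2"
    unfolding m1_def m2_def m3_def diag_metric_eq by algebra
  have "?g (Rm a b c x u v v) u = a / (b * c) * (- 3 * (b * c * (m1 u v)\<^sup>2) + a * c * m2\<^sup>2 + a * b * m3\<^sup>2)"
    unfolding m1_def m2_def m3_def diag_metric_eq Rm_def Let_def th_vec using pos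
    by (simp add: field_simps power2_eq_square)
  also have "\<dots> = a / (b * c) * ((?g u u * ?g v v - (?g u v)\<^sup>2) - 4 * (b * c * (m1 u v)\<^sup>2))"
    unfolding D by (simp add: algebra_simps)
  finally show "sectional_curvature (diag_metric f a b c) x u v = (let g = diag_metric f a b c x;
      D = g u u * g v v - (g u v)\<^sup>2 in a / (b * c) * (D - 4 * (b * c * (m1 u v)\<^sup>2)) / D)"
    by (simp add: sectional_curvature_def curvature_at_diag_metric[OF pos] Let_def)
  show "b * c * (m1 u v)\<^sup>2 \<le> ?g u u * ?g v v - (?g u v)\<^sup>2"
    unfolding D using pos by simp
qed

lemma sectional_curvature_bound:
  assumes pos: "a > 0" "b > 0" "c > 0"
  shows "\<bar>sectional_curvature (diag_metric f a b c) x u v\<bar> \<le> 3 * (a / (b * c))"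
proof -
  define q where "q = a / (b * c)"
  define D where "D = diag_metric f a b c x u u * diag_metric f a b c x v v - (diag_metric f a b c x u v)\<^sup>2"
  define X where "X = b * c * (th2 u * th3 v - th3 u * th2 v)\<^sup>2"
  have q: "q > 0" using pos by (simp add: q_def)
  have X: "0 \<le> X" "X \<le> D"
    using sectional_curvature_eq(2)[OF pos] pos by (auto simp: X_def D_def)
  have "\<bar>D - 4 * X\<bar> \<le> 3 * D" using X by linarith
  \<comment> \<open>For dependent \<open>u\<close> and \<open>v\<close> the division by
    \<open>D = 0\<close> yields \<open>0\<close>, so the bound covers this case too.\<close>
  then have "\<bar>D - 4 * X\<bar> / D \<le> 3"
    using X by (cases "D = 0") (simp_all add: divide_le_eq)
  then have "q * (\<bar>D - 4 * X\<bar> / D) \<le> q * 3" using q by (intro mult_left_mono) auto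
  then show ?thesis
    using X q unfolding sectional_curvature_eq(1)[OF pos] Let_def q_def[symmetric] D_def[symmetric] X_def[symmetric]
    by (simp add: abs_mult)
qed

text \<open>\<open>ricci\<close> is a trace in the standard basis; the trace is the same in the
  frame, where \<open>Rm\<close> has a closed form.\<close>

lemma trace_in_frame:
  assumes "linear L"
  shows "(\<Sum>i\<in>UNIV. L (axis i 1) $ i) = th1 x (L (f 1 x)) + th2 (L (f 2 x)) + th3 (L (f 3 x))"
proof -
  have ex: "L v = v$1 *\<^sub>R L (axis 1 1) + v$2 *\<^sub>R L (axis 2 1) + v$3 *\<^sub>R L (axis 3 1)" for v
  proof -
    have "v = v$1 *\<^sub>R axis 1 1 + v$2 *\<^sub>R axis 2 1 + v$3 *\<^sub>R axis 3 1"
      by (simp add: vec3_eq_iff axis_def)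
    then have "L v = L (v$1 *\<^sub>R axis 1 1 + v$2 *\<^sub>R axis 2 1 + v$3 *\<^sub>R axis 3 1)" by (rule arg_cong)
    then show ?thesis using assms by (simp only: linear_add linear_scale)
  qed
  have nth: "f 1 x $ i * th1 x y + f 2 x $ i * th2 y + f 3 x $ i * th3 y = y $ i" for y i
    by (subst (4) frame_decomposition[of y x]) simp
  have "th1 x (L (f 1 x)) + th2 (L (f 2 x)) + th3 (L (f 3 x))
     = (\<Sum>i\<in>UNIV. f 1 x $ i * th1 x (L (axis i 1)) + f 2 x $ i * th2 (L (axis i 1)) + f 3 x $ i * th3 (L (axis i 1)))"
    unfolding sum_3 by (subst (1 2 3) ex) (simp add: th_linear)
  then show ?thesis by (simp only: nth)
qed

lemma ricci_diag_metric:
  assumes pos: "a > 0" "b > 0" "c > 0"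
  shows "ricci (diag_metric f a b c) x u v
    = a / (b * c) * (4 * a * th1 x u * th1 x v - 2 * diag_metric f a b c x u v)"
proof -
  have "linear (\<lambda>w. Rm a b c x w u v)"
    by (rule linearI; rule th_eqI[of x])
      (simp_all add: Rm_def Let_def th_linear algebra_simps add_divide_distrib diff_divide_distrib)
  then have "ricci (diag_metric f a b c) x u v
     = th1 x (Rm a b c x (f 1 x) u v) + th2 (Rm a b c x (f 2 x) u v) + th3 (Rm a b c x (f 3 x) u v)"
    unfolding ricci_def curvature_at_diag_metric[OF pos] by (rule trace_in_frame)
  also have "\<dots> = a / (b * c) * (4 * a * th1 x u * th1 x v - 2 * diag_metric f a b c x u v)"
    unfolding Rm_def Let_def th_vec th_frame diag_metric_eq
    using pos by (simp add: field_simps power2_eq_square)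
  finally show ?thesis .
qed

lemma add_3_neq: "i + 1 \<noteq> (i::3)" "i + 2 \<noteq> (i::3)" "i + 1 \<noteq> i + (2::3)"
  by auto
lemma UNIV_minus_3: "UNIV - {i} = {i + 1, i + 2 :: 3}"
proof -
  have "card {i, i + 1, i + 2} = 3" using add_3_neq[of i] by simp
  moreover have "CARD(3) = 3" by simp
  ultimately have U: "{i, i+1, i+2} = UNIV" by (metis card_subset_eq finite_class.finite_UNIV subset_UNIV)
  have "i \<notin> {i + 1, i + 2}" using not_sym[OF add_3_neq(1)[of i]] not_sym[OF add_3_neq(2)[of i]] by (simp only: insert_iff empty_iff simp_thms)
  then show ?thesis unfolding U[symmetric] by (rule Diff_insert_absorb)
qed

text \<open>An orthonormal frame diagonalises Ricci exactly if \<open>th1\<close> vanishes on all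
  but one of its vectors, so one vector is vertical and the other two may rotate. Existence means
  that one form has the prescribed values in all these frames; uniqueness follows from the single
  frame \<open>E\<close>.\<close>

lemma cross_curvature_diag_metric:
  assumes pos: "a > 0" "b > 0" "c > 0"
  shows "cross_curvature (diag_metric f a b c) x u v
    = (a / (b * c))\<^sup>2 * (4 * a * th1 x u * th1 x v - 3 * diag_metric f a b c x u v)"
proof -
  let ?g = "diag_metric f a b c"
  define q where "q = a / (b * c)"
  have q: "q > 0" using pos by (simp add: q_def)
  define H where "H u v = q\<^sup>2 * (4 * a * th1 x u * th1 x v - 3 * ?g x u v)" for u v
  have H: "bilinear H"
    by (auto simp: bilinear_def H_def diag_metric_eq th_linear algebra_simps intro!: linearI)
  have HF: "H (e i) (e j) = (if i = j then \<Prod>k\<in>UNIV - {i}. principal_curvature ?g x e k else 0)"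
    if e: "ricci_frame ?g x e" for e i j
  proof -
    have on: "?g x (e i) (e j) = (if i = j then 1 else 0)" for i j
      using e by (simp add: ricci_frame_def)
    have off: "th1 x (e i) * th1 x (e j) = 0" if "i \<noteq> j" for i j
    proof -
      have "ricci ?g x (e i) (e j) = 0" using e that by (simp add: ricci_frame_def)
      then show ?thesis
        using q pos on[of i j] that unfolding ricci_diag_metric[OF pos] q_def[symmetric] by simp
    qed
    define s where "s i = a * (th1 x (e i))\<^sup>2" for i
    define A :: "real^3^3" where "A = (\<chi> i. vector [sqrt a * th1 x (e i), sqrt b * th2 (e i), sqrt c * th3 (e i)])"
    have sq: "sqrt r * (sqrt r * t) = r * t" if "r > 0" for r t
      using that by (simp add: mult.assoc[symmetric])
    have "A ** transpose A = mat 1"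
    proof -
      have "(A ** transpose A) $ i $ j = mat 1 $ i $ j" for i j
        using on[of i j] pos
        by (simp add: matrix_matrix_mult_def sum_3 transpose_def A_def mat_def diag_metric_eq algebra_simps sq)
      then show ?thesis by (simp add: vec_eq_iff)
    qed
    then have "transpose A ** A = mat 1" by (simp add: matrix_left_right_inverse)
    then have "(transpose A ** A) $ 1 $ 1 = 1" by (simp add: mat_def)
    \<comment> \<open>The rows of \<open>A\<close> are orthonormal, hence so are its columns; the
      first column has this squared norm.\<close>
    then have s1: "s 1 + s 2 + s 3 = 1"
      using pos by (simp add: matrix_matrix_mult_def sum_3 transpose_def A_def s_def power2_eq_square algebra_simps sq)
    have sum1: "s i + s (i + 1) + s (i + 2) = 1" for i
    proof -
      have "(\<Sum>k\<in>UNIV. s k) = s i + (\<Sum>k\<in>UNIV - {i}. s k)" by (rule sum.remove) simp_all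
      then show ?thesis using s1 add_3_neq(3)[of i] unfolding UNIV_minus_3 by (simp add: sum_3)
    qed
    have k: "principal_curvature ?g x e i = q * (1 - 4 * s i)" for i
    proof -
      let ?u = "e (i + 1)" and ?v = "e (i + 2)"
      have 1: "?g x ?u ?u = 1" "?g x ?v ?v = 1" "?g x ?u ?v = 0"
        using on[of "i + 1" "i + 1"] on[of "i + 2" "i + 2"] on[of "i + 1" "i + 2"] add_3_neq(3)[of i] by simp_all
      \<comment> \<open>The Gram matrix of \<open>?u\<close> and \<open>?v\<close> is the identity.
        Taking away the vertical parts leaves the Gram determinant of the horizontal projections,
        and it is \<open>s i\<close>.\<close>
      have "b * c * (th2 ?u * th3 ?v - th3 ?u * th2 ?v)\<^sup>2
         = (?g x ?u ?u - a * (th1 x ?u)\<^sup>2) * (?g x ?v ?v - a * (th1 x ?v)\<^sup>2)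
           - (?g x ?u ?v - a * th1 x ?u * th1 x ?v)\<^sup>2"
        unfolding diag_metric_eq by algebra
      also have "\<dots> = 1 - s (i + 1) - s (i + 2)"
        unfolding 1 s_def by algebra
      finally have "b * c * (th2 ?u * th3 ?v - th3 ?u * th2 ?v)\<^sup>2 = s i" using sum1[of i] by linarith
      then show ?thesis
        unfolding principal_curvature_def sectional_curvature_eq(1)[OF pos] Let_def 1 q_def by simp
    qed
    show ?thesis
    proof (cases "i = j")
      case True
      have z: "s (i + 1) * s (i + 2) = 0"
        using off[OF add_3_neq(3)[of i]] by (auto simp: s_def)
      have "(\<Prod>k\<in>UNIV - {i}. principal_curvature ?g x e k) = q\<^sup>2 * ((1 - 4 * s (i + 1)) * (1 - 4 * s (i + 2)))"
        unfolding UNIV_minus_3 k using add_3_neq(3)[of i] by (simp add: power2_eq_square)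
      also have "(1 - 4 * s (i + 1)) * (1 - 4 * s (i + 2)) = 4 * s i - 3"
      proof -
        have aux: "(1 - 4 * y) * (1 - 4 * z) = 4 * x - 3" if "x + y + z = 1" "y * z = 0" for x y z :: real
          using that by algebra
        show ?thesis by (rule aux[OF sum1 z])
      qed
      finally show ?thesis
        using True on[of i i] by (simp add: H_def s_def power2_eq_square)
    next
      case False
      then show ?thesis using off[OF False] on[of i j] by (simp add: H_def)
    qed
  qed
  define E where "E i = (if i = 1 then (1 / sqrt a) *\<^sub>R f 1 x else if i = 2 then (1 / sqrt b) *\<^sub>R f 2 x
      else (1 / sqrt c) *\<^sub>R f 3 x)" for i :: 3
  have E: "ricci_frame ?g x E"
  proof -
    have "?g x (E i) (E j) = (if i = j then 1 else 0)" for i j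
      using pos exhaust_3[of i] exhaust_3[of j] by (auto simp: E_def diag_metric_eq th_linear th_frame)
    moreover have "th1 x (E i) * th1 x (E j) = 0" if "i \<noteq> j" for i j
      using that exhaust_3[of i] exhaust_3[of j] by (auto simp: E_def th_linear th_frame)
    ultimately show ?thesis by (simp add: ricci_frame_def ricci_diag_metric[OF pos])
  qed
  have "cross_curvature ?g x = H"
    unfolding cross_curvature_def
  proof (rule the_equality)
    show "bilinear H \<and> (\<forall>e. ricci_frame ?g x e \<longrightarrow>
       (\<forall>i j. H (e i) (e j) = (if i = j then \<Prod>k\<in>UNIV - {i}. principal_curvature ?g x e k else 0)))"
      using H HF by blast
    fix h assume h: "bilinear h \<and> (\<forall>e. ricci_frame ?g x e \<longrightarrow>
       (\<forall>i j. h (e i) (e j) = (if i = j then \<Prod>k\<in>UNIV - {i}. principal_curvature ?g x e k else 0)))"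
    have eq: "h (E i) (E j) = H (E i) (E j)" for i j
      using h E HF[OF E, of i j] by simp
    have dec: "u = (sqrt a * th1 x u) *\<^sub>R E 1 + (sqrt b * th2 u) *\<^sub>R E 2 + (sqrt c * th3 u) *\<^sub>R E 3" for u
      using pos frame_decomposition[of u x] by (simp add: E_def)
    have expand: "B u v = (sqrt a * th1 x u) * ((sqrt a * th1 x v) * B (E 1) (E 1) + (sqrt b * th2 v) * B (E 1) (E 2) + (sqrt c * th3 v) * B (E 1) (E 3))
       + (sqrt b * th2 u) * ((sqrt a * th1 x v) * B (E 2) (E 1) + (sqrt b * th2 v) * B (E 2) (E 2) + (sqrt c * th3 v) * B (E 2) (E 3))
       + (sqrt c * th3 u) * ((sqrt a * th1 x v) * B (E 3) (E 1) + (sqrt b * th2 v) * B (E 3) (E 2) + (sqrt c * th3 v) * B (E 3) (E 3))"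
      if "bilinear B" for B :: "real^3 \<Rightarrow> real^3 \<Rightarrow> real" and u v
    proof -
      have "B u v = B ((sqrt a * th1 x u) *\<^sub>R E 1 + (sqrt b * th2 u) *\<^sub>R E 2 + (sqrt c * th3 u) *\<^sub>R E 3)
         ((sqrt a * th1 x v) *\<^sub>R E 1 + (sqrt b * th2 v) *\<^sub>R E 2 + (sqrt c * th3 v) *\<^sub>R E 3)"
        by (rule arg_cong2[of _ _ _ _ B]) (rule dec)+
      then show ?thesis
        by (simp only: bilinear_ladd[OF that] bilinear_radd[OF that] bilinear_lmul[OF that]
            bilinear_rmul[OF that] real_scaleR_def) (simp only: distrib_left add_ac mult_ac)
    qed
    have hb: "bilinear h" using h by blast
    show "h = H"
    proof (intro ext)
      fix u v show "h u v = H u v"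
        by (simp only: expand[OF hb, of u v] expand[OF H, of u v] eq)
    qed
  qed
  then show ?thesis by (simp add: H_def q_def)
qed


end

section \<open>The ordinary differential equations of the flow\<close>

lemma eq_powr_of_has_derivative:
  fixes F :: "real \<Rightarrow> real"
  assumes T: "T > 0" and F: "\<And>s. s > - T \<Longrightarrow> (F has_real_derivative r / (T + s) * F s) (at s)" and t: "t > - T"
  shows "F t = F 0 * (1 + t / T) powr r"
proof -
  define G where "G s = F s * (1 + s / T) powr (- r)" for s
  have pos: "1 + s / T > 0" if "s > - T" for s using T that by (simp add: field_simps)
  have "(G has_real_derivative 0) (at s within {- T<..})" if "s \<in> {- T<..}" for s
  proof -
    have s: "s > - T" using that by simp
    have "(G has_real_derivative r / (T + s) * F s * (1 + s / T) powr (- r)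
       + (1 + s / T) powr (- r) * (- r * (1 / T) / (1 + s / T)) * F s) (at s)"
      unfolding G_def using pos[OF s] T
      by (auto intro!: derivative_eq_intros F[OF s] simp: field_simps powr_diff)
    also have "r / (T + s) * F s * (1 + s / T) powr (- r)
       + (1 + s / T) powr (- r) * (- r * (1 / T) / (1 + s / T)) * F s = 0"
    proof -
      have "1 / T / (1 + s / T) = 1 / (T + s)" using T s pos[OF s] by (simp add: field_simps)
      then have "- r * (1 / T) / (1 + s / T) = - (r / (T + s))"
        by (metis mult.commute mult_minus_right times_divide_eq_right mult.right_neutral)
      then show ?thesis by (simp only:) (simp add: algebra_simps)
    qed
    finally show ?thesis by (rule DERIV_subset) simp
  qed
  then obtain k where "\<forall>s\<in>{- T<..}. G s = k"
    using has_field_derivative_zero_constant[of "{- T<..}" G] by auto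
  then have "G t = G 0" using T t by simp
  then show ?thesis using pos[OF t] by (simp add: G_def powr_minus field_simps)
qed

context milnor begin

text \<open>With \<open>Q = (A / (B * C))^2\<close> the equations read A' = -2QA, B' = 6QB, C' =
  6QC. Hence \<open>B * C / A\<close> has logarithmic derivative \<open>14 * Q\<close>, and its
  square \<open>R = 1 / Q\<close> has derivative 28. So \<open>Q\<close> is known explicitly, the
  equations decouple, and the exponents are -2/28 and 6/28.\<close>

lemma neg_xcf_solution_eq:
  assumes sol: "neg_xcf_solution p f (diag_metric f A0 B0 C0) {- T0<..} g"
    and pos: "A0 > 0" "B0 > 0" "C0 > 0" and T0: "T0 = B0\<^sup>2 * C0\<^sup>2 / (28 * A0\<^sup>2)" and t: "t > - T0"
  shows "g t = diag_metric f (A0 * (1 + t / T0) powr (- 1 / 14)) (B0 * (1 + t / T0) powr (3 / 14))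
      (C0 * (1 + t / T0) powr (3 / 14))"
proof -
  have T0pos: "T0 > 0" using pos by (simp add: T0)
  define A where "A s = g s 0 (f 1 0) (f 1 0)" for s
  define B where "B s = g s 0 (f 2 0) (f 2 0)" for s
  define C where "C s = g s 0 (f 3 0) (f 3 0)" for s
  have g: "g s = diag_metric f (A s) (B s) (C s) \<and> A s > 0 \<and> B s > 0 \<and> C s > 0" if s: "s > - T0" for s
  proof -
    have "s \<in> {- T0<..}" using s by simp
    then obtain a b c where abc: "0 < a" "0 < b" "0 < c" "g s = diag_metric f a b c"
      using sol unfolding neg_xcf_solution_def by blast
    then have "A s = a" "B s = b" "C s = c"
      by (simp_all add: A_def B_def C_def diag_metric_eq th_frame)
    then show ?thesis using abc by simp
  qed
  have g0: "A 0 = A0" "B 0 = B0" "C 0 = C0"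
    using sol by (simp_all add: A_def B_def C_def neg_xcf_solution_def diag_metric_eq th_frame)
  define Q where "Q s = (A s / (B s * C s))\<^sup>2" for s
  have d: "((\<lambda>r. g r 0 u u) has_real_derivative - 2 * (Q s * (4 * A s * th1 0 u * th1 0 u - 3 * g s 0 u u))) (at s)"
    if s: "s > - T0" for s u
  proof -
    have "((\<lambda>r. g r 0 u u) has_real_derivative - 2 * cross_curvature (g s) 0 u u) (at s)"
      using sol s unfolding neg_xcf_solution_def by auto
    then show ?thesis using g[OF s] cross_curvature_diag_metric[of "A s" "B s" "C s" 0 u u]
      by (simp only: Q_def)
  qed
  have dA: "(A has_real_derivative - 2 * (Q s * A s)) (at s)"
    and dB: "(B has_real_derivative 6 * (Q s * B s)) (at s)"
    and dC: "(C has_real_derivative 6 * (Q s * C s)) (at s)" if s: "s > - T0" for s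
    using d[OF s, of "f 1 0"] d[OF s, of "f 2 0"] d[OF s, of "f 3 0"]
    unfolding A_def[symmetric] B_def[symmetric] C_def[symmetric] th_frame
    by (simp_all add: algebra_simps)
  define R where "R s = (B s * C s / A s)\<^sup>2" for s
  have RQ: "Q s * R s = 1" if "s > - T0" for s
    using g[OF that] by (simp add: Q_def R_def field_simps power2_eq_square)
  have "((\<lambda>s. R s - 28 * s) has_real_derivative 0) (at s within {- T0<..})" if "s \<in> {- T0<..}" for s
  proof -
    have s: "s > - T0" using that by simp
    have Ap: "A s \<noteq> 0" using g[OF s] by simp
    have "((\<lambda>s. B s * C s / A s) has_real_derivative
        (((6 * (Q s * B s)) * C s + (6 * (Q s * C s)) * B s) * A s - (B s * C s) * (- 2 * (Q s * A s))) / (A s * A s)) (at s)"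
      by (intro DERIV_divide DERIV_mult dA[OF s] dB[OF s] dC[OF s] Ap)
    also have "(((6 * (Q s * B s)) * C s + (6 * (Q s * C s)) * B s) * A s - (B s * C s) * (- 2 * (Q s * A s))) / (A s * A s)
       = 14 * Q s * (B s * C s / A s)"
      using Ap by (simp add: field_simps)
    finally have D: "((\<lambda>s. B s * C s / A s) has_real_derivative 14 * Q s * (B s * C s / A s)) (at s)" .
    define u where "u = (\<lambda>s. B s * C s / A s)"
    have "(u has_real_derivative 14 * Q s * u s) (at s)" using D by (simp only: u_def)
    from DERIV_mult[OF this this] have "((\<lambda>s. u s * u s) has_real_derivative 28 * (Q s * R s)) (at s)"
      by (rule DERIV_cong) (simp add: R_def u_def power2_eq_square)
    moreover have "(\<lambda>s. u s * u s) = R" by (simp add: R_def u_def power2_eq_square fun_eq_iff)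
    ultimately have "(R has_real_derivative 28 * (Q s * R s)) (at s)" by simp
    then have "(R has_real_derivative 28) (at s)" using RQ[OF s] by simp
    then have "((\<lambda>s. R s - 28 * s) has_real_derivative 28 - 28 * 1) (at s)"
      by (intro DERIV_diff DERIV_cmult DERIV_ident)
    then show ?thesis by (simp add: has_field_derivative_at_within)
  qed
  then obtain k where k: "\<forall>s\<in>{- T0<..}. R s - 28 * s = k"
    using has_field_derivative_zero_constant[of "{- T0<..}" "\<lambda>s. R s - 28 * s"] by auto
  have "k = R 0" using bspec[OF k, of 0] T0pos by simp
  \<comment> \<open>This is the origin of \<open>T0\<close>: the linear function \<open>R\<close>
    vanishes at \<open>- T0\<close>.\<close>
  also have "\<dots> = 28 * T0" using pos by (simp add: R_def g0 T0 power_divide power_mult_distrib)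
  finally have R: "R s = 28 * (T0 + s)" if "s > - T0" for s using bspec[OF k, of s] that by simp
  have Q: "Q s = 1 / 28 / (T0 + s)" if "s > - T0" for s
    using RQ[OF that] R[OF that] that by (simp add: field_simps)
  have "A t = A 0 * (1 + t / T0) powr (- 1 / 14)"
  proof (rule eq_powr_of_has_derivative[OF T0pos _ t])
    fix s assume s: "s > - T0"
    have "- 2 * (Q s * A s) = - 1 / 14 / (T0 + s) * A s"
      unfolding Q[OF s] using s by (simp add: divide_simps)
    with dA[OF s] show "(A has_real_derivative - 1 / 14 / (T0 + s) * A s) (at s)" by simp
  qed
  moreover have "B t = B 0 * (1 + t / T0) powr (3 / 14)"
  proof (rule eq_powr_of_has_derivative[OF T0pos _ t])
    fix s assume s: "s > - T0"
    have "6 * (Q s * B s) = 3 / 14 / (T0 + s) * B s"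
      unfolding Q[OF s] using s by (simp add: divide_simps)
    with dB[OF s] show "(B has_real_derivative 3 / 14 / (T0 + s) * B s) (at s)" by simp
  qed
  moreover have "C t = C 0 * (1 + t / T0) powr (3 / 14)"
  proof (rule eq_powr_of_has_derivative[OF T0pos _ t])
    fix s assume s: "s > - T0"
    have "6 * (Q s * C s) = 3 / 14 / (T0 + s) * C s"
      unfolding Q[OF s] using s by (simp add: divide_simps)
    with dC[OF s] show "(C has_real_derivative 3 / 14 / (T0 + s) * C s) (at s)" by simp
  qed
  ultimately show ?thesis using g[OF t] g0 by simp
qed

end

section \<open>Lengths of paths\<close>

definition admissible :: "tensor2 \<Rightarrow> (real \<Rightarrow> real^3) \<Rightarrow> bool" where
  "admissible g \<gamma> \<longleftrightarrow> valid_path \<gamma> \<and> speed g \<gamma> integrable_on {0..1}"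

definition len :: "tensor2 \<Rightarrow> (real \<Rightarrow> real^3) \<Rightarrow> real" where
  "len g \<gamma> = integral {0..1} (speed g \<gamma>)"

text \<open>Homogeneity governs the speed under affine reparametrisation, nonnegativity the sign of
  lengths; this is what joining and reversing paths require of a metric.\<close>

definition quadratic :: "tensor2 \<Rightarrow> bool" where
  "quadratic g \<longleftrightarrow> (\<forall>x u r. g x (r *\<^sub>R u) (r *\<^sub>R u) = r\<^sup>2 * g x u u) \<and> (\<forall>x u. 0 \<le> g x u u)"

lemma riem_dist_eq:
  "riem_dist p g x y = Inf {len g \<gamma> | \<gamma>. admissible g \<gamma> \<and> p (\<gamma> 0) = x \<and> p (\<gamma> 1) = y}"
  unfolding riem_dist_def admissible_def len_def by (simp add: conj_assoc)

lemma speed_nonneg: "quadratic g \<Longrightarrow> 0 \<le> speed g \<gamma> s"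
  by (simp add: quadratic_def speed_def)

text \<open>If the speed is not integrable, \<open>integral\<close> has the default value
  \<open>0\<close>.\<close>

lemma len_nonneg: "quadratic g \<Longrightarrow> 0 \<le> len g \<gamma>"
  unfolding len_def
  by (cases "speed g \<gamma> integrable_on {0..1}")
    (auto intro: integral_nonneg speed_nonneg simp: not_integrable_integral)

lemma riem_dist_le:
  assumes "quadratic g" "admissible g \<gamma>" "p (\<gamma> 0) = x" "p (\<gamma> 1) = y"
  shows "riem_dist p g x y \<le> len g \<gamma>"
  unfolding riem_dist_eq
  by (rule cInf_lower) (use assms in \<open>auto intro!: bdd_belowI[of _ 0] len_nonneg\<close>)

lemma valid_path_has_vector_derivative:
  assumes "valid_path \<gamma>"
  obtains S where "finite S"
    "\<And>s. s \<in> {0..1} - S \<Longrightarrow> (\<gamma> has_vector_derivative vector_derivative \<gamma> (at s)) (at s)"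
  using assms unfolding valid_path_def piecewise_C1_differentiable_on_def C1_differentiable_on_eq
  by (metis vector_derivative_works)

lemma speed_eq:
  "(\<gamma> has_vector_derivative v) (at s) \<Longrightarrow> speed g \<gamma> s = sqrt (g (\<gamma> s) v v)"
  by (simp add: speed_def vector_derivative_at)

text \<open>Stated locally, on an open set \<open>T\<close> around \<open>s\<close>, to serve both
  halves of a joined path as well as a reversed path.\<close>

lemma speed_scaled:
  assumes q: "quadratic g" and d: "(\<gamma> has_vector_derivative vector_derivative \<gamma> (at (m * s + c))) (at (m * s + c))"
    and T: "open T" "s \<in> T" "\<And>r. r \<in> T \<Longrightarrow> \<delta> r = \<gamma> (m * r + c)"
  shows "speed g \<delta> s = \<bar>m\<bar> * speed g \<gamma> (m * s + c)"
proof -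
  have "((\<lambda>r. m * r + c) has_vector_derivative m) (at s)"
    by (auto intro!: derivative_eq_intros)
  from vector_diff_chain_at[OF this d]
  have "((\<lambda>r. \<gamma> (m * r + c)) has_vector_derivative m *\<^sub>R vector_derivative \<gamma> (at (m * s + c))) (at s)"
    by (simp add: o_def)
  then have "(\<delta> has_vector_derivative m *\<^sub>R vector_derivative \<gamma> (at (m * s + c))) (at s)"
    by (rule has_vector_derivative_transform_within_open[OF _ T(1,2)]) (simp add: T(3))
  then have "speed g \<delta> s = sqrt (g (\<delta> s) (m *\<^sub>R vector_derivative \<gamma> (at (m * s + c)))
      (m *\<^sub>R vector_derivative \<gamma> (at (m * s + c))))"
    by (rule speed_eq)
  also have "\<dots> = \<bar>m\<bar> * speed g \<gamma> (m * s + c)"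
  proof -
    have "g x (m *\<^sub>R v) (m *\<^sub>R v) = m\<^sup>2 * g x v v" for x v
      using q unfolding quadratic_def by blast
    then show ?thesis unfolding T(3)[OF T(2)] speed_def by (simp only: real_sqrt_mult real_sqrt_abs)
  qed
  finally show ?thesis .
qed

lemma admissible_join:
  assumes q: "quadratic g" and 1: "admissible g \<gamma>\<^sub>1" and 2: "admissible g \<gamma>\<^sub>2" and e: "\<gamma>\<^sub>1 1 = \<gamma>\<^sub>2 0"
  shows "admissible g (\<gamma>\<^sub>1 +++ \<gamma>\<^sub>2)" "len g (\<gamma>\<^sub>1 +++ \<gamma>\<^sub>2) = len g \<gamma>\<^sub>1 + len g \<gamma>\<^sub>2"
proof -
  let ?\<gamma> = "\<gamma>\<^sub>1 +++ \<gamma>\<^sub>2"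
  obtain S where S: "finite S"
    "\<And>s. s \<in> {0..1} - S \<Longrightarrow> (\<gamma>\<^sub>1 has_vector_derivative vector_derivative \<gamma>\<^sub>1 (at s)) (at s)"
    using valid_path_has_vector_derivative 1 unfolding admissible_def by blast
  obtain T where T: "finite T"
    "\<And>s. s \<in> {0..1} - T \<Longrightarrow> (\<gamma>\<^sub>2 has_vector_derivative vector_derivative \<gamma>\<^sub>2 (at s)) (at s)"
    using valid_path_has_vector_derivative 2 unfolding admissible_def by blast
  have h1: "((\<lambda>s. 2 * speed g \<gamma>\<^sub>1 (2 * s + 0)) has_integral len g \<gamma>\<^sub>1) {0..1/2}"
  proof -
    have "(speed g \<gamma>\<^sub>1 has_integral len g \<gamma>\<^sub>1) (cbox 0 1)"
      using 1 by (simp add: admissible_def len_def integrable_integral)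
    from has_integral_mult_right[OF has_integral_affinity[OF this, of 2 0], of 2]
    show ?thesis by (simp add: image_divide_atLeastAtMost)
  qed
  have h2: "((\<lambda>s. 2 * speed g \<gamma>\<^sub>2 (2 * s + (-1))) has_integral len g \<gamma>\<^sub>2) {1/2..1}"
  proof -
    have "(speed g \<gamma>\<^sub>2 has_integral len g \<gamma>\<^sub>2) (cbox 0 1)"
      using 2 by (simp add: admissible_def len_def integrable_integral)
    from has_integral_mult_right[OF has_integral_affinity[OF this, of 2 "-1"], of 2]
    have "((\<lambda>s. 2 * speed g \<gamma>\<^sub>2 (2 * s + (-1))) has_integral len g \<gamma>\<^sub>2) ((\<lambda>x. x / 2 + 1 / 2) ` {0..1})"
      by simp
    also have "(\<lambda>x::real. x / 2 + 1 / 2) ` {0..1} = {1/2..1}"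
      using image_affinity_atLeastAtMost[of "1/2" "1/2" 0 "1::real"] by simp
    finally show ?thesis .
  qed
  have "(speed g ?\<gamma> has_integral len g \<gamma>\<^sub>1) {0..1/2}"
  proof (rule has_integral_spike_finite[OF _ _ h1])
    show "finite ({0, 1/2} \<union> (\<lambda>s. s / 2) ` S)" using S by simp
    fix s :: real assume s: "s \<in> {0..1/2} - ({0, 1/2} \<union> (\<lambda>s. s / 2) ` S)"
    then have "2 * s \<notin> S" by (metis Diff_iff UnCI image_eqI nonzero_mult_div_cancel_left zero_neq_numeral)
    then have "(\<gamma>\<^sub>1 has_vector_derivative vector_derivative \<gamma>\<^sub>1 (at (2 * s + 0))) (at (2 * s + 0))"
      using s S(2)[of "2 * s"] by simp
    from speed_scaled[OF q this, of "{..<1/2}" ?\<gamma>] s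
    show "speed g ?\<gamma> s = 2 * speed g \<gamma>\<^sub>1 (2 * s + 0)" by (simp add: joinpaths_def)
  qed
  moreover have "(speed g ?\<gamma> has_integral len g \<gamma>\<^sub>2) {1/2..1}"
  proof (rule has_integral_spike_finite[OF _ _ h2])
    show "finite ({1/2, 1} \<union> (\<lambda>s. (s + 1) / 2) ` T)" using T by simp
    fix s :: real assume s: "s \<in> {1/2..1} - ({1/2, 1} \<union> (\<lambda>s. (s + 1) / 2) ` T)"
    then have "2 * s + (-1) \<notin> T" by (auto simp: image_iff)
    then have "(\<gamma>\<^sub>2 has_vector_derivative vector_derivative \<gamma>\<^sub>2 (at (2 * s + (-1)))) (at (2 * s + (-1)))"
      using s T(2)[of "2 * s + (-1)"] by simp
    from speed_scaled[OF q this, of "{1/2<..}" ?\<gamma>] s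
    show "speed g ?\<gamma> s = 2 * speed g \<gamma>\<^sub>2 (2 * s + (-1))" by (simp add: joinpaths_def)
  qed
  ultimately have "(speed g ?\<gamma> has_integral len g \<gamma>\<^sub>1 + len g \<gamma>\<^sub>2) {0..1}"
    by (intro has_integral_combine[of 0 "1/2" "1::real"]) simp_all
  moreover have "valid_path ?\<gamma>"
    using 1 2 e by (auto simp: admissible_def pathfinish_def pathstart_def intro: valid_path_join)
  ultimately show "admissible g ?\<gamma>" "len g ?\<gamma> = len g \<gamma>\<^sub>1 + len g \<gamma>\<^sub>2"
    unfolding admissible_def len_def by auto
qed

lemma admissible_reverse:
  assumes q: "quadratic g" and 1: "admissible g \<gamma>"
  shows "admissible g (reversepath \<gamma>)" "len g (reversepath \<gamma>) = len g \<gamma>"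
proof -
  obtain S where S: "finite S"
    "\<And>s. s \<in> {0..1} - S \<Longrightarrow> (\<gamma> has_vector_derivative vector_derivative \<gamma> (at s)) (at s)"
    using valid_path_has_vector_derivative 1 unfolding admissible_def by blast
  have h: "((\<lambda>s. speed g \<gamma> (- 1 * s + 1)) has_integral len g \<gamma>) {0..1}"
  proof -
    have "(speed g \<gamma> has_integral len g \<gamma>) (cbox 0 1)"
      using 1 by (simp add: admissible_def len_def integrable_integral)
    from has_integral_affinity[OF this, of "-1" 1]
    have "((\<lambda>s. speed g \<gamma> (- 1 * s + 1)) has_integral len g \<gamma>) ((\<lambda>x. 1 - x) ` {0..1})"
      by simp
    also have "(\<lambda>x::real. 1 - x) ` {0..1} = {0..1}" by simp
    finally show ?thesis .
  qed
  have "(speed g (reversepath \<gamma>) has_integral len g \<gamma>) {0..1}"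
  proof (rule has_integral_spike_finite[OF _ _ h])
    show "finite ((\<lambda>s. 1 - s) ` S)" using S by simp
    fix s :: real assume s: "s \<in> {0..1} - (\<lambda>s. 1 - s) ` S"
    then have "- 1 * s + 1 \<notin> S" by (auto simp: image_iff)
    then have "(\<gamma> has_vector_derivative vector_derivative \<gamma> (at (- 1 * s + 1))) (at (- 1 * s + 1))"
      using s S(2)[of "- 1 * s + 1"] by simp
    from speed_scaled[OF q this, of UNIV "reversepath \<gamma>"] s
    show "speed g (reversepath \<gamma>) s = speed g \<gamma> (- 1 * s + 1)" by (simp add: reversepath_def)
  qed
  moreover have "valid_path (reversepath \<gamma>)"
    using 1 by (simp add: admissible_def valid_path_imp_reverse)
  ultimately show "admissible g (reversepath \<gamma>)" "len g (reversepath \<gamma>) = len g \<gamma>"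
    unfolding admissible_def len_def by auto
qed

section \<open>Images of paths under isometries\<close>

lemma smooth_imp_C1:
  fixes \<phi> :: "real^3 \<Rightarrow> real^3"
  assumes "smooth \<phi>"
  shows "(\<phi> has_derivative frechet_derivative \<phi> (at x)) (at x)"
    and "continuous_on UNIV (\<lambda>x. frechet_derivative \<phi> (at x) v)"
proof -
  have d: "differentiable_order (Suc (Suc 0)) \<phi>" using assms by (simp add: smooth_def)
  then show "(\<phi> has_derivative frechet_derivative \<phi> (at x)) (at x)"
    by (metis differentiable_order.simps(2) frechet_derivative_works)
  have "(\<lambda>x. frechet_derivative \<phi> (at x) v) differentiable (at x)" for x
    using d by simp
  then show "continuous_on UNIV (\<lambda>x. frechet_derivative \<phi> (at x) v)"
    by (auto intro!: continuous_at_imp_continuous_on differentiable_imp_continuous_within)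
qed

lemma admissible_isometry:
  assumes \<phi>: "smooth \<phi>" and g: "preserves \<phi> g" and 1: "admissible g \<gamma>"
  shows "admissible g (\<phi> \<circ> \<gamma>)" "len g (\<phi> \<circ> \<gamma>) = len g \<gamma>"
proof -
  obtain S where S: "finite S" and C1: "\<gamma> C1_differentiable_on ({0..1} - S)" and c: "continuous_on {0..1} \<gamma>"
    using 1 unfolding admissible_def valid_path_def piecewise_C1_differentiable_on_def by auto
  obtain D where D: "\<And>s. s \<in> {0..1} - S \<Longrightarrow> (\<gamma> has_vector_derivative D s) (at s)"
    and cD: "continuous_on ({0..1} - S) D"
    using C1 unfolding C1_differentiable_on_def by blast
  let ?d = "\<lambda>x. frechet_derivative \<phi> (at x)"
  have d: "((\<phi> \<circ> \<gamma>) has_vector_derivative ?d (\<gamma> s) (D s)) (at s)" if "s \<in> {0..1} - S" for s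
    using diff_chain_at[OF D[OF that, unfolded has_vector_derivative_def] smooth_imp_C1(1)[OF \<phi>]]
      linear_scale[OF has_derivative_linear[OF smooth_imp_C1(1)[OF \<phi>]]]
    by (simp add: has_vector_derivative_def o_def)
  have cont: "continuous_on UNIV \<phi>"
    using smooth_imp_C1(1)[OF \<phi>] by (intro has_derivative_continuous_on) (auto intro: has_derivative_at_withinI)
  have "continuous_on ({0..1} - S) (\<lambda>s. ?d (\<gamma> s) (D s))"
  proof -
    \<comment> \<open>\<open>smooth_imp_C1\<close> gives continuity of the differential for a fixed
      vector only; expanding the vector in the standard basis yields continuity along the
      path.\<close>
    have ex: "?d x v = (\<Sum>i\<in>UNIV. v$i *\<^sub>R ?d x (axis i 1))" for x v
    proof -
      have lin: "linear (?d x)" by (rule has_derivative_linear[OF smooth_imp_C1(1)[OF \<phi>]])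
      have "(\<Sum>i\<in>UNIV. v$i *\<^sub>R axis i 1) = v"
        using basis_expansion[of v] by (simp only: scalar_mult_eq_scaleR)
      then have "?d x v = ?d x (\<Sum>i\<in>UNIV. v$i *\<^sub>R axis i 1)" by (rule arg_cong[OF sym])
      also have "\<dots> = (\<Sum>i\<in>UNIV. v$i *\<^sub>R ?d x (axis i 1))"
        by (simp only: linear_sum[OF lin] linear_scale[OF lin])
      finally show ?thesis .
    qed
    have "continuous_on ({0..1} - S) \<gamma>" by (rule continuous_on_subset[OF c]) auto
    then have "continuous_on ({0..1} - S) (\<lambda>s. ?d (\<gamma> s) (axis i 1))" for i
      by (rule continuous_on_compose2[OF smooth_imp_C1(2)[OF \<phi>]]) auto
    then have "continuous_on ({0..1} - S) (\<lambda>s. \<Sum>i\<in>UNIV. D s$i *\<^sub>R ?d (\<gamma> s) (axis i 1))"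
      by (intro continuous_on_sum continuous_on_scaleR bounded_linear.continuous_on[OF bounded_linear_vec_nth cD])
    then show ?thesis by (simp only: ex[symmetric])
  qed
  then have "(\<phi> \<circ> \<gamma>) C1_differentiable_on ({0..1} - S)"
    unfolding C1_differentiable_on_def using d by (intro exI[of _ "\<lambda>s. ?d (\<gamma> s) (D s)"] conjI ballI)
  moreover have "continuous_on {0..1} (\<phi> \<circ> \<gamma>)"
    by (rule continuous_on_compose[OF c continuous_on_subset[OF cont]]) simp
  ultimately have v: "valid_path (\<phi> \<circ> \<gamma>)"
    using S unfolding valid_path_def piecewise_C1_differentiable_on_def by blast
  have s: "(speed g \<gamma> has_integral len g \<gamma>) {0..1}"
    using 1 by (simp add: admissible_def len_def integrable_integral)
  have "(speed g (\<phi> \<circ> \<gamma>) has_integral len g \<gamma>) {0..1}"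
  proof (rule has_integral_spike_finite[OF S _ s])
    fix s assume "s \<in> {0..1} - S"
    then show "speed g (\<phi> \<circ> \<gamma>) s = speed g \<gamma> s"
      using g speed_eq[OF d[of s]] speed_eq[OF D[of s]] by (simp add: preserves_def)
  qed
  then show "admissible g (\<phi> \<circ> \<gamma>)" "len g (\<phi> \<circ> \<gamma>) = len g \<gamma>"
    using v unfolding admissible_def len_def by auto
qed

text \<open>A mean value inequality with variable bound. The derivative is replaced by
  \<open>0\<close> on the finite set where it may fail to exist.\<close>

lemma norm_diff_le_integral_bound:
  fixes V :: "real \<Rightarrow> 'a::euclidean_space"
  assumes S: "finite S" and le: "s \<le> s'" and c: "continuous_on {s..s'} V"
    and d: "\<And>r. r \<in> {s..s'} - S \<Longrightarrow> (V has_vector_derivative V' r) (at r)"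
    and b: "\<And>r. r \<in> {s..s'} - S \<Longrightarrow> norm (V' r) \<le> k * h r"
    and h: "h integrable_on {s..s'}" "\<And>r. 0 \<le> h r" and k: "0 \<le> k"
  shows "norm (V s' - V s) \<le> k * integral {s..s'} h"
proof -
  let ?V = "\<lambda>r. if r \<in> S then 0 else V' r"
  have i: "(?V has_integral (V s' - V s)) {s..s'}"
    by (rule fundamental_theorem_of_calculus_strong[OF S le _ c]) (use d in auto)
  have "norm (integral {s..s'} ?V) \<le> integral {s..s'} (\<lambda>r. k * h r)"
  proof (rule integral_norm_bound_integral)
    show "?V integrable_on {s..s'}" using i by blast
    show "(\<lambda>r. k * h r) integrable_on {s..s'}" using h(1) integrable_on_mult_right by blast
    show "norm (?V r) \<le> k * h r" if "r \<in> {s..s'}" for r using b[of r] that h(2)[of r] k by auto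
  qed
  then show ?thesis using integral_unique[OF i] by simp
qed

section \<open>Exponential coordinates, segments and the length of paths\<close>

context milnor begin

text \<open>The functions \<open>y1\<close>, \<open>th2\<close>, \<open>th3\<close> are exponential coordinates with respect to the frame, and
  \<open>w1 x x'\<close> is the first exponential coordinate of \<open>x\<^sup>-\<^sup>1 x'\<close>. Segments are left translates of
  one-parameter subgroups.\<close>

definition y1 :: "real^3 \<Rightarrow> real" where
  "y1 x = (x$3 - x$1 * x$2 / 2 - F0 2 $ 3 * th2 x - F0 3 $ 3 * th3 x) / kap"

definition Yinv :: "real \<Rightarrow> real \<Rightarrow> real \<Rightarrow> real^3" where
  "Yinv r s t = (let x1 = s * F0 2 $ 1 + t * F0 3 $ 1; x2 = s * F0 2 $ 2 + t * F0 3 $ 2 in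
     vector [x1, x2, r * kap + x1 * x2 / 2 + F0 2 $ 3 * s + F0 3 $ 3 * t])"

lemma Yinv_nth:
  "Yinv r s t $ 1 = s * F0 2 $ 1 + t * F0 3 $ 1" "Yinv r s t $ 2 = s * F0 2 $ 2 + t * F0 3 $ 2"
  "Yinv r s t $ 3 = r * kap + (s * F0 2 $ 1 + t * F0 3 $ 1) * (s * F0 2 $ 2 + t * F0 3 $ 2) / 2 + F0 2 $ 3 * s + F0 3 $ 3 * t"
  by (simp_all add: Yinv_def Let_def)

lemma coordinates_Yinv [simp]: "th2 (Yinv r s t) = s" "th3 (Yinv r s t) = t" "y1 (Yinv r s t) = r"
proof -
  have "th2 (Yinv r s t) = s * (F0 2 $ 1 * F0 3 $ 2 - F0 3 $ 1 * F0 2 $ 2) / (2 * kap)"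
    unfolding th2_def Yinv_nth by (simp add: algebra_simps)
  then show 2: "th2 (Yinv r s t) = s" unfolding det using kap_nz by simp
  have "th3 (Yinv r s t) = t * (F0 2 $ 1 * F0 3 $ 2 - F0 3 $ 1 * F0 2 $ 2) / (2 * kap)"
    unfolding th3_def Yinv_nth by (simp add: algebra_simps)
  then show 3: "th3 (Yinv r s t) = t" unfolding det using kap_nz by simp
  show "y1 (Yinv r s t) = r" unfolding y1_def 2 3 unfolding Yinv_nth using kap_nz by simp
qed

lemma Yinv_coordinates [simp]: "Yinv (y1 x) (th2 x) (th3 x) = x"
proof -
  have "y1 x * kap = x$3 - x$1 * x$2 / 2 - F0 2 $ 3 * th2 x - F0 3 $ 3 * th3 x"
    using kap_nz by (simp add: y1_def)
  then show ?thesis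
    using nth_of_th(1,2)[of x] by (simp add: vec3_eq_iff Yinv_nth)
qed

lemma coordinates_eqI: "y1 x = y1 x' \<Longrightarrow> th2 x = th2 x' \<Longrightarrow> th3 x = th3 x' \<Longrightarrow> x = x'"
  by (metis Yinv_coordinates)

text \<open>The contact form in exponential coordinates is
  \<open>dy1 - (th2 dth3 - th3 dth2)\<close>. The bracket is, up to scale, twice the rate at which
  area is swept out as seen from the origin; all area estimates come from it.\<close>

lemma y1_has_derivative: "(y1 has_derivative (\<lambda>h. th1 x h + th2 x * th3 h - th3 x * th2 h)) (at x)"
proof -
  have "((\<lambda>x. (x$3 - x$1 * x$2 * (1/2) - F0 2 $ 3 * th2 x - F0 3 $ 3 * th3 x)) has_derivative
     (\<lambda>h. h$3 - (x$1 * h$2 + h$1 * x$2) * (1/2) - F0 2 $ 3 * th2 h - F0 3 $ 3 * th3 h)) (at x)"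
    by (intro has_derivative_diff has_derivative_mult_left has_derivative_mult has_derivative_mult_right
        has_derivative_vec_nth th2_has_derivative th3_has_derivative has_derivative_ident)
  from bounded_linear.has_derivative[OF bounded_linear_divide[of kap] this]
  have "(y1 has_derivative (\<lambda>h. (h$3 - (x$1 * h$2 + h$1 * x$2) * (1/2) - F0 2 $ 3 * th2 h - F0 3 $ 3 * th3 h) / kap)) (at x)"
    by (simp add: y1_def[abs_def])
  then show ?thesis
  proof (rule has_derivative_eq_rhs, intro ext)
    fix h
    have "th2 x * th3 h - th3 x * th2 h = (x$1 * h$2 - x$2 * h$1) / (2 * kap)"
      unfolding area_th using kap_nz by simp
    then have "th1 x h + th2 x * th3 h - th3 x * th2 h = th1 x h + (x$1 * h$2 - x$2 * h$1) / (2 * kap)"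
      by linarith
    then show "(h$3 - (x$1 * h$2 + h$1 * x$2) * (1/2) - F0 2 $ 3 * th2 h - F0 3 $ 3 * th3 h) / kap
       = th1 x h + th2 x * th3 h - th3 x * th2 h"
      using kap_nz by (simp only: th1_def) (simp add: field_simps)
  qed
qed

definition w1 :: "real^3 \<Rightarrow> real^3 \<Rightarrow> real" where
  "w1 x x' = y1 x' - y1 x - (th2 x * th3 x' - th3 x * th2 x')"

lemma w1_self [simp]: "w1 x x = 0"
  by (simp add: w1_def)

definition seg :: "real^3 \<Rightarrow> real^3 \<Rightarrow> real \<Rightarrow> real^3" where
  "seg x x' s = Yinv (y1 x + s * (y1 x' - y1 x)) (th2 x + s * (th2 x' - th2 x)) (th3 x + s * (th3 x' - th3 x))"

lemma seg_ends [simp]: "seg x x' 0 = x" "seg x x' 1 = x'"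
  by (simp_all add: seg_def)

lemma coordinates_seg: "y1 (seg x x' s) = y1 x + s * (y1 x' - y1 x)"
  "th2 (seg x x' s) = th2 x + s * (th2 x' - th2 x)" "th3 (seg x x' s) = th3 x + s * (th3 x' - th3 x)"
  by (simp_all add: seg_def)

lemma has_vector_derivative_vec3:
  fixes \<gamma> :: "real \<Rightarrow> real^3"
  assumes "\<And>i. ((\<lambda>s. \<gamma> s $ i) has_real_derivative v $ i) (at s)"
  shows "(\<gamma> has_vector_derivative v) (at s)"
proof -
  have e: "w = (\<Sum>i\<in>UNIV. w $ i *\<^sub>R axis i 1)" for w :: "real^3"
    using basis_expansion[of w] by (simp only: scalar_mult_eq_scaleR)
  have "((\<lambda>s. \<Sum>i\<in>UNIV. \<gamma> s $ i *\<^sub>R axis i (1::real)) has_vector_derivative (\<Sum>i\<in>UNIV. v $ i *\<^sub>R axis i 1)) (at s)"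
    using assms unfolding has_real_derivative_iff_has_vector_derivative
    by (intro has_vector_derivative_sum bounded_linear.has_vector_derivative[OF bounded_linear_scaleR_left])
  then show ?thesis by (simp only: e[symmetric])
qed

text \<open>The frame components of the velocity are constant, so a segment has constant speed for
  every diagonal metric and its length is the norm \<open>NN\<close>.\<close>

lemma seg_has_vector_derivative:
  "(seg x x' has_vector_derivative vec (seg x x' s) (w1 x x') (th2 x' - th2 x) (th3 x' - th3 x)) (at s)"
proof (rule has_vector_derivative_vec3)
  let ?a = "th2 x' - th2 x" and ?b = "th3 x' - th3 x" and ?c = "y1 x' - y1 x"
  let ?X = "\<lambda>s. (th2 x + s * ?a) * F0 2 $ 1 + (th3 x + s * ?b) * F0 3 $ 1"
  let ?Y = "\<lambda>s. (th2 x + s * ?a) * F0 2 $ 2 + (th3 x + s * ?b) * F0 3 $ 2"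
  have n: "seg x x' s $ 1 = ?X s" "seg x x' s $ 2 = ?Y s"
    "seg x x' s $ 3 = (y1 x + s * ?c) * kap + ?X s * ?Y s / 2 + F0 2 $ 3 * (th2 x + s * ?a) + F0 3 $ 3 * (th3 x + s * ?b)" for s
    unfolding seg_def Yinv_nth by simp_all
  have dX: "(?X has_real_derivative ?a * F0 2 $ 1 + ?b * F0 3 $ 1) (at s)"
    and dY: "(?Y has_real_derivative ?a * F0 2 $ 2 + ?b * F0 3 $ 2) (at s)"
    by (auto intro!: derivative_eq_intros)
  have v: "vec z r p q $ 1 = p * F0 2 $ 1 + q * F0 3 $ 1" "vec z r p q $ 2 = p * F0 2 $ 2 + q * F0 3 $ 2"
    "vec z r p q $ 3 = r * kap + p * (F0 2 $ 3 + z$1 * F0 2 $ 2) + q * (F0 3 $ 3 + z$1 * F0 3 $ 2)" for z r p q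
    by (simp_all add: vec_def frame_nth frame1 kap_def)
  let ?X' = "?a * F0 2 $ 1 + ?b * F0 3 $ 1" and ?Y' = "?a * F0 2 $ 2 + ?b * F0 3 $ 2"
  have lin: "((\<lambda>s. k * (u + s * v)) has_real_derivative k * v) (at s)"
    "((\<lambda>s. (u + s * v) * k) has_real_derivative v * k) (at s)" for k u v :: real
    by (auto intro!: derivative_eq_intros)
  have "((\<lambda>s. (y1 x + s * ?c) * kap + ?X s * ?Y s / 2 + F0 2 $ 3 * (th2 x + s * ?a) + F0 3 $ 3 * (th3 x + s * ?b))
     has_real_derivative ?c * kap + (?X' * ?Y s + ?Y' * ?X s) / 2 + F0 2 $ 3 * ?a + F0 3 $ 3 * ?b) (at s)"
    by (rule DERIV_add[OF DERIV_add[OF DERIV_add[OF lin(2) DERIV_cdivide[OF DERIV_mult[OF dX dY]]] lin(1)] lin(1)])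
  moreover have "?c * kap + (?X' * ?Y s + ?Y' * ?X s) / 2 + F0 2 $ 3 * ?a + F0 3 $ 3 * ?b
      = vec (seg x x' s) (w1 x x') ?a ?b $ 3"
  proof -
    have k: "kap = (F0 2 $ 1 * F0 3 $ 2 - F0 3 $ 1 * F0 2 $ 2) / 2" unfolding det by simp
    show ?thesis unfolding v n w1_def k by (simp add: field_simps)
  qed
  ultimately have 3: "((\<lambda>s. seg x x' s $ 3) has_real_derivative vec (seg x x' s) (w1 x x') ?a ?b $ 3) (at s)"
    unfolding n by simp
  have 1: "((\<lambda>s. seg x x' s $ 1) has_real_derivative vec (seg x x' s) (w1 x x') ?a ?b $ 1) (at s)"
    and 2: "((\<lambda>s. seg x x' s $ 2) has_real_derivative vec (seg x x' s) (w1 x x') ?a ?b $ 2) (at s)"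
    using dX dY unfolding n v by simp_all
  show "((\<lambda>s. seg x x' s $ i) has_real_derivative vec (seg x x' s) (w1 x x') ?a ?b $ i) (at s)" for i
    using exhaust_3[of i] by (elim disjE) (simp_all only: 1 2 3)
qed

lemma continuous_on_coordinates: "continuous_on S y1" "continuous_on S th2" "continuous_on S th3"
  "continuous_on S (th1 x)"
proof -
  show "continuous_on S y1"
    by (rule continuous_at_imp_continuous_on, rule ballI, rule has_derivative_continuous[OF y1_has_derivative])
  show "continuous_on S th2" "continuous_on S th3"
    by (rule continuous_at_imp_continuous_on, rule ballI,
        rule has_derivative_continuous[OF th2_has_derivative[OF has_derivative_ident]])
      (rule continuous_at_imp_continuous_on, rule ballI,
        rule has_derivative_continuous[OF th3_has_derivative[OF has_derivative_ident]])
  have "linear (th1 x)" by (rule linearI) (simp_all add: th_linear)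
  then show "continuous_on S (th1 x)" by (simp add: linear_continuous_on linear_conv_bounded_linear)
qed

lemma continuous_on_vec_of:
  assumes "continuous_on S \<gamma>" shows "continuous_on S (\<lambda>s. vec (\<gamma> s) p q r)"
proof -
  have c: "continuous_on UNIV (f i)" for i
    by (rule continuous_at_imp_continuous_on, rule ballI, rule has_derivative_continuous[OF frame_has_derivative])
  show ?thesis
    unfolding vec_def by (intro continuous_on_add continuous_on_scaleR continuous_on_const
        continuous_on_compose2[OF c assms]) auto
qed

lemma valid_path_seg: "valid_path (seg x x')"
proof -
  have "continuous_on {0..1} (seg x x')"
    by (rule continuous_on_vector_derivative) (rule has_vector_derivative_at_within[OF seg_has_vector_derivative])
  then have "seg x x' C1_differentiable_on {0..1}"
    unfolding C1_differentiable_on_def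
    by (intro exI[of _ "\<lambda>s. vec (seg x x' s) (w1 x x') (th2 x' - th2 x) (th3 x' - th3 x)"] conjI ballI
        seg_has_vector_derivative continuous_on_vec_of)
  then show ?thesis by (simp add: valid_path_def C1_differentiable_imp_piecewise)
qed

text \<open>Scaled so that the modulus is the length of the horizontal part. In complex notation
  \<open>Im (cnj z * w)\<close> is the area form, and the linear parts of plane isometries become
  multiplications, possibly after conjugation.\<close>

definition pt :: "real \<Rightarrow> real \<Rightarrow> real^3 \<Rightarrow> complex" where
  "pt b c x = Complex (sqrt b * th2 x) (sqrt c * th3 x)"

lemma pt_linear: "pt b c (x + x') = pt b c x + pt b c x'" "pt b c (x - x') = pt b c x - pt b c x'"
  "pt b c (r *\<^sub>R x) = r *\<^sub>R pt b c x" "pt b c 0 = 0"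
  by (simp_all add: pt_def th_linear complex_eq_iff algebra_simps)

lemma pt_bounded_linear: "bounded_linear (pt b c)"
  by (intro linear_conv_bounded_linear[THEN iffD1] linearI) (simp_all add: pt_linear)

lemma area_pt:
  assumes "b > 0" "c > 0"
  shows "th2 x * th3 x' - th3 x * th2 x' = Im (cnj (pt b c x) * pt b c x') / sqrt (b * c)"
  using assms by (simp add: pt_def real_sqrt_mult field_simps)

definition NN :: "real \<Rightarrow> real \<Rightarrow> real \<Rightarrow> real^3 \<Rightarrow> real^3 \<Rightarrow> real" where
  "NN a b c x x' = norm (sqrt a * w1 x x', pt b c x' - pt b c x)"

lemma diag_metric_pt:
  assumes "a \<ge> 0" "b \<ge> 0" "c \<ge> 0"
  shows "sqrt (diag_metric f a b c x u u) = norm (sqrt a * th1 x u, pt b c u)"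
proof -
  have "(cmod (pt b c u))\<^sup>2 = b * (th2 u)\<^sup>2 + c * (th3 u)\<^sup>2"
    using assms by (simp add: pt_def cmod_power2 power_mult_distrib)
  then have "(norm (sqrt a * th1 x u))\<^sup>2 + (cmod (pt b c u))\<^sup>2 = diag_metric f a b c x u u"
    using assms by (simp add: diag_metric_eq power_mult_distrib) (simp add: power2_eq_square)
  then show ?thesis by (simp only: norm_Pair)
qed

lemma quadratic_diag_metric: "a \<ge> 0 \<Longrightarrow> b \<ge> 0 \<Longrightarrow> c \<ge> 0 \<Longrightarrow> quadratic (diag_metric f a b c)"
  by (simp add: quadratic_def diag_metric_eq th_linear power2_eq_square algebra_simps)

lemma seg_length:
  assumes "a \<ge> 0" "b \<ge> 0" "c \<ge> 0"
  shows "admissible (diag_metric f a b c) (seg x x')" "len (diag_metric f a b c) (seg x x') = NN a b c x x'"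
proof -
  have "pt b c (vec y r (th2 x' - th2 x) (th3 x' - th3 x)) = pt b c x' - pt b c x" for y r
    by (simp add: pt_def complex_eq_iff right_diff_distrib)
  then have "speed (diag_metric f a b c) (seg x x') s = NN a b c x x'" for s
    unfolding speed_eq[OF seg_has_vector_derivative] diag_metric_pt[OF assms] NN_def by simp
  then have "speed (diag_metric f a b c) (seg x x') = (\<lambda>s. NN a b c x x')" by blast
  then show "admissible (diag_metric f a b c) (seg x x')" "len (diag_metric f a b c) (seg x x') = NN a b c x x'"
    using valid_path_seg integrable_const_ivl[of "NN a b c x x'" 0 "1::real"] by (simp_all add: admissible_def len_def)
qed

lemma riem_dist_le_NN:
  assumes "a \<ge> 0" "b \<ge> 0" "c \<ge> 0"
  shows "riem_dist p (diag_metric f a b c) (p x) (p x') \<le> NN a b c x x'"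
  using riem_dist_le[OF quadratic_diag_metric[OF assms] seg_length(1)[OF assms], of p x x'] seg_length(2)[OF assms]
  by simp

text \<open>Measuring from \<open>x0\<close> moves the centre of the swept area to
  \<open>pt b c x0\<close>, as the two terms with \<open>th2 x0\<close> and \<open>th3 x0\<close>
  have the form of the area term itself.\<close>

lemma w1_has_vector_derivative:
  assumes bc: "b > 0" "c > 0" and \<gamma>: "(\<gamma> has_vector_derivative D) (at r)"
  shows "((\<lambda>r. w1 x0 (\<gamma> r)) has_vector_derivative
    th1 (\<gamma> r) D + Im (cnj (pt b c (\<gamma> r - x0)) * pt b c D) / sqrt (b * c)) (at r)"
proof -
  have "((\<lambda>x. w1 x0 x) has_derivative
      (\<lambda>h. th1 (\<gamma> r) h + th2 (\<gamma> r) * th3 h - th3 (\<gamma> r) * th2 h - 0 - (th2 x0 * th3 h - th3 x0 * th2 h))) (at (\<gamma> r))"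
    unfolding w1_def
    by (intro has_derivative_diff y1_has_derivative has_derivative_const has_derivative_mult_right
        th2_has_derivative th3_has_derivative has_derivative_ident)
  from diff_chain_at[OF \<gamma>[unfolded has_vector_derivative_def] this, unfolded o_def]
  have "((\<lambda>r. w1 x0 (\<gamma> r)) has_derivative (\<lambda>t. t *\<^sub>R (th1 (\<gamma> r) D
       + (th2 (\<gamma> r - x0) * th3 D - th3 (\<gamma> r - x0) * th2 D)))) (at r)"
    by (rule has_derivative_eq_rhs) (simp add: fun_eq_iff th_linear algebra_simps)
  then show ?thesis unfolding area_pt[OF bc] has_vector_derivative_def .
qed

text \<open>The projection does not increase length, so it stays within \<open>L\<close> of its
  start and its area term grows at a rate of at most \<open>L\<close> times the speed, up to the
  factor \<open>1 / sqrt (b * c)\<close>. Hence the curve \<open>V\<close>, whose displacement has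
  norm \<open>NN\<close>, moves at most \<open>1 + l * L\<close> times as fast as
  \<open>\<gamma>\<close>.\<close>

lemma path_estimate:
  assumes pos: "a > 0" "b > 0" "c > 0" and adm: "admissible (diag_metric f a b c) \<gamma>"
    and s: "0 \<le> s" "s \<le> s'" "s' \<le> 1"
  defines "L \<equiv> integral {s..s'} (speed (diag_metric f a b c) \<gamma>)"
  shows "cmod (pt b c (\<gamma> s') - pt b c (\<gamma> s)) \<le> L"
    and "NN a b c (\<gamma> s) (\<gamma> s') \<le> L + sqrt (a / (b * c)) * L\<^sup>2"
proof -
  let ?g = "diag_metric f a b c"
  have q: "quadratic ?g" using pos by (simp add: quadratic_diag_metric)
  obtain S where S: "finite S"
    "\<And>s. s \<in> {0..1} - S \<Longrightarrow> (\<gamma> has_vector_derivative vector_derivative \<gamma> (at s)) (at s)"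
    using valid_path_has_vector_derivative adm unfolding admissible_def by blast
  define D where "D s = vector_derivative \<gamma> (at s)" for s
  have D: "(\<gamma> has_vector_derivative D r) (at r)" if "r \<in> {s..s'} - S" for r
    using S(2)[of r] that s by (simp add: D_def)
  have sp: "speed ?g \<gamma> r = norm (sqrt a * th1 (\<gamma> r) (D r), pt b c (D r))" for r
    using pos by (simp add: speed_def D_def diag_metric_pt)
  have int: "speed ?g \<gamma> integrable_on {u..v}" if "0 \<le> u" "v \<le> 1" for u v
    using adm that integrable_on_subinterval[of "speed ?g \<gamma>" "{0..1}" u v] by (auto simp: admissible_def)
  have cont: "continuous_on {s..s'} \<gamma>"
    using adm s by (auto simp: admissible_def valid_path_def piecewise_C1_differentiable_on_def
        intro: continuous_on_subset)
  have L0: "0 \<le> L" unfolding L_def by (rule integral_nonneg) (use int s speed_nonneg[OF q] in auto)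
  have dpt: "((\<lambda>r. pt b c (\<gamma> r)) has_vector_derivative pt b c (D r)) (at r)" if "r \<in> {s..s'} - S" for r
    by (rule bounded_linear.has_vector_derivative[OF pt_bounded_linear D[OF that]])
  have cpt: "continuous_on {s..s'} (\<lambda>r. pt b c (\<gamma> r))"
    by (rule bounded_linear.continuous_on[OF pt_bounded_linear cont])
  have b1: "cmod (pt b c (\<gamma> r) - pt b c (\<gamma> s)) \<le> L" if r: "r \<in> {s..s'}" for r
  proof -
    have "cmod (pt b c (\<gamma> r) - pt b c (\<gamma> s)) \<le> 1 * integral {s..r} (speed ?g \<gamma>)"
    proof (rule norm_diff_le_integral_bound[OF S(1)])
      show "continuous_on {s..r} (\<lambda>r. pt b c (\<gamma> r))"
        by (rule continuous_on_subset[OF cpt]) (use r in auto)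
      show "((\<lambda>r. pt b c (\<gamma> r)) has_vector_derivative pt b c (D z)) (at z)" if "z \<in> {s..r} - S" for z
        by (rule dpt) (use that r in auto)
      show "cmod (pt b c (D z)) \<le> 1 * speed ?g \<gamma> z" for z
        unfolding sp by (simp add: norm_snd_le)
      show "speed ?g \<gamma> integrable_on {s..r}" using int s r by auto
    qed (use r speed_nonneg[OF q] in auto)
    also have "\<dots> \<le> L"
      unfolding L_def mult_1 by (rule integral_subset_le) (use int s r speed_nonneg[OF q] in auto)
    finally show ?thesis .
  qed
  show "cmod (pt b c (\<gamma> s') - pt b c (\<gamma> s)) \<le> L" using b1[of s'] s by simp
  define l where "l = sqrt (a / (b * c))"
  have l: "sqrt a / sqrt (b * c) = l" "l > 0" using pos by (simp_all add: l_def real_sqrt_divide)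
  define V where "V r = (sqrt a * w1 (\<gamma> s) (\<gamma> r), pt b c (\<gamma> r))" for r
  define A where "A r = Im (cnj (pt b c (\<gamma> r - \<gamma> s)) * pt b c (D r)) / sqrt (b * c)" for r
  have dw: "((\<lambda>r. w1 (\<gamma> s) (\<gamma> r)) has_vector_derivative th1 (\<gamma> r) (D r) + A r) (at r)" if r: "r \<in> {s..s'} - S" for r
    unfolding A_def by (rule w1_has_vector_derivative[OF pos(2,3) D[OF r]])
  have "norm (V s' - V s) \<le> (1 + l * L) * integral {s..s'} (speed ?g \<gamma>)"
  proof (rule norm_diff_le_integral_bound[OF S(1) s(2)])
    show "continuous_on {s..s'} V"
      unfolding V_def w1_def
      by (intro continuous_on_Pair continuous_on_mult continuous_on_diff continuous_on_const cpt
          continuous_on_compose2[OF continuous_on_coordinates(1) cont]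
          continuous_on_compose2[OF continuous_on_coordinates(2) cont]
          continuous_on_compose2[OF continuous_on_coordinates(3) cont]) auto
    fix r assume r: "r \<in> {s..s'} - S"
    show "(V has_vector_derivative (sqrt a * (th1 (\<gamma> r) (D r) + A r), pt b c (D r))) (at r)"
      unfolding V_def by (intro has_vector_derivative_Pair has_vector_derivative_mult_right dw dpt r)
    have "\<bar>A r\<bar> \<le> L * cmod (pt b c (D r)) / sqrt (b * c)"
    proof -
      have "\<bar>Im (cnj (pt b c (\<gamma> r - \<gamma> s)) * pt b c (D r))\<bar> \<le> cmod (pt b c (\<gamma> r - \<gamma> s)) * cmod (pt b c (D r))"
        using abs_Im_le_cmod[of "cnj (pt b c (\<gamma> r - \<gamma> s)) * pt b c (D r)"] by (simp add: norm_mult)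
      also have "\<dots> \<le> L * cmod (pt b c (D r))"
        using b1[of r] r by (intro mult_right_mono) (auto simp: pt_linear)
      finally show ?thesis using pos by (simp add: A_def abs_mult divide_right_mono)
    qed
    from mult_left_mono[OF this, of "sqrt a"]
    have "\<bar>sqrt a * A r\<bar> \<le> sqrt a * (L * cmod (pt b c (D r)) / sqrt (b * c))"
      using pos by (simp only: abs_mult) simp
    also have "\<dots> = (sqrt a / sqrt (b * c)) * L * cmod (pt b c (D r))" by simp
    also have "\<dots> = l * L * cmod (pt b c (D r))" by (simp only: l(1))
    also have "\<dots> \<le> l * L * speed ?g \<gamma> r"
      unfolding sp by (rule mult_left_mono[OF norm_snd_le]) (use L0 l(2) in simp)
    finally have *: "norm (sqrt a * A r, 0::complex) \<le> l * L * speed ?g \<gamma> r" by (simp add: norm_Pair)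
    have "(sqrt a * (th1 (\<gamma> r) (D r) + A r), pt b c (D r))
       = (sqrt a * th1 (\<gamma> r) (D r), pt b c (D r)) + (sqrt a * A r, 0)" by (simp add: distrib_left)
    then have "norm (sqrt a * (th1 (\<gamma> r) (D r) + A r), pt b c (D r))
       \<le> speed ?g \<gamma> r + norm (sqrt a * A r, 0::complex)"
      unfolding sp by (simp only: norm_triangle_ineq)
    then show "norm (sqrt a * (th1 (\<gamma> r) (D r) + A r), pt b c (D r)) \<le> (1 + l * L) * speed ?g \<gamma> r"
    proof -
      have "(1 + l * L) * speed ?g \<gamma> r = speed ?g \<gamma> r + l * L * speed ?g \<gamma> r"
        by (simp only: distrib_right mult_1)
      with * \<open>norm (sqrt a * (th1 (\<gamma> r) (D r) + A r), pt b c (D r)) \<le> _\<close> show ?thesis by linarith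
    qed
  next
    show "speed ?g \<gamma> integrable_on {s..s'}" by (rule int[OF s(1,3)])
    show "0 \<le> speed ?g \<gamma> r" for r by (rule speed_nonneg[OF q])
    show "0 \<le> 1 + l * L" using mult_nonneg_nonneg[OF less_imp_le[OF l(2)] L0] by linarith
  qed
  also have "(1 + l * L) * integral {s..s'} (speed ?g \<gamma>) = L + l * L\<^sup>2"
    unfolding L_def[symmetric] by (simp add: algebra_simps power2_eq_square)
  finally show "NN a b c (\<gamma> s) (\<gamma> s') \<le> L + sqrt (a / (b * c)) * L\<^sup>2"
    by (simp add: V_def NN_def l_def)
qed

end

section \<open>Absolutely continuous curves\<close>

text \<open>The Lipschitz condition is imposed only along the curve, so that the lemma applies to
  \<open>w1\<close>, which is quadratic and thus only locally Lipschitz.\<close>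

lemma abs_continuous_on_compose:
  fixes \<gamma> :: "real \<Rightarrow> 'a::real_normed_vector" and F :: "'a \<Rightarrow> 'b::real_normed_vector"
  assumes ac: "abs_continuous_on S \<gamma>" and K: "0 \<le> K"
    and lip: "\<And>s t. s \<in> S \<Longrightarrow> t \<in> S \<Longrightarrow> norm (F (\<gamma> s) - F (\<gamma> t)) \<le> K * norm (\<gamma> s - \<gamma> t)"
  shows "abs_continuous_on S (\<lambda>s. F (\<gamma> s))"
  unfolding abs_continuous_on_def
proof (intro allI impI)
  fix e :: real assume "e > 0"
  then have "e / (K + 1) > 0" using K by simp
  then obtain d where d: "d > 0" "\<And>D. D division_of \<Union>D \<Longrightarrow> \<Union>D \<subseteq> S \<Longrightarrow> (\<Sum>I\<in>D. Sup I - Inf I) < d \<Longrightarrow>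
     (\<Sum>I\<in>D. norm (\<gamma> (Sup I) - \<gamma> (Inf I))) < e / (K + 1)"
    using ac unfolding abs_continuous_on_def by meson
  show "\<exists>d>0. \<forall>D. D division_of \<Union>D \<and> \<Union>D \<subseteq> S \<and> (\<Sum>K\<in>D. Sup K - Inf K) < d \<longrightarrow>
     (\<Sum>K\<in>D. norm (F (\<gamma> (Sup K)) - F (\<gamma> (Inf K)))) < e"
  proof (intro exI[of _ d] conjI allI impI d(1))
    fix D assume D: "D division_of \<Union>D \<and> \<Union>D \<subseteq> S \<and> (\<Sum>K\<in>D. Sup K - Inf K) < d"
    have SI: "Sup I \<in> S" "Inf I \<in> S" if I: "I \<in> D" for I
    proof -
      obtain a b where ab: "I = cbox a b" "I \<noteq> {}"
        using D division_ofD(3,4)[of D "\<Union>D" I] I by blast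
      then have "Sup I \<in> I" "Inf I \<in> I" by auto
      then show "Sup I \<in> S" "Inf I \<in> S" using D I by blast+
    qed
    have "(\<Sum>I\<in>D. norm (F (\<gamma> (Sup I)) - F (\<gamma> (Inf I)))) \<le> (\<Sum>I\<in>D. K * norm (\<gamma> (Sup I) - \<gamma> (Inf I)))"
      by (intro sum_mono lip SI)
    also have "\<dots> = K * (\<Sum>I\<in>D. norm (\<gamma> (Sup I) - \<gamma> (Inf I)))" by (simp add: sum_distrib_left)
    also have "\<dots> \<le> K * (e / (K + 1))"
      by (rule mult_left_mono[OF less_imp_le[OF d(2)] K]) (use D in auto)
    also have "\<dots> < e" using K \<open>e > 0\<close> by (simp add: field_simps)
    finally show "(\<Sum>K\<in>D. norm (F (\<gamma> (Sup K)) - F (\<gamma> (Inf K)))) < e" .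
  qed
qed

lemma abs_continuous_on_subset: "abs_continuous_on S \<gamma> \<Longrightarrow> T \<subseteq> S \<Longrightarrow> abs_continuous_on T \<gamma>"
  unfolding abs_continuous_on_def by (meson order_trans)

lemma abs_continuous_on_lipschitz:
  assumes "L-lipschitz_on S \<gamma>"
  shows "abs_continuous_on S (\<gamma> :: real \<Rightarrow> 'a::real_normed_vector)"
proof -
  have id: "abs_continuous_on S (\<lambda>s::real. s)"
    unfolding abs_continuous_on_def
  proof (intro allI impI, rule_tac x = "\<epsilon>" in exI, intro conjI allI impI)
    fix e :: real and D :: "real set set"
    assume D: "D division_of \<Union>D \<and> \<Union>D \<subseteq> S \<and> (\<Sum>K\<in>D. Sup K - Inf K) < e"
    have "norm (Sup I - Inf I) = Sup I - Inf I" if I: "I \<in> D" for I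
    proof -
      obtain a b where "I = cbox a b" "I \<noteq> {}"
        using D division_ofD(3,4)[of D "\<Union>D" I] I by blast
      then show ?thesis by auto
    qed
    then show "(\<Sum>K\<in>D. norm (Sup K - Inf K)) < e" using D by simp
  qed
  have "0 \<le> L" using assms by (rule lipschitz_on_nonneg)
  from abs_continuous_on_compose[OF id this, of \<gamma>] show ?thesis
    using lipschitz_onD[OF assms] by (simp add: dist_norm)
qed

lemma abs_continuous_on_imp_continuous:
  assumes "abs_continuous_on {a..b} \<gamma>"
  shows "continuous_on {a..b} \<gamma>"
  unfolding continuous_on_iff
proof (intro ballI allI impI)
  fix s e :: real assume s: "s \<in> {a..b}" and e: "e > 0"
  obtain d where d: "d > 0" "\<And>D. D division_of \<Union>D \<Longrightarrow> \<Union>D \<subseteq> {a..b} \<Longrightarrow> (\<Sum>I\<in>D. Sup I - Inf I) < d \<Longrightarrow>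
     (\<Sum>I\<in>D. norm (\<gamma> (Sup I) - \<gamma> (Inf I))) < e"
    using assms e unfolding abs_continuous_on_def by meson
  have *: "norm (\<gamma> v - \<gamma> u) < e" if "u \<in> {a..b}" "v \<in> {a..b}" "u \<le> v" "v - u < d" for u v
  proof -
    have "{cbox u v} division_of cbox u v" using that by (intro division_of_self) auto
    then show ?thesis using d(2)[of "{{u..v}}"] that by auto
  qed
  show "\<exists>d>0. \<forall>t\<in>{a..b}. dist t s < d \<longrightarrow> dist (\<gamma> t) (\<gamma> s) < e"
  proof (intro exI[of _ d] conjI ballI impI d(1))
    fix t assume t: "t \<in> {a..b}" "dist t s < d"
    show "dist (\<gamma> t) (\<gamma> s) < e"
      using *[of s t] *[of t s] s t by (cases "s \<le> t") (auto simp: dist_norm norm_minus_commute)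
  qed
qed

text \<open>On a fine tagged division the intervals tagged in the null set where the derivative bound
  fails have small total length, so absolute continuity makes their contribution small.\<close>

lemma abs_continuous_mean_value:
  fixes F :: "real \<Rightarrow> 'a::real_normed_vector"
  assumes ac: "abs_continuous_on {a..b} F" and ab: "a \<le> b" and M: "0 \<le> M"
    and ae: "AE s in lebesgue. s \<in> {a..b} \<longrightarrow> (\<exists>v. (F has_vector_derivative v) (at s) \<and> norm v \<le> M)"
  shows "norm (F b - F a) \<le> M * (b - a)"
proof (rule field_le_epsilon)
  fix \<epsilon>' :: real assume "\<epsilon>' > 0"
  \<comment> \<open>One share \<open>\<epsilon> * (b - a)\<close> is spent on the tags outside the
    null set \<open>N\<close>, the other share \<open>\<epsilon>\<close> on the tags in
    \<open>N\<close>.\<close>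
  define \<epsilon> where "\<epsilon> = \<epsilon>' / (b - a + 1)"
  have "\<epsilon> * (b - a + 1) = \<epsilon>'" "\<epsilon> > 0"
    using \<open>\<epsilon>' > 0\<close> ab by (simp_all add: \<epsilon>_def)
  then have \<epsilon>: "\<epsilon> > 0" "\<epsilon> * (b - a) + \<epsilon> = \<epsilon>'" by (simp_all add: distrib_left)
  obtain \<delta> where \<delta>: "\<delta> > 0" "\<And>D. D division_of \<Union>D \<Longrightarrow> \<Union>D \<subseteq> {a..b} \<Longrightarrow> (\<Sum>I\<in>D. Sup I - Inf I) < \<delta> \<Longrightarrow>
     (\<Sum>I\<in>D. norm (F (Sup I) - F (Inf I))) < \<epsilon>"
    using ac \<epsilon>(1) unfolding abs_continuous_on_def by meson
  define P where "P s \<longleftrightarrow> (\<exists>v. (F has_vector_derivative v) (at s) \<and> norm v \<le> M)" for s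
  have "AE s in lebesgue. s \<in> {a..b} \<longrightarrow> P s" using ae by (simp only: P_def)
  then obtain N where N: "N \<in> null_sets lebesgue" "{s \<in> space lebesgue. \<not> (s \<in> {a..b} \<longrightarrow> P s)} \<subseteq> N"
    by (auto simp only: eventually_ae_filter)
  have NP: "P s" if "s \<in> {a..b}" "s \<notin> N" for s
    using N(2) that by auto
  \<comment> \<open>The gauge keeps intervals tagged in \<open>N\<close> inside the open set
    \<open>O'\<close>, so their total length is below \<open>\<delta>\<close>.\<close>
  obtain O' where O': "open O'" "N \<subseteq> O'" "O' - N \<in> lmeasurable" "emeasure lebesgue (O' - N) < ennreal \<delta>"
    using sets_lebesgue_outer_open[of N \<delta>] N(1) \<delta>(1) by blast
  have emO: "emeasure lebesgue O' < ennreal \<delta>"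
  proof -
    have "emeasure lebesgue O' \<le> emeasure lebesgue ((O' - N) \<union> N)"
      using O' N(1) by (intro emeasure_mono) auto
    also have "\<dots> = emeasure lebesgue (O' - N)"
      using O'(3) N(1) by (intro emeasure_Un_null_set) auto
    finally show ?thesis using O'(4) by simp
  qed
  have ex: "\<exists>r>0. (s \<in> N \<longrightarrow> ball s r \<subseteq> O') \<and>
     (s \<in> {a..b} - N \<longrightarrow> (\<forall>y. \<bar>y - s\<bar> < r \<longrightarrow> norm (F y - F s) \<le> (M + \<epsilon>) * \<bar>y - s\<bar>))" for s
  proof (cases "s \<in> N")
    case True
    then obtain r where "r > 0" "ball s r \<subseteq> O'" using O'(1,2) by (meson openE subsetD)
    then show ?thesis using True by auto
  next
    case sN: False
    show ?thesis
    proof (cases "s \<in> {a..b}")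
      case True
      then obtain v where v: "(F has_vector_derivative v) (at s)" "norm v \<le> M" using NP[of s] sN by (auto simp: P_def)
      then obtain r where r: "r > 0" "\<And>y. norm (y - s) < r \<Longrightarrow> norm (F y - F s - (y - s) *\<^sub>R v) \<le> \<epsilon> * norm (y - s)"
        using \<epsilon>(1) unfolding has_vector_derivative_def has_derivative_at_alt by meson
      have "norm (F y - F s) \<le> (M + \<epsilon>) * \<bar>y - s\<bar>" if "\<bar>y - s\<bar> < r" for y
      proof -
        have "norm (F y - F s) \<le> norm (F y - F s - (y - s) *\<^sub>R v) + norm ((y - s) *\<^sub>R v)"
          using norm_triangle_ineq[of "F y - F s - (y - s) *\<^sub>R v" "(y - s) *\<^sub>R v"] by simp
        also have "\<dots> \<le> \<epsilon> * \<bar>y - s\<bar> + \<bar>y - s\<bar> * M"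
          using r(2)[of y] that v(2) by (intro add_mono) (auto intro: mult_left_mono)
        finally show ?thesis by (simp add: algebra_simps)
      qed
      then show ?thesis using r(1) sN by auto
    qed (use sN in \<open>auto intro: exI[of _ 1]\<close>)
  qed
  obtain r where r: "\<And>s. r s > 0" "\<And>s. s \<in> N \<Longrightarrow> ball s (r s) \<subseteq> O'"
    "\<And>s y. s \<in> {a..b} - N \<Longrightarrow> \<bar>y - s\<bar> < r s \<Longrightarrow> norm (F y - F s) \<le> (M + \<epsilon>) * \<bar>y - s\<bar>"
    using ex by metis
  have "gauge (\<lambda>s. ball s (r s))" using r(1) by (simp add: gauge_def)
  then obtain p where p: "p tagged_division_of {a..b}" "(\<lambda>s. ball s (r s)) fine p"
    using fine_division_exists_real by blast
  have fin: "finite p" using p(1) by blast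
  have pK: "\<exists>u v. K = {u..v} \<and> u \<le> x \<and> x \<le> v \<and> a \<le> u \<and> v \<le> b \<and> {u..v} \<subseteq> ball x (r x)" if xK: "(x, K) \<in> p" for x K
  proof -
    obtain u v where "K = cbox u v" using tagged_division_ofD(4)[OF p(1) xK] by blast
    moreover have "x \<in> K" "K \<subseteq> {a..b}" "K \<subseteq> ball x (r x)"
      using tagged_division_ofD(2,3)[OF p(1) xK] p(2) xK by (auto simp: fine_def)
    ultimately show ?thesis by (intro exI[of _ u] exI[of _ v]) auto
  qed
  define p1 where "p1 = {(x, K) \<in> p. x \<notin> N}"
  define p2 where "p2 = {(x, K) \<in> p. x \<in> N}"
  have pp: "p = p1 \<union> p2" "p1 \<inter> p2 = {}" "finite p1" "finite p2"
    using fin by (auto simp: p1_def p2_def intro: finite_subset[of _ p])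
  \<comment> \<open>The value \<open>0\<close> on the empty interval is needed when the sum over
    tags becomes a sum over intervals; \<open>Sup\<close> and \<open>Inf\<close> say nothing
    there.\<close>
  define h where "h K = (if K = {} then 0 else norm (F (Sup K) - F (Inf K)))" for K
  have h: "h K = norm (F (Sup K) - F (Inf K))" if "(x, K) \<in> p" for x K
    using pK[OF that] by (auto simp: h_def)
  have len: "(\<Sum>(x, K)\<in>p. Sup K - Inf K) = b - a"
    using additive_tagged_division_1[OF ab p(1), of "\<lambda>x. x"] by simp
  have lenpos: "0 \<le> Sup K - Inf K" if "(x, K) \<in> p" for x K using pK[OF that] by auto
  have s1: "(\<Sum>(x, K)\<in>p1. h K) \<le> (M + \<epsilon>) * (b - a)"
  proof -
    have "(\<Sum>(x, K)\<in>p1. h K) \<le> (\<Sum>(x, K)\<in>p1. (M + \<epsilon>) * (Sup K - Inf K))"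
    proof (rule sum_mono, clarify)
      fix x K assume "(x, K) \<in> p1"
      then have xp: "(x, K) \<in> p" "x \<notin> N" by (auto simp: p1_def)
      obtain u v where uv: "K = {u..v}" "u \<le> x" "x \<le> v" "a \<le> u" "v \<le> b" "{u..v} \<subseteq> ball x (r x)"
        using pK[OF xp(1)] by blast
      have "u \<in> ball x (r x)" "v \<in> ball x (r x)"
        by (rule subsetD[OF uv(6)], use uv in simp)+
      then have "norm (F u - F x) \<le> (M + \<epsilon>) * \<bar>u - x\<bar>" "norm (F v - F x) \<le> (M + \<epsilon>) * \<bar>v - x\<bar>"
        using r(3)[of x u] r(3)[of x v] uv xp(2) by (auto simp: dist_real_def abs_minus_commute)
      moreover have "norm (F v - F u) \<le> norm (F v - F x) + norm (F u - F x)"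
        using norm_triangle_ineq4[of "F v - F x" "F u - F x"] by simp
      ultimately show "h K \<le> (M + \<epsilon>) * (Sup K - Inf K)"
        using uv h[OF xp(1)] by (simp add: algebra_simps)
    qed
    also have "\<dots> = (M + \<epsilon>) * (\<Sum>(x, K)\<in>p1. Sup K - Inf K)"
      by (simp add: sum_distrib_left case_prod_unfold)
    also have "(\<Sum>(x, K)\<in>p1. Sup K - Inf K) \<le> (\<Sum>(x, K)\<in>p. Sup K - Inf K)"
      by (rule sum_mono2[OF fin]) (use lenpos in \<open>auto simp: p1_def\<close>)
    finally show ?thesis unfolding len using M \<epsilon>(1) by (simp add: mult_left_mono)
  qed
  have s2: "(\<Sum>(x, K)\<in>p2. h K) < \<epsilon>"
  proof -
    have td: "p2 tagged_division_of \<Union>(snd ` p2)"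
      by (rule tagged_partial_division_of_Union_self[OF tagged_partial_division_subset])
        (use p(1) in \<open>auto simp: p2_def tagged_division_of_def\<close>)
    have e: "(\<Sum>(x, K)\<in>p2. h K) = (\<Sum>K\<in>snd ` p2. h K)"
    proof (rule sum.over_tagged_division_lemma[OF td])
      fix u v :: real assume "box u v = {}"
      then have "v \<le> u" by (simp add: box_real)
      then show "h (cbox u v) = 0" by (cases "u = v") (auto simp: h_def)
    qed
    have D: "snd ` p2 division_of \<Union>(snd ` p2)" by (rule division_of_tagged_division[OF td])
    have sub: "\<Union>(snd ` p2) \<subseteq> O'" "\<Union>(snd ` p2) \<subseteq> {a..b}"
      using pK r(2) by (fastforce simp: p2_def)+
    have "(\<Sum>K\<in>snd ` p2. Sup K - Inf K) = (\<Sum>K\<in>snd ` p2. measure lebesgue K)"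
    proof (rule sum.cong[OF refl])
      fix K assume "K \<in> snd ` p2"
      then obtain x where "(x, K) \<in> p" by (auto simp: p2_def)
      from pK[OF this] show "Sup K - Inf K = measure lebesgue K" by (auto simp: measure_completion)
    qed
    also have "\<dots> = measure lebesgue (\<Union>(snd ` p2))" using content_division[OF D] by simp
    also have "\<dots> < \<delta>"
    proof -
      have "emeasure lebesgue (\<Union>(snd ` p2)) \<le> emeasure lebesgue O'"
        using sub(1) O'(1) by (intro emeasure_mono) auto
      then have "emeasure lebesgue (\<Union>(snd ` p2)) < ennreal \<delta>" using emO by (rule le_less_trans)
      then show ?thesis
        using lmeasurable_division[OF D] \<delta>(1) by (simp add: emeasure_eq_measure2 ennreal_less_iff)
    qed
    finally have "(\<Sum>I\<in>snd ` p2. norm (F (Sup I) - F (Inf I))) < \<epsilon>" using \<delta>(2) D sub(2) by blast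
    moreover have "(\<Sum>I\<in>snd ` p2. h I) = (\<Sum>I\<in>snd ` p2. norm (F (Sup I) - F (Inf I)))"
      by (rule sum.cong) (auto simp: p2_def h)
    ultimately show ?thesis using e by simp
  qed
  have "norm (F b - F a) = norm (\<Sum>(x, K)\<in>p. F (Sup K) - F (Inf K))"
    using additive_tagged_division_1[OF ab p(1), of F] by simp
  also have "\<dots> \<le> (\<Sum>(x, K)\<in>p. h K)"
    by (rule order_trans[OF norm_sum], rule sum_mono) (auto simp: h)
  also have "\<dots> = (\<Sum>(x, K)\<in>p1. h K) + (\<Sum>(x, K)\<in>p2. h K)"
    using pp by (simp add: sum.union_disjoint)
  also have "\<dots> \<le> (M + \<epsilon>) * (b - a) + \<epsilon>" using s1 s2 by linarith
  also have "\<dots> = M * (b - a) + \<epsilon>'" using \<epsilon>(2) by (simp add: algebra_simps)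
  finally show "norm (F b - F a) \<le> M * (b - a) + \<epsilon>'" .
qed

section \<open>Covering spaces\<close>

text \<open>The library lifts maps only through coverings of normed spaces. A section of the
  pulled-back covering, which has a normed base, gives the lift for a general base.\<close>

lemma covering_space_pullback:
  fixes p :: "'a::topological_space \<Rightarrow> 'b::topological_space" and f :: "'c::topological_space \<Rightarrow> 'b"
  assumes cov: "covering_space UNIV p S" and f: "continuous_on UNIV f" "range f \<subseteq> S"
  shows "covering_space {(y, x). f y = p x} fst UNIV"
proof
  let ?E = "{(y, x). f y = p x}"
  show "continuous_on ?E fst" by (intro continuous_intros)
  have "range p = S" using cov by (simp add: covering_space_def)
  then have sur: "\<exists>x. f y = p x" for y using f(2) by (metis image_iff range_subsetD)
  show "fst ` ?E = UNIV" using sur by (force simp: image_iff)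
  fix y :: 'c
  have "f y \<in> S" using f(2) by blast
  then obtain T v where T: "f y \<in> T" "openin (top_of_set S) T" and v: "\<Union>v = p -` T"
     "\<forall>u\<in>v. open u" "pairwise disjnt v" "\<forall>u\<in>v. \<exists>q. homeomorphism u T p q"
    using cov unfolding covering_space_def by (simp; elim conjE) (drule bspec, assumption, force)
  have opT: "open (f -` T)"
  proof -
    obtain T' where "open T'" "T = S \<inter> T'" using T(2) by (auto simp: openin_open)
    then have "f -` T = f -` T'" using f(2) by auto
    then show ?thesis using f(1) \<open>open T'\<close> by (metis open_vimage)
  qed
  show "\<exists>T. y \<in> T \<and> openin (top_of_set UNIV) T \<and>
       (\<exists>v. \<Union> v = ?E \<inter> fst -` T \<and> (\<forall>u\<in>v. openin (top_of_set ?E) u) \<and> pairwise disjnt v \<and>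
           (\<forall>u\<in>v. \<exists>q. homeomorphism u T fst q))"
  proof (intro exI[of _ "f -` T"] conjI exI[of _ "(\<lambda>u. ?E \<inter> (f -` T \<times> u)) ` v"])
    show "y \<in> f -` T" using T by simp
    show "openin (top_of_set UNIV) (f -` T)" using opT by simp
    show "\<Union> ((\<lambda>u. ?E \<inter> (f -` T \<times> u)) ` v) = ?E \<inter> fst -` f -` T"
    proof -
      have "\<exists>u\<in>v. x \<in> u" if "p x \<in> T" for x using v(1) that by blast
      then show ?thesis by auto
    qed
    show "\<forall>u\<in>(\<lambda>u. ?E \<inter> (f -` T \<times> u)) ` v. openin (top_of_set ?E) u"
      using v(2) opT by (auto simp: openin_open intro!: open_Times)
    show "pairwise disjnt ((\<lambda>u. ?E \<inter> (f -` T \<times> u)) ` v)"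
      using v(3) unfolding pairwise_def disjnt_def by blast
    show "\<forall>u\<in>(\<lambda>u. ?E \<inter> (f -` T \<times> u)) ` v. \<exists>q. homeomorphism u (f -` T) fst q"
    proof clarify
      fix u assume "u \<in> v"
      then obtain q where q: "homeomorphism u T p q" using v(4) by blast
      have qT: "\<And>z. z \<in> T \<Longrightarrow> p (q z) = z \<and> q z \<in> u" "\<And>x. x \<in> u \<Longrightarrow> q (p x) = x"
        "continuous_on T q"
        using q unfolding homeomorphism_def by auto
      have "homeomorphism (?E \<inter> (f -` T \<times> u)) (f -` T) fst (\<lambda>y. (y, q (f y)))"
      proof (rule homeomorphismI)
        show "continuous_on (f -` T) (\<lambda>y. (y, q (f y)))"
          by (intro continuous_intros continuous_on_compose2[OF qT(3)]
              continuous_on_subset[OF f(1)]) auto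
        show "continuous_on (?E \<inter> (f -` T \<times> u)) fst" by (intro continuous_intros)
      qed (use qT in auto)
      then show "\<exists>q. homeomorphism (?E \<inter> (f -` T \<times> u)) (f -` T) fst q" by blast
    qed
  qed
qed

lemma covering_space_lift_from_normed_space:
  fixes p :: "'a::real_normed_vector \<Rightarrow> 'b::topological_space" and f :: "'c::real_normed_vector \<Rightarrow> 'b"
  assumes cov: "covering_space UNIV p S" and f: "continuous_on UNIV f" "range f \<subseteq> S"
    and z: "f z = p a"
  obtains g where "continuous_on UNIV g" "g z = a" "\<And>y. p (g y) = f y"
proof -
  have "convex (UNIV :: 'c set)" by simp
  then have "simply_connected (UNIV :: 'c set)" "locally path_connected (UNIV :: 'c set)"
    by (auto intro: convex_imp_simply_connected convex_imp_locally_path_connected)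
  then obtain h where h: "continuous_on UNIV h" "h \<in> UNIV \<rightarrow> {(y, x). f y = p x}" "h z = (z, a)"
      "\<And>y. y \<in> UNIV \<Longrightarrow> fst (h y) = y"
    using covering_space_lift_strong[OF covering_space_pullback[OF cov f],
        of "(z, a)" z UNIV "\<lambda>y. y"] z by (auto simp: continuous_on_id)
  show thesis
  proof
    show "continuous_on UNIV (\<lambda>y. snd (h y))" using h(1) by (intro continuous_intros)
    show "snd (h z) = a" using h(3) by simp
    show "p (snd (h y)) = f y" for y
      using h(2,4) by (auto simp: Pi_iff case_prod_beta)
  qed
qed

text \<open>As \<open>real^3\<close> is simply connected, \<open>p\<close> lifts through itself to a
  map taking \<open>x\<close> to \<open>y\<close> and to one taking \<open>y\<close> to
  \<open>x\<close>. Both composites lift \<open>p\<close> and have a fixed point, so they are the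
  identity by uniqueness of lifts.\<close>

lemma deck_transformation_transitive:
  fixes p :: "real^3 \<Rightarrow> 'm::topological_space"
  assumes cov: "covering_space UNIV p M" and xy: "p x = p y"
  obtains \<phi> where "\<phi> \<in> deck_transformations p" "\<phi> x = y"
proof -
  have c: "continuous_on UNIV p" and r: "range p \<subseteq> M"
    using cov by (auto simp: covering_space_def)
  obtain g where g: "continuous_on UNIV g" "g x = y" "\<And>z. p (g z) = p z"
    using covering_space_lift_from_normed_space[OF cov c r xy] by metis
  obtain h where h: "continuous_on UNIV h" "h y = x" "\<And>z. p (h z) = p z"
    using covering_space_lift_from_normed_space[OF cov c r xy[symmetric]] by metis
  have comp: "continuous_on UNIV (\<lambda>z. h (g z))" "continuous_on UNIV (\<lambda>z. g (h z))"
    using g h by (auto intro: continuous_on_compose2)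
  have r': "p \<in> UNIV \<rightarrow> M" using r by auto
  have 1: "h (g z) = z" for z
    by (rule covering_space_lift_unique[OF cov _ c r' comp(1) _ _ continuous_on_id, of x])
      (use g h in auto)
  have 2: "g (h z) = z" for z
    by (rule covering_space_lift_unique[OF cov _ c r' comp(2) _ _ continuous_on_id, of y])
      (use g h in auto)
  have "homeomorphism UNIV UNIV g h"
    using g h 1 2 by (auto simp: homeomorphism_def) (metis rangeI)+
  then have "g \<in> deck_transformations p"
    using g(3) by (auto simp: deck_transformations_def o_def)
  then show thesis using g(2) that by blast
qed

lemma covering_space_UNIV_image_open:
  assumes cov: "covering_space UNIV p M" and U: "open U"
  shows "openin (top_of_set M) (p ` U)"
proof (subst openin_subopen, clarify)
  fix x assume "x \<in> U"
  obtain T u q where T: "x \<in> T" "open T" "p x \<in> u" "openin (top_of_set M) u" "homeomorphism T u p q"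
    using covering_space_local_homeomorphism[OF cov, of x] by auto
  have "openin (top_of_set u) (p ` (T \<inter> U))"
    using homeomorphism_imp_open_map[OF T(5)] U by (simp add: openin_open_Int)
  then have "openin (top_of_set M) (p ` (T \<inter> U))" using T(4) openin_trans by blast
  then show "\<exists>V. openin (top_of_set M) V \<and> p x \<in> V \<and> V \<subseteq> p ` U"
    using T(1) \<open>x \<in> U\<close> by (intro exI[of _ "p ` (T \<inter> U)"]) auto
qed

lemma covering_space_locally_inj:
  assumes "covering_space UNIV p M"
  obtains V where "open V" "x \<in> V" "inj_on p V"
  using covering_space_local_homeomorphism[OF assms, of x]
  by (metis UNIV_I homeomorphism_apply1 inj_on_inverseI open_openin subtopology_UNIV)

text \<open>The images of balls around \<open>0\<close> form an increasing open cover of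
  \<open>M\<close>, so finitely many of them cover \<open>K\<close>, and then one does.\<close>

lemma covering_space_compact_subset:
  fixes p :: "'a::real_normed_vector \<Rightarrow> 'b::topological_space"
  assumes cov: "covering_space UNIV p M" and K: "compact K" "K \<subseteq> M"
  obtains r where "K \<subseteq> p ` ball 0 r"
proof -
  let ?B = "\<lambda>n::nat. p ` ball 0 (real n)"
  have sub: "?B m \<subseteq> ?B n" if "m \<le> n" for m n using that by (intro image_mono subset_ball) simp
  have "\<forall>n. \<exists>T. open T \<and> ?B n = M \<inter> T"
    using covering_space_UNIV_image_open[OF cov open_ball] unfolding openin_open by blast
  then obtain T where T: "\<And>n. open (T n) \<and> ?B n = M \<inter> T n" by metis
  have "K \<subseteq> (\<Union>n. T n)"
  proof
    fix y assume "y \<in> K"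
    then obtain x where "p x = y" using cov K(2) unfolding covering_space_def by blast
    moreover obtain n where "norm x < real n" using reals_Archimedean2 by blast
    ultimately have "y \<in> ?B n" by auto
    then show "y \<in> (\<Union>n. T n)" using T by blast
  qed
  then obtain C where C: "finite C" "K \<subseteq> (\<Union>n\<in>C. T n)"
    using compactE_image[OF K(1), of UNIV T] T by (metis subset_UNIV)
  \<comment> \<open>The inserted \<open>0\<close> makes \<open>Max\<close> meaningful if
    \<open>C\<close> is empty.\<close>
  have "K \<subseteq> ?B (Max (insert 0 C))"
  proof
    fix y assume "y \<in> K"
    then obtain n where "n \<in> C" "y \<in> T n" using C by blast
    then have "y \<in> ?B n" using T K(2) \<open>y \<in> K\<close> by blast
    then show "y \<in> ?B (Max (insert 0 C))"
      using sub[of n "Max (insert 0 C)"] C(1) \<open>n \<in> C\<close> by auto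
  qed
  then show thesis using that by blast
qed

lemma deck_transformation_inverse:
  assumes "\<phi> \<in> deck_transformations p"
  obtains \<psi> where "\<psi> \<in> deck_transformations p" "\<And>x. \<psi> (\<phi> x) = x" "\<And>x. \<phi> (\<psi> x) = x"
proof -
  obtain \<psi> where h: "homeomorphism UNIV UNIV \<phi> \<psi>" and p: "p \<circ> \<phi> = p"
    using assms by (auto simp: deck_transformations_def)
  have inv: "\<psi> (\<phi> x) = x" "\<phi> (\<psi> x) = x" for x using h by (auto simp: homeomorphism_def)
  have "p \<circ> \<psi> = p"
  proof
    fix x show "(p \<circ> \<psi>) x = p x" using fun_cong[OF p, of "\<psi> x"] inv by simp
  qed
  then have "\<psi> \<in> deck_transformations p"
    using homeomorphism_symD[OF h] by (auto simp: deck_transformations_def)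
  then show thesis using that inv by blast
qed

lemma deck_transformation_compose:
  assumes "\<phi> \<in> deck_transformations p" "\<psi> \<in> deck_transformations p"
  shows "\<phi> \<circ> \<psi> \<in> deck_transformations p"
  using assms unfolding deck_transformations_def
  by (auto simp: o_assoc[symmetric] intro: homeomorphism_compose) (metis comp_assoc)

lemma deck_transformation_apply: "\<phi> \<in> deck_transformations p \<Longrightarrow> p (\<phi> x) = p x"
  by (auto simp: deck_transformations_def o_def fun_eq_iff)

section \<open>Horizontal curves\<close>

context milnor begin

text \<open>A class of horizontal curves that is easily concatenated: Lipschitz instead of
  absolutely continuous, with finitely many exceptional times instead of a null set.\<close>

definition hreach :: "real \<Rightarrow> real \<Rightarrow> real \<Rightarrow> real^3 \<Rightarrow> real^3 \<Rightarrow> bool" where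
  "hreach b c \<tau> x x' \<longleftrightarrow> 0 \<le> \<tau> \<and> (\<exists>\<gamma> L S. \<gamma> 0 = x \<and> \<gamma> \<tau> = x' \<and> L-lipschitz_on {0..\<tau>} \<gamma> \<and> finite S \<and>
     (\<forall>s\<in>{0..\<tau>} - S. \<exists>a2 a3. a2\<^sup>2 + a3\<^sup>2 \<le> 1 \<and> (\<gamma> has_vector_derivative
       (a2 * sqrt b) *\<^sub>R f 2 (\<gamma> s) + (a3 * sqrt c) *\<^sub>R f 3 (\<gamma> s)) (at s)))"

lemma hreach_imp_horizontal:
  assumes "hreach b c \<tau> x x'"
  obtains \<gamma> where "0 \<le> \<tau>" "horizontal_curve f b c \<tau> \<gamma>" "\<gamma> 0 = x" "\<gamma> \<tau> = x'"
proof -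
  obtain \<gamma> L S where *: "0 \<le> \<tau>" "\<gamma> 0 = x" "\<gamma> \<tau> = x'" "L-lipschitz_on {0..\<tau>} \<gamma>" "finite S"
     and d: "\<forall>s\<in>{0..\<tau>} - S. \<exists>a2 a3. a2\<^sup>2 + a3\<^sup>2 \<le> 1 \<and> (\<gamma> has_vector_derivative
       (a2 * sqrt b) *\<^sub>R f 2 (\<gamma> s) + (a3 * sqrt c) *\<^sub>R f 3 (\<gamma> s)) (at s)"
    using assms unfolding hreach_def by blast
  have "negligible S" using *(5) by (rule negligible_finite)
  then have "AE s in lebesgue. s \<notin> S" by (simp add: negligible_iff_null_sets AE_not_in)
  then have "AE s in lebesgue. s \<in> {0..\<tau>} \<longrightarrow> (\<exists>a2 a3. a2\<^sup>2 + a3\<^sup>2 \<le> 1 \<and> (\<gamma> has_vector_derivative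
       (a2 * sqrt b) *\<^sub>R f 2 (\<gamma> s) + (a3 * sqrt c) *\<^sub>R f 3 (\<gamma> s)) (at s))"
    by (rule AE_mp) (rule AE_I2, use d in blast)
  then have "horizontal_curve f b c \<tau> \<gamma>"
    unfolding horizontal_curve_def using abs_continuous_on_lipschitz[OF *(4)] by blast
  then show thesis using that * by blast
qed

lemma hreach_refl: "hreach b c 0 x x"
  unfolding hreach_def
  by (intro conjI order_refl exI[of _ "\<lambda>_. x"] exI[of _ 0] exI[of _ "{0}"]) (auto simp: lipschitz_on_def)

lemma hreach_trans:
  assumes 1: "hreach b c \<tau>\<^sub>1 x y" and 2: "hreach b c \<tau>\<^sub>2 y z"
  shows "hreach b c (\<tau>\<^sub>1 + \<tau>\<^sub>2) x z"
proof -
  define P where "P \<gamma> s \<longleftrightarrow> (\<exists>a2 a3. a2\<^sup>2 + a3\<^sup>2 \<le> 1 \<and> (\<gamma> has_vector_derivative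
       (a2 * sqrt b) *\<^sub>R f 2 (\<gamma> s) + (a3 * sqrt c) *\<^sub>R f 3 (\<gamma> s)) (at s))" for \<gamma> and s :: real
  obtain \<gamma> L S where g: "0 \<le> \<tau>\<^sub>1" "\<gamma> 0 = x" "\<gamma> \<tau>\<^sub>1 = y" "L-lipschitz_on {0..\<tau>\<^sub>1} \<gamma>" "finite S"
     "\<forall>s\<in>{0..\<tau>\<^sub>1} - S. P \<gamma> s"
    using 1 unfolding hreach_def P_def by blast
  obtain \<delta> K T where d: "0 \<le> \<tau>\<^sub>2" "\<delta> 0 = y" "\<delta> \<tau>\<^sub>2 = z" "K-lipschitz_on {0..\<tau>\<^sub>2} \<delta>" "finite T"
     "\<forall>s\<in>{0..\<tau>\<^sub>2} - T. P \<delta> s"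
    using 2 unfolding hreach_def P_def by blast
  let ?h = "\<lambda>s. if s \<le> \<tau>\<^sub>1 then \<gamma> s else \<delta> (s - \<tau>\<^sub>1)"
  have lip: "(max L K)-lipschitz_on {0..\<tau>\<^sub>1 + \<tau>\<^sub>2} ?h"
  proof (rule lipschitz_on_concat)
    show "(max L K)-lipschitz_on {0..\<tau>\<^sub>1} \<gamma>" using g(4) by (rule lipschitz_on_le) simp
    have "K-lipschitz_on {\<tau>\<^sub>1..\<tau>\<^sub>1 + \<tau>\<^sub>2} (\<lambda>s. \<delta> (s - \<tau>\<^sub>1))"
      unfolding lipschitz_on_def
    proof (intro conjI ballI)
      show "0 \<le> K" by (rule lipschitz_on_nonneg[OF d(4)])
      fix s t assume "s \<in> {\<tau>\<^sub>1..\<tau>\<^sub>1 + \<tau>\<^sub>2}" "t \<in> {\<tau>\<^sub>1..\<tau>\<^sub>1 + \<tau>\<^sub>2}"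
      then show "dist (\<delta> (s - \<tau>\<^sub>1)) (\<delta> (t - \<tau>\<^sub>1)) \<le> K * dist s t"
        using lipschitz_onD[OF d(4), of "s - \<tau>\<^sub>1" "t - \<tau>\<^sub>1"] by (auto simp: dist_real_def)
    qed
    then show "(max L K)-lipschitz_on {\<tau>\<^sub>1..\<tau>\<^sub>1 + \<tau>\<^sub>2} (\<lambda>s. \<delta> (s - \<tau>\<^sub>1))" by (rule lipschitz_on_le) simp
    show "\<gamma> \<tau>\<^sub>1 = \<delta> (\<tau>\<^sub>1 - \<tau>\<^sub>1)" using g d by simp
  qed
  have "P ?h s" if s: "s \<in> {0..\<tau>\<^sub>1 + \<tau>\<^sub>2} - (S \<union> (\<lambda>s. s + \<tau>\<^sub>1) ` T \<union> {\<tau>\<^sub>1})" for s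
  proof (cases "s < \<tau>\<^sub>1")
    case True
    then have "P \<gamma> s" using g(6) s by auto
    then obtain a2 a3 where a: "a2\<^sup>2 + a3\<^sup>2 \<le> 1" "(\<gamma> has_vector_derivative
       (a2 * sqrt b) *\<^sub>R f 2 (\<gamma> s) + (a3 * sqrt c) *\<^sub>R f 3 (\<gamma> s)) (at s)"
      unfolding P_def by blast
    have "(?h has_vector_derivative
       (a2 * sqrt b) *\<^sub>R f 2 (\<gamma> s) + (a3 * sqrt c) *\<^sub>R f 3 (\<gamma> s)) (at s)"
      by (rule has_vector_derivative_transform_within_open[OF a(2), of "{..<\<tau>\<^sub>1}"]) (use True in auto)
    then have "(?h has_vector_derivative
       (a2 * sqrt b) *\<^sub>R f 2 (?h s) + (a3 * sqrt c) *\<^sub>R f 3 (?h s)) (at s)" using True by simp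
    then show ?thesis using a(1) unfolding P_def by blast
  next
    case False
    then have s': "s > \<tau>\<^sub>1" using s by auto
    moreover have "s - \<tau>\<^sub>1 \<notin> T" using s by (auto simp: image_iff)
    ultimately have "P \<delta> (s - \<tau>\<^sub>1)" using d(6) s by auto
    then obtain a2 a3 where a: "a2\<^sup>2 + a3\<^sup>2 \<le> 1" "(\<delta> has_vector_derivative
       (a2 * sqrt b) *\<^sub>R f 2 (\<delta> (s - \<tau>\<^sub>1)) + (a3 * sqrt c) *\<^sub>R f 3 (\<delta> (s - \<tau>\<^sub>1))) (at (s - \<tau>\<^sub>1))"
      unfolding P_def by blast
    have "((\<lambda>s. s - \<tau>\<^sub>1) has_vector_derivative 1) (at s)" by (auto intro!: derivative_eq_intros)
    from vector_diff_chain_at[OF this a(2)]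
    have "((\<lambda>s. \<delta> (s - \<tau>\<^sub>1)) has_vector_derivative
       (a2 * sqrt b) *\<^sub>R f 2 (\<delta> (s - \<tau>\<^sub>1)) + (a3 * sqrt c) *\<^sub>R f 3 (\<delta> (s - \<tau>\<^sub>1))) (at s)"
      by (simp add: o_def)
    then have "(?h has_vector_derivative
       (a2 * sqrt b) *\<^sub>R f 2 (\<delta> (s - \<tau>\<^sub>1)) + (a3 * sqrt c) *\<^sub>R f 3 (\<delta> (s - \<tau>\<^sub>1))) (at s)"
      by (rule has_vector_derivative_transform_within_open[of _ _ _ "{\<tau>\<^sub>1<..}"]) (use s' in auto)
    then have "(?h has_vector_derivative
       (a2 * sqrt b) *\<^sub>R f 2 (?h s) + (a3 * sqrt c) *\<^sub>R f 3 (?h s)) (at s)" using s' by simp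
    then show ?thesis using a(1) unfolding P_def by blast
  qed
  moreover have "?h 0 = x" "?h (\<tau>\<^sub>1 + \<tau>\<^sub>2) = z" using g d by (auto simp: )
  ultimately show ?thesis
    unfolding hreach_def P_def[symmetric] using g(1,5) d(1,5) lip
    by (intro conjI exI[of _ ?h] exI[of _ "max L K"] exI[of _ "S \<union> (\<lambda>s. s + \<tau>\<^sub>1) ` T \<union> {\<tau>\<^sub>1}"]) auto
qed

lemma lipschitz_on_seg: "\<exists>L. L-lipschitz_on {0..1} (seg x x')"
proof -
  let ?D = "\<lambda>s. vec (seg x x' s) (w1 x x') (th2 x' - th2 x) (th3 x' - th3 x)"
  have cs: "continuous_on {0..1} (seg x x')"
    by (rule continuous_on_vector_derivative) (rule has_vector_derivative_at_within[OF seg_has_vector_derivative])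
  have "compact (?D ` {0..1})"
    by (rule compact_continuous_image[OF continuous_on_vec_of[OF cs]]) simp
  then have "bounded (?D ` {0..1})" by (rule compact_imp_bounded)
  then obtain C where "\<forall>y\<in>?D ` {0..1}. norm y \<le> C" by (auto simp only: bounded_iff)
  then have C: "norm (?D s) \<le> C" if "s \<in> {0..1}" for s using that by (metis imageI)
  have C0: "0 \<le> C" by (rule order_trans[OF norm_ge_zero C[of 0]]) simp
  have "C-lipschitz_on {0..1} (seg x x')"
  proof (rule bounded_derivative_imp_lipschitz[OF _ _ _ C0])
    fix s :: real assume s: "s \<in> {0..1}"
    show "(seg x x' has_derivative (\<lambda>h. h *\<^sub>R ?D s)) (at s within {0..1})"
      by (rule has_vector_derivative_at_within[OF seg_has_vector_derivative, unfolded has_vector_derivative_def])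
    show "onorm (\<lambda>h. h *\<^sub>R ?D s) \<le> C"
    proof (rule onorm_le)
      fix h :: real
      show "norm (h *\<^sub>R ?D s) \<le> C * norm h"
        unfolding norm_scaleR real_norm_def using mult_left_mono[OF C[OF s] abs_ge_zero[of h]]
        by (simp only: mult.commute)
    qed
  qed simp
  then show ?thesis by blast
qed

text \<open>If \<open>w1 x x'\<close> vanishes, the segment has no vertical velocity and, run at
  unit speed, is horizontal. The coefficients \<open>1 / b\<close> and \<open>1 / c\<close> occur
  because \<open>sqrt (1 / b)\<close> times \<open>f 2\<close> and \<open>sqrt (1 / c)\<close> times
  \<open>f 3\<close> have length one.\<close>

lemma hreach_seg:
  assumes bc: "b > 0" "c > 0" and w: "w1 x x' = 0"
  shows "hreach (1 / b) (1 / c) (cmod (pt b c x' - pt b c x)) x x'"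
proof (cases "pt b c x' = pt b c x")
  \<comment> \<open>Unit speed is impossible here, but if the projections agree then so do the
    points.\<close>
  case True
  then have "th2 x = th2 x'" "th3 x = th3 x'" using bc by (simp_all add: pt_def)
  moreover from this have "y1 x = y1 x'" using w by (simp add: w1_def)
  ultimately have "x = x'" by (intro coordinates_eqI)
  then show ?thesis by (simp add: hreach_refl)
next
  case False
  define \<tau> where "\<tau> = cmod (pt b c x' - pt b c x)"
  have \<tau>: "\<tau> > 0" using False by (simp add: \<tau>_def)
  define \<gamma> where "\<gamma> s = seg x x' (s / \<tau>)" for s
  define a2 where "a2 = sqrt b * (th2 x' - th2 x) / \<tau>"
  define a3 where "a3 = sqrt c * (th3 x' - th3 x) / \<tau>"
  have "\<tau>\<^sup>2 = (sqrt b * (th2 x' - th2 x))\<^sup>2 + (sqrt c * (th3 x' - th3 x))\<^sup>2"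
    unfolding \<tau>_def cmod_power2 by (simp add: pt_def right_diff_distrib)
  moreover have "a2\<^sup>2 + a3\<^sup>2 = ((sqrt b * (th2 x' - th2 x))\<^sup>2 + (sqrt c * (th3 x' - th3 x))\<^sup>2) / \<tau>\<^sup>2"
    by (simp only: a2_def a3_def power_divide add_divide_distrib)
  ultimately have "a2\<^sup>2 + a3\<^sup>2 = \<tau>\<^sup>2 / \<tau>\<^sup>2" by (simp only:)
  then have a: "a2\<^sup>2 + a3\<^sup>2 = 1" using \<tau> by simp
  have e: "a2 * sqrt (1 / b) = (th2 x' - th2 x) / \<tau>" "a3 * sqrt (1 / c) = (th3 x' - th3 x) / \<tau>"
    using bc by (simp_all add: a2_def a3_def real_sqrt_divide)
  have d: "(\<gamma> has_vector_derivative (a2 * sqrt (1 / b)) *\<^sub>R f 2 (\<gamma> s) + (a3 * sqrt (1 / c)) *\<^sub>R f 3 (\<gamma> s)) (at s)" for s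
  proof -
    have "((\<lambda>s. s / \<tau>) has_vector_derivative 1 / \<tau>) (at s)"
      by (auto intro!: derivative_eq_intros)
    from vector_diff_chain_at[OF this seg_has_vector_derivative]
    have "(\<gamma> has_vector_derivative (1 / \<tau>) *\<^sub>R vec (\<gamma> s) (w1 x x') (th2 x' - th2 x) (th3 x' - th3 x)) (at s)"
      by (simp add: o_def \<gamma>_def[abs_def])
    moreover have "(1 / \<tau>) *\<^sub>R vec (\<gamma> s) (w1 x x') (th2 x' - th2 x) (th3 x' - th3 x)
        = (a2 * sqrt (1 / b)) *\<^sub>R f 2 (\<gamma> s) + (a3 * sqrt (1 / c)) *\<^sub>R f 3 (\<gamma> s)"
      unfolding e w vec_def by (simp add: scaleR_add_right)
    ultimately show ?thesis by simp
  qed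
  obtain L where L: "L-lipschitz_on {0..1} (seg x x')" using lipschitz_on_seg by blast
  have "(L / \<tau>)-lipschitz_on {0..\<tau>} \<gamma>"
    unfolding lipschitz_on_def
  proof (intro conjI ballI)
    show "0 \<le> L / \<tau>" using lipschitz_on_nonneg[OF L] \<tau> by simp
    fix s t assume "s \<in> {0..\<tau>}" "t \<in> {0..\<tau>}"
    then have "dist (\<gamma> s) (\<gamma> t) \<le> L * dist (s / \<tau>) (t / \<tau>)"
      unfolding \<gamma>_def using \<tau> by (intro lipschitz_onD[OF L]) auto
    also have "dist (s / \<tau>) (t / \<tau>) = dist s t / \<tau>"
      using \<tau> by (simp add: dist_real_def diff_divide_distrib[symmetric])
    finally show "dist (\<gamma> s) (\<gamma> t) \<le> L / \<tau> * dist s t" by simp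
  qed
  moreover have "\<gamma> 0 = x" "\<gamma> \<tau> = x'" using \<tau> by (simp_all add: \<gamma>_def)
  ultimately show ?thesis
    unfolding hreach_def \<tau>_def[symmetric] using \<tau> a
    by (intro conjI exI[of _ \<gamma>] exI[of _ "L / \<tau>"] exI[of _ "{}"] ballI exI[of _ a2] exI[of _ a3] d) auto
qed

text \<open>End point of the horizontal lift, starting at \<open>x\<close>, of the straight line
  from \<open>pt b c x\<close> to \<open>z\<close>.\<close>

definition htarget :: "real \<Rightarrow> real \<Rightarrow> real^3 \<Rightarrow> complex \<Rightarrow> real^3" where
  "htarget b c x z = Yinv (y1 x + Im (cnj (pt b c x) * z) / sqrt (b * c)) (Re z / sqrt b) (Im z / sqrt c)"

lemma htarget:
  assumes "b > 0" "c > 0"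
  shows "pt b c (htarget b c x z) = z"
    and "y1 (htarget b c x z) = y1 x + Im (cnj (pt b c x) * z) / sqrt (b * c)"
    and "w1 x (htarget b c x z) = 0"
proof -
  show 1: "pt b c (htarget b c x z) = z"
    using assms by (simp add: htarget_def pt_def complex_eq_iff)
  show "y1 (htarget b c x z) = y1 x + Im (cnj (pt b c x) * z) / sqrt (b * c)"
    by (simp add: htarget_def)
  then show "w1 x (htarget b c x z) = 0"
    unfolding w1_def area_pt[OF assms] 1 by simp
qed

lemma hreach_htarget:
  assumes "b > 0" "c > 0"
  shows "hreach (1 / b) (1 / c) (cmod (z - pt b c x)) x (htarget b c x z)"
  using hreach_seg[OF assms htarget(3)[OF assms]] by (simp add: htarget(1)[OF assms])

text \<open>Going around a square of side \<open>l\<close> moves vertically by twice its area.\<close>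

lemma hreach_vertical:
  assumes bc: "b > 0" "c > 0" and pt: "pt b c x' = pt b c x"
  shows "hreach (1 / b) (1 / c) (4 * sqrt (sqrt (b * c) / 2 * \<bar>y1 x' - y1 x\<bar>)) x x'"
proof -
  define k where "k = sqrt (b * c)"
  have k: "k > 0" using bc by (simp add: k_def)
  \<comment> \<open>The loop moves vertically by \<open>2 * l^2 / k\<close>, which has to equal the
    gap.\<close>
  define l where "l = sqrt (k / 2 * \<bar>y1 x' - y1 x\<bar>)"
  have l: "l \<ge> 0" "l\<^sup>2 = k / 2 * \<bar>y1 x' - y1 x\<bar>" using k by (simp_all add: l_def)
  define \<sigma> where "\<sigma> = sgn (y1 x' - y1 x)"
  \<comment> \<open>The orientation of the square decides between up and down.\<close>
  define \<zeta> where "\<zeta> = (if \<sigma> = -1 then - \<i> else \<i>)"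
  have z: "cmod \<zeta> = 1" "Im \<zeta> * \<bar>y1 x' - y1 x\<bar> = y1 x' - y1 x" "Re \<zeta> = 0"
    by (auto simp: \<zeta>_def \<sigma>_def sgn_if)
  define p0 where "p0 = pt b c x"
  define p1 where "p1 = p0 + of_real l"
  define p2 where "p2 = p0 + of_real l + \<zeta> * of_real l"
  define p3 where "p3 = p0 + \<zeta> * of_real l"
  define x1 where "x1 = htarget b c x p1"
  define x2 where "x2 = htarget b c x1 p2"
  define x3 where "x3 = htarget b c x2 p3"
  define x4 where "x4 = htarget b c x3 p0"
  have P: "pt b c x1 = p1" "pt b c x2 = p2" "pt b c x3 = p3" "pt b c x4 = p0"
    by (simp_all add: x1_def x2_def x3_def x4_def htarget[OF bc])
  have "y1 x4 = y1 x + (Im (cnj p0 * p1) + Im (cnj p1 * p2) + Im (cnj p2 * p3) + Im (cnj p3 * p0)) / k"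
    unfolding x4_def htarget(2)[OF bc] P(3) unfolding x3_def htarget(2)[OF bc] P(2)
    unfolding x2_def htarget(2)[OF bc] P(1) unfolding x1_def htarget(2)[OF bc] p0_def[symmetric] k_def[symmetric]
    by (simp add: add_divide_distrib)
  also have "Im (cnj p0 * p1) + Im (cnj p1 * p2) + Im (cnj p2 * p3) + Im (cnj p3 * p0) = 2 * Im \<zeta> * l\<^sup>2"
    unfolding p1_def p2_def p3_def using z(3) by (simp add: algebra_simps power2_eq_square)
  also have "y1 x + 2 * Im \<zeta> * l\<^sup>2 / k = y1 x'" unfolding l(2) using k z(2) by simp
  finally have "x4 = x'"
    using P(4) pt bc by (intro coordinates_eqI) (simp_all add: p0_def pt_def)
  have h: "hreach (1 / b) (1 / c) l y (htarget b c y p)" if "cmod (p - pt b c y) = l" for y p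
    using hreach_htarget[OF bc, of p y] that by simp
  have "hreach (1 / b) (1 / c) (l + l + l + l) x x4"
    unfolding x4_def
    by (rule hreach_trans[OF _ h], unfold x3_def, rule hreach_trans[OF _ h], unfold x2_def,
        rule hreach_trans[OF _ h], unfold x1_def, rule h)
      (use l(1) z(1) in \<open>simp_all add: x1_def[symmetric] x2_def[symmetric] x3_def[symmetric] P p0_def[symmetric],
        simp_all add: p1_def p2_def p3_def norm_mult\<close>)
  then show ?thesis unfolding \<open>x4 = x'\<close> l_def k_def by (simp add: algebra_simps)
qed

lemma hreach_any:
  assumes bc: "b > 0" "c > 0"
  shows "hreach (1 / b) (1 / c) (cmod (pt b c x' - pt b c x) + 4 * sqrt (sqrt (b * c) / 2 * \<bar>w1 x x'\<bar>)) x x'"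
proof -
  let ?y = "htarget b c x (pt b c x')"
  have "y1 x' - y1 ?y = w1 x x'"
    unfolding htarget(2)[OF bc] w1_def area_pt[OF bc] by simp
  then show ?thesis
    using hreach_trans[OF hreach_htarget[OF bc, of "pt b c x'" x] hreach_vertical[OF bc, of x' ?y]]
    by (simp add: htarget(1)[OF bc])
qed

text \<open>Each step follows a horizontal segment to a point over the next \<open>x i\<close>. The
  vertical gap is not closed at once: lifting over the same line keeps it, so the gaps add up and
  one loop at the end closes their sum. This costs one square root of \<open>n * e\<close> in place
  of \<open>n\<close> square roots of \<open>e\<close>.\<close>

lemma hreach_chain:
  assumes bc: "b > 0" "c > 0"
    and x: "\<And>i. i < n \<Longrightarrow> cmod (pt b c (x (Suc i)) - pt b c (x i)) \<le> d"
      "\<And>i. i < n \<Longrightarrow> \<bar>w1 (x i) (x (Suc i))\<bar> \<le> e"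
  shows "\<exists>\<tau>. \<tau> \<le> real n * d + 4 * sqrt (sqrt (b * c) / 2 * (real n * e)) \<and> hreach (1 / b) (1 / c) \<tau> (x 0) (x n)"
proof -
  have "m \<le> n \<Longrightarrow> \<exists>\<tau> z. \<tau> \<le> real m * d \<and> hreach (1 / b) (1 / c) \<tau> (x 0) z \<and> pt b c z = pt b c (x m) \<and>
     \<bar>y1 (x m) - y1 z\<bar> \<le> real m * e" for m
  proof (induction m)
    case 0
    then show ?case by (intro exI[of _ 0] exI[of _ "x 0"]) (simp add: hreach_refl)
  next
    case (Suc m)
    then obtain \<tau> z where z: "\<tau> \<le> real m * d" "hreach (1 / b) (1 / c) \<tau> (x 0) z" "pt b c z = pt b c (x m)"
      "\<bar>y1 (x m) - y1 z\<bar> \<le> real m * e" by auto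
    let ?z = "htarget b c z (pt b c (x (Suc m)))"
    have "y1 (x (Suc m)) - y1 ?z = y1 (x m) - y1 z + w1 (x m) (x (Suc m))"
      unfolding htarget(2)[OF bc] z(3) w1_def area_pt[OF bc] by simp
    then have "\<bar>y1 (x (Suc m)) - y1 ?z\<bar> \<le> real (Suc m) * e"
      using z(4) x(2)[of m] Suc.prems by (simp add: distrib_right)
    moreover have "hreach (1 / b) (1 / c) (\<tau> + cmod (pt b c (x (Suc m)) - pt b c (x m))) (x 0) ?z"
      using hreach_trans[OF z(2) hreach_htarget[OF bc, of "pt b c (x (Suc m))" z]] by (simp add: z(3))
    moreover have "\<tau> + cmod (pt b c (x (Suc m)) - pt b c (x m)) \<le> real (Suc m) * d"
      using z(1) x(1)[of m] Suc.prems by (simp add: distrib_right)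
    ultimately show ?case using htarget(1)[OF bc] by blast
  qed
  from this[of n] obtain \<tau> z where z: "\<tau> \<le> real n * d" "hreach (1 / b) (1 / c) \<tau> (x 0) z" "pt b c z = pt b c (x n)"
      "\<bar>y1 (x n) - y1 z\<bar> \<le> real n * e" by auto
  define q where "q = sqrt (sqrt (b * c) / 2 * \<bar>y1 (x n) - y1 z\<bar>)"
  have "q \<le> sqrt (sqrt (b * c) / 2 * (real n * e))"
    unfolding q_def using z(4) bc by (intro real_sqrt_le_mono mult_left_mono) auto
  moreover have "hreach (1 / b) (1 / c) (\<tau> + 4 * q) (x 0) (x n)"
    using hreach_trans[OF z(2) hreach_vertical[OF bc z(3)[symmetric]]] by (simp only: q_def)
  ultimately show ?thesis using z(1) by (intro exI[of _ "\<tau> + 4 * q"] conjI) linarith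
qed

section \<open>Comparison of the Riemannian and the sub-Riemannian distance\<close>

lemma polygon_admissible:
  assumes pos: "a \<ge> 0" "b \<ge> 0" "c \<ge> 0"
  shows "\<exists>\<gamma>. admissible (diag_metric f a b c) \<gamma> \<and> \<gamma> 0 = x 0 \<and> \<gamma> 1 = x n \<and>
     len (diag_metric f a b c) \<gamma> = (\<Sum>i<n. NN a b c (x i) (x (Suc i)))"
proof (induction n)
  case 0
  show ?case
    using seg_length[OF pos, of "x 0" "x 0"] by (intro exI[of _ "seg (x 0) (x 0)"]) (simp add: NN_def norm_Pair)
next
  case (Suc n)
  then obtain \<gamma> where g: "admissible (diag_metric f a b c) \<gamma>" "\<gamma> 0 = x 0" "\<gamma> 1 = x n"
     "len (diag_metric f a b c) \<gamma> = (\<Sum>i<n. NN a b c (x i) (x (Suc i)))" by blast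
  have e: "\<gamma> 1 = seg (x n) (x (Suc n)) 0" using g by simp
  show ?case
    using admissible_join[OF quadratic_diag_metric[OF pos] g(1) seg_length(1)[OF pos] e] g seg_length(2)[OF pos]
    by (intro exI[of _ "\<gamma> +++ seg (x n) (x (Suc n))"]) (simp add: joinpaths_def)
qed

text \<open>\<open>w1 x0\<close> is affine up to a multiple of \<open>x$1 * x$2\<close>, hence
  Lipschitz on bounded sets. This makes it absolutely continuous along absolutely continuous
  curves.\<close>

lemma w1_lipschitz_on_ball:
  obtains K where "0 \<le> K"
    "\<And>x x'. norm x \<le> R \<Longrightarrow> norm x' \<le> R \<Longrightarrow> norm (w1 x0 x - w1 x0 x') \<le> K * norm (x - x')"
proof -
  define l where "l v = (v$3 - F0 2 $ 3 * th2 v - F0 3 $ 3 * th3 v) / kap - (th2 x0 * th3 v - th3 x0 * th2 v)" for v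
  have "linear l"
    by (rule linearI) (simp_all add: l_def th_linear add_divide_distrib diff_divide_distrib algebra_simps)
  then obtain B where B: "B \<ge> 0" "\<And>v. norm (l v) \<le> norm v * B"
    using bounded_linear.nonneg_bounded[OF linear_conv_bounded_linear[THEN iffD1]] by blast
  have w: "w1 x0 x - w1 x0 x' = l (x - x') - (x$1 * (x - x')$2 + (x - x')$1 * x'$2) / (2 * kap)" for x x'
    unfolding w1_def y1_def l_def using kap_nz by (simp add: th_linear field_simps)
  define K where "K = B + (\<bar>R\<bar> + \<bar>R\<bar>) / \<bar>2 * kap\<bar>"
  show thesis
  proof
    show "0 \<le> K" using B(1) by (simp add: K_def)
    fix x x' :: "real^3" assume R: "norm x \<le> R" "norm x' \<le> R"
    have i: "\<bar>x$1\<bar> \<le> \<bar>R\<bar>" "\<bar>x'$2\<bar> \<le> \<bar>R\<bar>" "\<bar>(x - x')$2\<bar> \<le> norm (x - x')" "\<bar>(x - x')$1\<bar> \<le> norm (x - x')"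
      using R component_le_norm_cart[of x 1] component_le_norm_cart[of x' 2]
        component_le_norm_cart[of "x - x'" 2] component_le_norm_cart[of "x - x'" 1] by linarith+
    have "\<bar>x$1 * (x - x')$2 + (x - x')$1 * x'$2\<bar> \<le> \<bar>x$1\<bar> * \<bar>(x - x')$2\<bar> + \<bar>(x - x')$1\<bar> * \<bar>x'$2\<bar>"
      using abs_triangle_ineq[of "x$1 * (x - x')$2" "(x - x')$1 * x'$2"] by (simp only: abs_mult)
    also have "\<dots> \<le> \<bar>R\<bar> * norm (x - x') + norm (x - x') * \<bar>R\<bar>"
      using i by (intro add_mono mult_mono) auto
    finally have "\<bar>(x$1 * (x - x')$2 + (x - x')$1 * x'$2) / (2 * kap)\<bar> \<le> (\<bar>R\<bar> * norm (x - x') + norm (x - x') * \<bar>R\<bar>) / \<bar>2 * kap\<bar>"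
      unfolding abs_divide by (rule divide_right_mono) simp
    then have "\<bar>w1 x0 x - w1 x0 x'\<bar> \<le> norm (x - x') * B + (\<bar>R\<bar> * norm (x - x') + norm (x - x') * \<bar>R\<bar>) / \<bar>2 * kap\<bar>"
      unfolding w using B(2)[of "x - x'"] by (simp only: real_norm_def)
    also have "\<dots> = K * norm (x - x')"
      unfolding K_def by (simp add: algebra_simps add_divide_distrib)
    finally show "norm (w1 x0 x - w1 x0 x') \<le> K * norm (x - x')" by simp
  qed
qed

text \<open>A horizontal curve has plane speed at most one and no \<open>th1\<close> component. Its
  vertical displacement comes from swept area alone, at a rate of at most
  \<open>(s' - s) / sqrt (b * c)\<close>, and is therefore quadratic in the elapsed time.\<close>

lemma horizontal_curve_estimate:
  assumes bc: "b > 0" "c > 0" and hor: "horizontal_curve f (1 / b) (1 / c) \<tau> \<gamma>"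
    and s: "0 \<le> s" "s \<le> s'" "s' \<le> \<tau>"
  shows "cmod (pt b c (\<gamma> s') - pt b c (\<gamma> s)) \<le> s' - s"
    and "\<bar>w1 (\<gamma> s) (\<gamma> s')\<bar> \<le> (s' - s)\<^sup>2 / sqrt (b * c)"
proof -
  have ac: "abs_continuous_on {0..\<tau>} \<gamma>" using hor by (simp add: horizontal_curve_def)
  define H where "H r D \<longleftrightarrow> (\<gamma> has_vector_derivative D) (at r) \<and> th1 (\<gamma> r) D = 0 \<and> cmod (pt b c D) \<le> 1" for r D
  have aeH: "AE r in lebesgue. r \<in> {0..\<tau>} \<longrightarrow> (\<exists>D. H r D)"
  proof -
    have "\<exists>D. H r D" if "a2\<^sup>2 + a3\<^sup>2 \<le> 1"
      "(\<gamma> has_vector_derivative (a2 * sqrt (1 / b)) *\<^sub>R f 2 (\<gamma> r) + (a3 * sqrt (1 / c)) *\<^sub>R f 3 (\<gamma> r)) (at r)" for r a2 a3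
    proof -
      let ?D = "(a2 * sqrt (1 / b)) *\<^sub>R f 2 (\<gamma> r) + (a3 * sqrt (1 / c)) *\<^sub>R f 3 (\<gamma> r)"
      have "pt b c ?D = Complex a2 a3"
        using bc by (simp add: pt_def th_linear th_frame real_sqrt_divide)
      then have "cmod (pt b c ?D) \<le> 1" using that(1) by (simp add: cmod_def)
      moreover have "th1 (\<gamma> r) ?D = 0" by (simp add: th_linear th_frame)
      ultimately show ?thesis using that(2) unfolding H_def by blast
    qed
    moreover have "AE r in lebesgue. r \<in> {0..\<tau>} \<longrightarrow> (\<exists>a2 a3. a2\<^sup>2 + a3\<^sup>2 \<le> 1 \<and>
      (\<gamma> has_vector_derivative (a2 * sqrt (1 / b)) *\<^sub>R f 2 (\<gamma> r) + (a3 * sqrt (1 / c)) *\<^sub>R f 3 (\<gamma> r)) (at r))"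
      using hor by (simp add: horizontal_curve_def)
    ultimately show ?thesis by (elim AE_mp) (rule AE_I2, blast)
  qed
  have "continuous_on {0..\<tau>} \<gamma>" by (rule abs_continuous_on_imp_continuous[OF ac])
  then have "bounded (\<gamma> ` {0..\<tau>})" by (intro compact_imp_bounded compact_continuous_image) auto
  then obtain R where R: "\<forall>y\<in>\<gamma> ` {0..\<tau>}. norm y \<le> R" by (auto simp only: bounded_iff)
  obtain K1 where K1: "K1 \<ge> 0" "\<And>v. norm (pt b c v) \<le> norm v * K1"
    using bounded_linear.nonneg_bounded[OF pt_bounded_linear] by blast
  have ac1: "abs_continuous_on {0..\<tau>} (\<lambda>r. pt b c (\<gamma> r))"
    by (rule abs_continuous_on_compose[OF ac K1(1)]) (use K1(2) in \<open>simp add: pt_linear(2)[symmetric] mult.commute\<close>)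
  have est: "cmod (pt b c (\<gamma> r) - pt b c (\<gamma> s)) \<le> 1 * (r - s)" if r: "r \<in> {s..\<tau>}" for r
  proof (rule abs_continuous_mean_value)
    show "abs_continuous_on {s..r} (\<lambda>r. pt b c (\<gamma> r))"
      by (rule abs_continuous_on_subset[OF ac1]) (use s r in auto)
    have "\<exists>v. ((\<lambda>r. pt b c (\<gamma> r)) has_vector_derivative v) (at z) \<and> norm v \<le> 1" if "H z D" for z D
      using that bounded_linear.has_vector_derivative[OF pt_bounded_linear] unfolding H_def by blast
    then have "\<And>z. (z \<in> {0..\<tau>} \<longrightarrow> (\<exists>D. H z D)) \<longrightarrow> z \<in> {s..r} \<longrightarrow>
        (\<exists>v. ((\<lambda>r. pt b c (\<gamma> r)) has_vector_derivative v) (at z) \<and> norm v \<le> 1)"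
      using s r by (metis atLeastAtMost_iff order_trans)
    then show "AE z in lebesgue. z \<in> {s..r} \<longrightarrow>
        (\<exists>v. ((\<lambda>r. pt b c (\<gamma> r)) has_vector_derivative v) (at z) \<and> norm v \<le> 1)"
      using aeH by (elim AE_mp) (rule AE_I2)
  qed (use r in auto)
  show "cmod (pt b c (\<gamma> s') - pt b c (\<gamma> s)) \<le> s' - s" using est[of s'] s by simp
  obtain K2 where K2: "0 \<le> K2"
    "\<And>x x'. norm x \<le> R \<Longrightarrow> norm x' \<le> R \<Longrightarrow> norm (w1 (\<gamma> s) x - w1 (\<gamma> s) x') \<le> K2 * norm (x - x')"
    by (rule w1_lipschitz_on_ball[of R "\<gamma> s"]) (rule that; blast)
  have ac2: "abs_continuous_on {0..\<tau>} (\<lambda>r. w1 (\<gamma> s) (\<gamma> r))"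
    by (rule abs_continuous_on_compose[OF ac K2(1)]) (use K2(2) R in blast)
  have "norm (w1 (\<gamma> s) (\<gamma> s') - w1 (\<gamma> s) (\<gamma> s)) \<le> ((s' - s) / sqrt (b * c)) * (s' - s)"
  proof (rule abs_continuous_mean_value[OF _ s(2)])
    show "abs_continuous_on {s..s'} (\<lambda>r. w1 (\<gamma> s) (\<gamma> r))"
      by (rule abs_continuous_on_subset[OF ac2]) (use s in auto)
    show "0 \<le> (s' - s) / sqrt (b * c)" using s bc by simp
    have "\<exists>v. ((\<lambda>r. w1 (\<gamma> s) (\<gamma> r)) has_vector_derivative v) (at z) \<and> norm v \<le> (s' - s) / sqrt (b * c)"
      if "H z D" "z \<in> {s..s'}" for z D
    proof -
      have "\<bar>Im (cnj (pt b c (\<gamma> z - \<gamma> s)) * pt b c D)\<bar> \<le> cmod (pt b c (\<gamma> z - \<gamma> s)) * cmod (pt b c D)"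
        using abs_Im_le_cmod[of "cnj (pt b c (\<gamma> z - \<gamma> s)) * pt b c D"] by (simp add: norm_mult)
      also have "\<dots> \<le> (s' - s) * 1"
        using est[of z] that s by (intro mult_mono) (auto simp: pt_linear H_def)
      finally have "norm (th1 (\<gamma> z) D + Im (cnj (pt b c (\<gamma> z - \<gamma> s)) * pt b c D) / sqrt (b * c)) \<le> (s' - s) / sqrt (b * c)"
        using that(1) bc by (simp add: H_def abs_divide divide_right_mono)
      then show ?thesis using w1_has_vector_derivative[OF bc] that(1) unfolding H_def by blast
    qed
    then have "\<And>z. (z \<in> {0..\<tau>} \<longrightarrow> (\<exists>D. H z D)) \<longrightarrow> z \<in> {s..s'} \<longrightarrow>
        (\<exists>v. ((\<lambda>r. w1 (\<gamma> s) (\<gamma> r)) has_vector_derivative v) (at z) \<and> norm v \<le> (s' - s) / sqrt (b * c))"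
      using s by (metis atLeastAtMost_iff order_trans)
    then show "AE z in lebesgue. z \<in> {s..s'} \<longrightarrow>
        (\<exists>v. ((\<lambda>r. w1 (\<gamma> s) (\<gamma> r)) has_vector_derivative v) (at z) \<and> norm v \<le> (s' - s) / sqrt (b * c))"
      using aeH by (elim AE_mp) (rule AE_I2)
  qed
  then show "\<bar>w1 (\<gamma> s) (\<gamma> s')\<bar> \<le> (s' - s)\<^sup>2 / sqrt (b * c)" by (simp add: power2_eq_square)
qed

text \<open>Horizontal curves are merely absolutely continuous, so they enter
  \<open>riem_dist\<close> through inscribed polygons. The vertical part of each of the
  \<open>n\<close> segments is quadratic in \<open>h = \<tau> / n\<close>, so the total excess tends
  to \<open>0\<close>.\<close>

lemma riem_dist_le_horizontal:
  assumes pos: "a > 0" "b > 0" "c > 0" and \<tau>: "0 \<le> \<tau>" and hor: "horizontal_curve f (1 / b) (1 / c) \<tau> \<gamma>"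
  shows "riem_dist p (diag_metric f a b c) (p (\<gamma> 0)) (p (\<gamma> \<tau>)) \<le> \<tau>"
proof -
  let ?g = "diag_metric f a b c"
  let ?C = "sqrt a * \<tau>\<^sup>2 / sqrt (b * c)"
  have pos': "a \<ge> 0" "b \<ge> 0" "c \<ge> 0" using pos by simp_all
  have "riem_dist p ?g (p (\<gamma> 0)) (p (\<gamma> \<tau>)) \<le> \<tau> + ?C * inverse (real (Suc m))" for m
  proof -
    define n where "n = Suc m"
    define h where "h = \<tau> / real n"
    have h: "h \<ge> 0" "real n * h = \<tau>" using \<tau> by (simp_all add: h_def n_def)
    define x where "x i = \<gamma> (real i * h)" for i
    have step: "NN a b c (x i) (x (Suc i)) \<le> sqrt a * (h\<^sup>2 / sqrt (b * c)) + h" if "i < n" for i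
    proof -
      have "real (Suc i) * h \<le> real n * h" using that h(1) by (intro mult_right_mono) auto
      then have "0 \<le> real i * h" "real i * h \<le> real (Suc i) * h" "real (Suc i) * h \<le> \<tau>"
        using h by (simp_all add: mult_right_mono)
      note e = horizontal_curve_estimate[OF pos(2,3) hor this]
      have d: "real (Suc i) * h - real i * h = h" by (simp add: algebra_simps)
      have "NN a b c (x i) (x (Suc i)) \<le> norm (sqrt a * w1 (x i) (x (Suc i))) + cmod (pt b c (x (Suc i)) - pt b c (x i))"
        unfolding NN_def by (rule norm_Pair_le)
      also have "\<dots> \<le> sqrt a * (h\<^sup>2 / sqrt (b * c)) + h"
      proof (rule add_mono)
        have "norm (sqrt a * w1 (x i) (x (Suc i))) = sqrt a * \<bar>w1 (x i) (x (Suc i))\<bar>"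
          using pos by (simp add: abs_mult)
        also have "\<dots> \<le> sqrt a * (h\<^sup>2 / sqrt (b * c))"
          using e(2) pos(1) unfolding d x_def by (intro mult_left_mono) simp_all
        finally show "norm (sqrt a * w1 (x i) (x (Suc i))) \<le> sqrt a * (h\<^sup>2 / sqrt (b * c))" .
        show "cmod (pt b c (x (Suc i)) - pt b c (x i)) \<le> h" using e(1) unfolding d x_def .
      qed
      finally show ?thesis .
    qed
    obtain \<delta> where \<delta>: "admissible ?g \<delta>" "\<delta> 0 = x 0" "\<delta> 1 = x n" "len ?g \<delta> = (\<Sum>i<n. NN a b c (x i) (x (Suc i)))"
      using polygon_admissible[OF pos', of x n] by blast
    have "p (\<delta> 0) = p (\<gamma> 0)" "p (\<delta> 1) = p (\<gamma> \<tau>)" using \<delta> h by (simp_all add: x_def)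
    from riem_dist_le[OF quadratic_diag_metric[OF pos'] \<delta>(1) this]
    have "riem_dist p ?g (p (\<gamma> 0)) (p (\<gamma> \<tau>)) \<le> (\<Sum>i<n. NN a b c (x i) (x (Suc i)))" unfolding \<delta>(4) .
    also have "\<dots> \<le> (\<Sum>i<n. sqrt a * (h\<^sup>2 / sqrt (b * c)) + h)" by (intro sum_mono step) simp
    also have "\<dots> = real n * h + sqrt a * ((real n * h) * h) / sqrt (b * c)"
      by (simp add: power2_eq_square algebra_simps)
    also have "\<dots> = \<tau> + ?C * inverse (real (Suc m))"
      unfolding h(2) by (simp add: h_def n_def power2_eq_square field_simps)
    finally show ?thesis .
  qed
  moreover have "(\<lambda>m. \<tau> + ?C * inverse (real (Suc m))) \<longlonglongrightarrow> \<tau> + ?C * 0"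
    by (intro tendsto_intros LIMSEQ_inverse_real_of_nat)
  ultimately show ?thesis
    by (intro LIMSEQ_le_const[where a="riem_dist p ?g (p (\<gamma> 0)) (p (\<gamma> \<tau>))" and x=\<tau>]) auto
qed

lemma subriem_dist_le:
  assumes "hreach b c \<tau> x x'"
  shows "subriem_dist p f b c (p x) (p x') \<le> \<tau>"
proof -
  obtain \<gamma> where "0 \<le> \<tau>" "horizontal_curve f b c \<tau> \<gamma>" "\<gamma> 0 = x" "\<gamma> \<tau> = x'"
    using hreach_imp_horizontal[OF assms] by blast
  then show ?thesis
    unfolding subriem_dist_def by (intro cInf_lower) (auto intro!: bdd_belowI[of _ 0])
qed

lemma riem_dist_le_subriem_dist:
  assumes pos: "a > 0" "b > 0" "c > 0"
  shows "riem_dist p (diag_metric f a b c) (p x) (p x') \<le> subriem_dist p f (1 / b) (1 / c) (p x) (p x')"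
  unfolding subriem_dist_def
proof (rule cInf_greatest)
  obtain \<tau> \<gamma> where "0 \<le> \<tau>" "horizontal_curve f (1 / b) (1 / c) \<tau> \<gamma>" "\<gamma> 0 = x" "\<gamma> \<tau> = x'"
    by (rule hreach_imp_horizontal[OF hreach_any[OF pos(2,3), of x' x]])
  then show "{\<tau>. 0 \<le> \<tau> \<and> (\<exists>\<gamma>. horizontal_curve f (1 / b) (1 / c) \<tau> \<gamma> \<and> p (\<gamma> 0) = p x \<and> p (\<gamma> \<tau>) = p x')} \<noteq> {}"
    by (auto intro!: exI[of _ \<tau>] exI[of _ \<gamma>])
next
  fix \<tau>
  assume "\<tau> \<in> {\<tau>. 0 \<le> \<tau> \<and> (\<exists>\<gamma>. horizontal_curve f (1 / b) (1 / c) \<tau> \<gamma> \<and> p (\<gamma> 0) = p x \<and> p (\<gamma> \<tau>) = p x')}"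
  then obtain \<gamma> where "0 \<le> \<tau>" "horizontal_curve f (1 / b) (1 / c) \<tau> \<gamma>" "p (\<gamma> 0) = p x" "p (\<gamma> \<tau>) = p x'"
    by blast
  then show "riem_dist p (diag_metric f a b c) (p x) (p x') \<le> \<tau>"
    using riem_dist_le_horizontal[OF pos, of \<tau> \<gamma> p] by simp
qed

text \<open>The path is cut into \<open>n\<close> pieces of equal length \<open>d\<close>, each with
  vertical displacement at most \<open>d / sqrt a + d^2 / k\<close>. The sum is
  \<open>L / sqrt a + L^2 / (k * n)\<close>, and for large \<open>n\<close> only the first summand
  is left for the closing loop.\<close>

lemma subriem_dist_le_path:
  assumes pos: "a > 0" "b > 0" "c > 0" and adm: "admissible (diag_metric f a b c) \<gamma>"
  defines "L \<equiv> len (diag_metric f a b c) \<gamma>"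
  shows "subriem_dist p f (1 / b) (1 / c) (p (\<gamma> 0)) (p (\<gamma> 1)) \<le> L + 4 * sqrt (sqrt (b * c) / 2 * (L / sqrt a))"
proof -
  let ?g = "diag_metric f a b c"
  define k where "k = sqrt (b * c)"
  have k: "k > 0" using pos by (simp add: k_def)
  have q: "quadratic ?g" using pos by (simp add: quadratic_diag_metric)
  have L0: "0 \<le> L" unfolding L_def by (rule len_nonneg[OF q])
  define I where "I s = integral {0..s} (speed ?g \<gamma>)" for s
  have int: "speed ?g \<gamma> integrable_on {0..1}" using adm by (simp add: admissible_def)
  have I: "I 0 = 0" "I 1 = L" by (simp_all add: I_def L_def len_def)
  have cI: "continuous_on {0..1} I"
    unfolding I_def by (rule indefinite_integral_continuous_1[OF int])
  have Icomb: "integral {u..v} (speed ?g \<gamma>) = I v - I u" if "0 \<le> u" "u \<le> v" "v \<le> 1" for u v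
    using Henstock_Kurzweil_Integration.integral_combine[of 0 u v "speed ?g \<gamma>"]
      integrable_on_subinterval[OF int, of 0 v] that by (simp add: I_def)
  have est: "cmod (pt b c (\<gamma> v) - pt b c (\<gamma> u)) \<le> d \<and> \<bar>w1 (\<gamma> u) (\<gamma> v)\<bar> \<le> d / sqrt a + d\<^sup>2 / k"
    if uv: "0 \<le> u" "u \<le> v" "v \<le> 1" "I v - I u = d" for u v d
  proof
    note e = path_estimate[OF pos adm uv(1-3), unfolded Icomb[OF uv(1-3)] uv(4)]
    show "cmod (pt b c (\<gamma> v) - pt b c (\<gamma> u)) \<le> d" by (rule e(1))
    have "sqrt a * \<bar>w1 (\<gamma> u) (\<gamma> v)\<bar> \<le> NN a b c (\<gamma> u) (\<gamma> v)"
      unfolding NN_def using norm_fst_le[of "sqrt a * w1 (\<gamma> u) (\<gamma> v)" "pt b c (\<gamma> v) - pt b c (\<gamma> u)"] pos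
      by (simp add: abs_mult)
    also have "\<dots> \<le> d + sqrt a * d\<^sup>2 / k" using e(2) by (simp add: real_sqrt_divide k_def)
    also have "\<dots> = sqrt a * (d / sqrt a + d\<^sup>2 / k)" using pos by (simp add: field_simps)
    finally show "\<bar>w1 (\<gamma> u) (\<gamma> v)\<bar> \<le> d / sqrt a + d\<^sup>2 / k" using pos by simp
  qed
  have *: "subriem_dist p f (1 / b) (1 / c) (p (\<gamma> 0)) (p (\<gamma> 1))
     \<le> L + 4 * sqrt (k / 2 * (L / sqrt a + L\<^sup>2 / k * inverse (real (Suc m))))" for m
  proof -
    define n where "n = Suc m"
    define d where "d = L / real n"
    have nd: "real n * d = L" "d \<ge> 0" using L0 by (simp_all add: d_def n_def)
    define e where "e = d / sqrt a + d\<^sup>2 / k"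
    have ne: "real n * e = L / sqrt a + L\<^sup>2 / k * inverse (real (Suc m))"
    proof -
      have "real n * e = (real n * d) / sqrt a + (real n * d) * d / k"
        by (simp add: e_def distrib_left power2_eq_square)
      also have "\<dots> = L / sqrt a + L * d / k" by (simp only: nd(1))
      finally show ?thesis by (simp add: d_def n_def power2_eq_square divide_inverse)
    qed
    obtain x where x: "x 0 = \<gamma> 0" "x n = \<gamma> 1"
      "\<And>i. i < n \<Longrightarrow> cmod (pt b c (x (Suc i)) - pt b c (x i)) \<le> d \<and> \<bar>w1 (x i) (x (Suc i))\<bar> \<le> e"
    proof (cases "L = 0")
      \<comment> \<open>For \<open>d = 0\<close> the times used in the other case need not be
        ordered. A path of length \<open>0\<close> has no displacement in either direction, so a
        single jump to its end will do.\<close>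
      case True
      then have d0: "d = 0" "e = 0" by (simp_all add: d_def e_def)
      have e01: "cmod (pt b c (\<gamma> 1) - pt b c (\<gamma> 0)) \<le> 0 \<and> \<bar>w1 (\<gamma> 0) (\<gamma> 1)\<bar> \<le> 0"
        using est[of 0 1 0] I True by simp
      show ?thesis
        by (rule that[of "\<lambda>i. if i = 0 then \<gamma> 0 else \<gamma> 1"]) (use d0 e01 in \<open>auto simp: n_def\<close>)
    next
      case False
      have "\<exists>s. 0 \<le> s \<and> s \<le> 1 \<and> I s = real i * d" if "i \<le> n" for i
      proof -
        have "real i * d \<le> real n * d" using that nd(2) by (intro mult_right_mono) auto
        then show ?thesis using IVT'[of I 0 "real i * d" 1] I nd cI by auto
      qed
      then obtain s0 where s0: "\<And>i. i \<le> n \<Longrightarrow> 0 \<le> s0 i \<and> s0 i \<le> 1 \<and> I (s0 i) = real i * d" by metis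
      \<comment> \<open>The end points are pinned, since the intermediate value theorem may return
        other times with the same arc length.\<close>
      define s where "s i = (if i = 0 then 0 else if i = n then 1 else s0 i)" for i
      have s: "0 \<le> s i \<and> s i \<le> 1 \<and> I (s i) = real i * d" if "i \<le> n" for i
        using s0[OF that] I nd(1) by (auto simp: s_def)
      have mono: "I u \<le> I v" if "0 \<le> u" "u \<le> v" "v \<le> 1" for u v
        using Icomb[OF that] integral_nonneg[of "speed ?g \<gamma>" "{u..v}"] speed_nonneg[OF q]
          integrable_on_subinterval[OF int, of u v] that by auto
      have "s i \<le> s (Suc i)" if "i < n" for i
      proof (rule ccontr)
        assume "\<not> s i \<le> s (Suc i)"
        then have "I (s (Suc i)) \<le> I (s i)" using mono[of "s (Suc i)" "s i"] s[of i] s[of "Suc i"] that by simp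
        then have "d \<le> 0" using s[of i] s[of "Suc i"] that by (simp add: algebra_simps)
        then show False using False nd by simp
      qed
      then have "cmod (pt b c (\<gamma> (s (Suc i))) - pt b c (\<gamma> (s i))) \<le> d \<and> \<bar>w1 (\<gamma> (s i)) (\<gamma> (s (Suc i)))\<bar> \<le> e"
        if "i < n" for i
        unfolding e_def using est[of "s i" "s (Suc i)" d] s[of i] s[of "Suc i"] that by (simp add: algebra_simps)
      then show ?thesis by (intro that[of "\<lambda>i. \<gamma> (s i)"]) (auto simp: s_def n_def)
    qed
    obtain \<tau> where \<tau>: "\<tau> \<le> real n * d + 4 * sqrt (sqrt (b * c) / 2 * (real n * e))"
        "hreach (1 / b) (1 / c) \<tau> (x 0) (x n)"
      using hreach_chain[OF pos(2,3), of n x d e] x(3) by blast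
    show ?thesis
      using subriem_dist_le[OF \<tau>(2), of p] \<tau>(1) unfolding x(1,2) nd(1) ne k_def[symmetric] by linarith
  qed
  have "(\<lambda>m. L + 4 * sqrt (k / 2 * (L / sqrt a + L\<^sup>2 / k * inverse (real (Suc m)))))
     \<longlonglongrightarrow> L + 4 * sqrt (k / 2 * (L / sqrt a + L\<^sup>2 / k * 0))"
    by (intro tendsto_intros LIMSEQ_inverse_real_of_nat)
  then show ?thesis
    using * unfolding k_def[symmetric] by (intro LIMSEQ_le_const) auto
qed

lemma subriem_dist_bounded:
  assumes bc: "b > 0" "c > 0"
  obtains D where "\<And>x x'. norm x \<le> r \<Longrightarrow> norm x' \<le> r \<Longrightarrow> subriem_dist p f (1 / b) (1 / c) (p x) (p x') \<le> D"
proof -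
  let ?h = "\<lambda>z. cmod (pt b c (snd z) - pt b c (fst z)) + 4 * sqrt (sqrt (b * c) / 2 * \<bar>w1 (fst z) (snd z)\<bar>)"
  let ?K = "cball 0 r \<times> cball 0 r :: ((real^3) \<times> (real^3)) set"
  have c1: "continuous_on ?K (\<lambda>z. h (fst z))" "continuous_on ?K (\<lambda>z. h (snd z))"
    if "continuous_on UNIV h" for h :: "real^3 \<Rightarrow> 'b::topological_space"
    by (rule continuous_on_compose2[OF that], auto intro!: continuous_intros)+
  note cc = continuous_on_coordinates[of UNIV] linear_continuous_on[OF pt_bounded_linear[of b c], of UNIV]
  have "continuous_on ?K ?h"
    unfolding w1_def
    by (intro continuous_on_add continuous_on_mult continuous_on_diff continuous_on_norm continuous_on_const
        continuous_on_real_sqrt continuous_on_rabs c1 cc)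
  then have "compact (?h ` ?K)" by (intro compact_continuous_image compact_Times compact_cball)
  then have "bounded (?h ` ?K)" by (rule compact_imp_bounded)
  then obtain D where D: "\<forall>y\<in>?h ` ?K. norm y \<le> D" by (auto simp only: bounded_iff)
  show thesis
  proof
    fix x x' :: "real^3" assume "norm x \<le> r" "norm x' \<le> r"
    then have "?h (x, x') \<in> ?h ` ?K" by (intro imageI) simp
    then have "norm (?h (x, x')) \<le> D" using D by blast
    then show "subriem_dist p f (1 / b) (1 / c) (p x) (p x') \<le> D"
      using subriem_dist_le[OF hreach_any[OF bc, of x' x], of p] by simp
  qed
qed

text \<open>The two distances differ by at most \<open>E a\<close>, which depends on the pair of
  points only through a bound \<open>D\<close> of the sub-Riemannian distance over a compact set. An
  almost minimising Riemannian path is shorter than \<open>D + 1\<close>.\<close>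

lemma uniformly_convergent_to_subriem_dist:
  fixes p :: "real^3 \<Rightarrow> 'm::topological_space"
  assumes cov: "covering_space UNIV p M" and bc: "b > 0" "c > 0"
    and a: "filterlim a at_top F" and g: "eventually (\<lambda>t. g t = diag_metric f (a t) b c) F"
  shows "uniformly_convergent_metrics M (\<lambda>t. riem_dist p (g t)) (subriem_dist p f (1 / b) (1 / c)) F"
  unfolding uniformly_convergent_metrics_def
proof (intro allI impI)
  fix K assume K: "compact K \<and> K \<subseteq> M \<times> M"
  let ?S = "subriem_dist p f (1 / b) (1 / c)"
  define K' where "K' = fst ` K \<union> snd ` K"
  have "compact (fst ` K)" "compact (snd ` K)"
    using K by (auto intro!: compact_continuous_image continuous_intros)
  then have "compact K'" unfolding K'_def by (rule compact_Un)
  moreover have "K' \<subseteq> M" using K by (auto simp: K'_def)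
  ultimately obtain r where r: "K' \<subseteq> p ` ball 0 r" using covering_space_compact_subset[OF cov] by blast
  obtain D where D: "\<And>x x'. norm x \<le> r \<Longrightarrow> norm x' \<le> r \<Longrightarrow> ?S (p x) (p x') \<le> D"
    using subriem_dist_bounded[OF bc] by blast
  define E where "E a = 4 * sqrt (sqrt (b * c) / 2 * ((D + 1) / sqrt a))" for a
  have est: "\<bar>riem_dist p (diag_metric f a b c) X Y - ?S X Y\<bar> \<le> E a" if "a > 0" "(X, Y) \<in> K" for a X Y
  proof -
    let ?g = "diag_metric f a b c"
    note pos = that(1) bc
    have "X \<in> K'" "Y \<in> K'" using that(2) by (force simp: K'_def)+
    then obtain x y where "X = p x" "Y = p y" "x \<in> ball 0 r" "y \<in> ball 0 r"
      using r by blast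
    then have xy: "X = p x" "Y = p y" "norm x \<le> r" "norm y \<le> r" by auto
    let ?R = "riem_dist p ?g X Y"
    have le: "?R \<le> ?S X Y" unfolding xy(1,2) by (rule riem_dist_le_subriem_dist[OF pos])
    have "?S X Y \<le> ?R + E a + \<epsilon>" if \<epsilon>: "0 < \<epsilon>" "\<epsilon> < 1" for \<epsilon>
    proof -
      define Z where "Z = {len ?g \<gamma> |\<gamma>. admissible ?g \<gamma> \<and> p (\<gamma> 0) = X \<and> p (\<gamma> 1) = Y}"
      have "Z \<noteq> {}"
        using seg_length(1)[of a b c x y] pos xy(1,2) by (auto simp: Z_def intro!: exI[of _ "seg x y"])
      moreover have "Inf Z < ?R + \<epsilon>" using \<epsilon>(1) by (simp add: Z_def riem_dist_eq)
      ultimately obtain l where "l \<in> Z" "l < ?R + \<epsilon>" using cInf_lessD by blast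
      then obtain \<gamma> where \<gamma>: "admissible ?g \<gamma>" "p (\<gamma> 0) = X" "p (\<gamma> 1) = Y" "len ?g \<gamma> < ?R + \<epsilon>"
        unfolding Z_def by blast
      have "?S X Y \<le> len ?g \<gamma> + 4 * sqrt (sqrt (b * c) / 2 * (len ?g \<gamma> / sqrt a))"
        using subriem_dist_le_path[OF pos \<gamma>(1), of p] \<gamma>(2,3) by simp
      moreover have "len ?g \<gamma> \<le> D + 1" using \<gamma>(4) \<epsilon>(2) le D[OF xy(3,4)] xy(1,2) by simp
      then have "4 * sqrt (sqrt (b * c) / 2 * (len ?g \<gamma> / sqrt a)) \<le> E a"
        unfolding E_def using pos by (intro mult_left_mono real_sqrt_le_mono divide_right_mono) auto
      ultimately show ?thesis using \<gamma>(4) by linarith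
    qed
    then have *: "?S X Y \<le> ?R + E a + \<epsilon>" if "0 < \<epsilon>" "\<epsilon> < 1" for \<epsilon> using that by blast
    have "?S X Y \<le> ?R + E a"
    proof (rule field_le_epsilon)
      fix \<epsilon> :: real assume "0 < \<epsilon>"
      then have "min \<epsilon> (1 / 2) > 0" "min \<epsilon> (1 / 2) < 1" "min \<epsilon> (1 / 2) \<le> \<epsilon>" by (auto simp: min_def)
      with *[of "min \<epsilon> (1 / 2)"] show "?S X Y \<le> ?R + E a + \<epsilon>" by linarith
    qed
    then show ?thesis using le by linarith
  qed
  have "((\<lambda>t. E (a t)) \<longlongrightarrow> 4 * sqrt (sqrt (b * c) / 2 * ((D + 1) * 0))) F"
    unfolding E_def divide_inverse
    by (intro tendsto_intros filterlim_compose[OF tendsto_inverse_0_at_top filterlim_compose[OF sqrt_at_top a]] filterlim_ident)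
  then have E0: "((\<lambda>t. E (a t)) \<longlongrightarrow> 0) F" by simp
  show "uniform_limit K (\<lambda>t (x, y). riem_dist p (g t) x y) (\<lambda>(x, y). ?S x y) F"
    unfolding uniform_limit_iff
  proof (intro allI impI)
    fix e :: real assume "e > 0"
    then have "eventually (\<lambda>t. E (a t) < e) F" using E0 by (simp add: order_tendsto_iff)
    moreover have "eventually (\<lambda>t. a t > 0) F" using a by (simp add: filterlim_at_top_dense)
    ultimately show "\<forall>\<^sub>F t in F. \<forall>z\<in>K. dist (case z of (x, y) \<Rightarrow> riem_dist p (g t) x y) (case z of (x, y) \<Rightarrow> ?S x y) < e"
      using g
    proof eventually_elim
      case (elim t)
      show ?case
      proof clarify
        fix X Y assume "(X, Y) \<in> K"
        from est[OF elim(2) this] elim(1,3) show "dist (riem_dist p (g t) X Y) (?S X Y) < e"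
          by (simp add: dist_real_def)
      qed
    qed
  qed
qed

end

section \<open>Gromov--Hausdorff closeness from correspondences\<close>

text \<open>The spaces are glued along \<open>R\<close> with related points at distance
  \<open>\<eta>\<close>, and \<open>e x y\<close> is the cheapest passage from \<open>x\<close> to
  \<open>y\<close>. Crossing over and back costs \<open>2 * \<eta>\<close>, which pays for the
  distortion, so neither metric is shortened.\<close>

lemma GH_close_of_correspondence:
  fixes dX :: "'a \<Rightarrow> 'a \<Rightarrow> real" and Y :: "'b::metric_space set"
  assumes nonneg: "\<And>x x'. x \<in> X \<Longrightarrow> x' \<in> X \<Longrightarrow> 0 \<le> dX x x'"
    and sym: "\<And>x x'. x \<in> X \<Longrightarrow> x' \<in> X \<Longrightarrow> dX x x' = dX x' x"
    and zero: "\<And>x x'. x \<in> X \<Longrightarrow> x' \<in> X \<Longrightarrow> dX x x' = 0 \<longleftrightarrow> x = x'"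
    and tri: "\<And>x y z. x \<in> X \<Longrightarrow> y \<in> X \<Longrightarrow> z \<in> X \<Longrightarrow> dX x z \<le> dX x y + dX y z"
    and R: "R \<subseteq> X \<times> Y" and base: "(x0, y0) \<in> R"
    and totX: "\<And>x. x \<in> X \<Longrightarrow> \<exists>y. (x, y) \<in> R" and totY: "\<And>y. y \<in> Y \<Longrightarrow> \<exists>x. (x, y) \<in> R"
    and dis: "\<And>x y x' y'. (x, y) \<in> R \<Longrightarrow> (x', y') \<in> R \<Longrightarrow> \<bar>dX x x' - dist y y'\<bar> \<le> 2 * \<eta>"
    and \<eta>: "0 < \<eta>" "\<eta> < \<epsilon>"
  shows "GH_close \<epsilon> X x0 dX Y y0 dist"
proof -
  define E where "E x y r = dX x (fst r) + \<eta> + dist (snd r) y" for x y and r :: "'a \<times> 'b"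
  define e where "e x y = (INF r\<in>R. E x y r)" for x y
  have Epos: "\<eta> \<le> E x y r" if "x \<in> X" "r \<in> R" for x y r
    using nonneg[of x "fst r"] that R zero_le_dist[of "snd r" y]
    unfolding E_def by (smt (verit) mem_Sigma_iff prod.collapse subsetD)
  have e_le: "e x y \<le> E x y r" if "x \<in> X" "r \<in> R" for x y r
    unfolding e_def by (rule cINF_lower[OF _ that(2)]) (use Epos that(1) in \<open>auto intro!: bdd_belowI2\<close>)
  have e_ge: "c \<le> e x y" if "\<And>r. r \<in> R \<Longrightarrow> c \<le> E x y r" for c x y
    unfolding e_def by (rule cINF_greatest) (use base that in auto)
  have epos: "\<eta> \<le> e x y" if "x \<in> X" for x y using e_ge Epos that by blast
  have RX: "fst r \<in> X" "snd r \<in> Y" if "r \<in> R" for r using that R by auto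
  \<comment> \<open>\<open>Metric_space\<close> demands nonnegativity and symmetry on the whole
    type, hence the value \<open>0\<close> outside \<open>X\<close>.\<close>
  define \<delta> where "\<delta> a b = (case (a, b) of
       (Inl x, Inl x') \<Rightarrow> if x \<in> X \<and> x' \<in> X then dX x x' else 0
     | (Inr y, Inr y') \<Rightarrow> dist y y'
     | (Inl x, Inr y) \<Rightarrow> if x \<in> X then e x y else 0
     | (Inr y, Inl x) \<Rightarrow> if x \<in> X then e x y else 0)" for a b
  have t1: "e x y \<le> dX x x' + e x' y" if "x \<in> X" "x' \<in> X" for x x' y
  proof -
    have "e x y - dX x x' \<le> e x' y"
    proof (rule e_ge)
      fix r assume r: "r \<in> R"
      show "e x y - dX x x' \<le> E x' y r"
        using e_le[OF that(1) r, of y] tri[OF that(1,2) RX(1)[OF r]] unfolding E_def by linarith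
    qed
    then show ?thesis by linarith
  qed
  have t2: "e x y \<le> e x y' + dist y' y" if "x \<in> X" for x y y'
  proof -
    have "e x y - dist y' y \<le> e x y'"
    proof (rule e_ge)
      fix r assume r: "r \<in> R"
      show "e x y - dist y' y \<le> E x y' r"
        using e_le[OF that r, of y] dist_triangle[of "snd r" y y'] unfolding E_def by linarith
    qed
    then show ?thesis by linarith
  qed
  have t3: "dX x x' \<le> e x y + e x' y" if "x \<in> X" "x' \<in> X" for x x' y
  proof -
    have *: "dX x x' \<le> E x y r + E x' y r'" if r: "r \<in> R" "r' \<in> R" for r r'
      using tri[OF \<open>x \<in> X\<close> RX(1)[OF r(1)] \<open>x' \<in> X\<close>]
        tri[OF RX(1)[OF r(1)] RX(1)[OF r(2)] \<open>x' \<in> X\<close>]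
        sym[OF RX(1)[OF r(2)] \<open>x' \<in> X\<close>] dist_triangle[of "snd r" "snd r'" y]
        dis[of "fst r" "snd r" "fst r'" "snd r'"] r dist_commute[of "snd r'" y]
      unfolding E_def by force
    have "dX x x' - e x' y \<le> e x y"
    proof (rule e_ge)
      fix r assume r: "r \<in> R"
      have "dX x x' - E x y r \<le> e x' y" by (rule e_ge) (use *[OF r] in force)
      then show "dX x x' - e x' y \<le> E x y r" by linarith
    qed
    then show ?thesis by linarith
  qed
  have t4: "dist y y' \<le> e x y + e x y'" if "x \<in> X" for x y y'
  proof -
    have *: "dist y y' \<le> E x y r + E x y' r'" if r: "r \<in> R" "r' \<in> R" for r r'
      using tri[OF RX(1)[OF r(1)] \<open>x \<in> X\<close> RX(1)[OF r(2)]]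
        sym[OF RX(1)[OF r(1)] \<open>x \<in> X\<close>] dist_triangle[of y y' "snd r"]
        dist_triangle[of "snd r" y' "snd r'"]
        dis[of "fst r" "snd r" "fst r'" "snd r'"] r dist_commute[of "snd r" y]
      unfolding E_def by force
    have "dist y y' - e x y' \<le> e x y"
    proof (rule e_ge)
      fix r assume r: "r \<in> R"
      have "dist y y' - E x y r \<le> e x y'" by (rule e_ge) (use *[OF r] in force)
      then show "dist y y' - e x y' \<le> E x y r" by linarith
    qed
    then show ?thesis by linarith
  qed
  have t1': "e x' y \<le> e x y + dX x x'" if "x \<in> X" "x' \<in> X" for x x' y
    using t1[OF that(2,1), of y] sym[OF that] by linarith
  have t2': "e x y \<le> dist y y' + e x y'" if "x \<in> X" for x y y'
    using t2[OF that, of y y'] by (simp add: dist_commute)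
  have e_rel: "e x y \<le> \<eta>" if "(x, y) \<in> R" for x y
    using e_le[of x "(x, y)" y] that R zero[of x x] by (auto simp: E_def)
  have "Metric_space (X <+> Y) \<delta>"
  proof
    fix a b
    show "0 \<le> \<delta> a b"
      using nonneg epos \<eta>(1) by (auto simp: \<delta>_def split: sum.splits) (smt (verit))+
    show "\<delta> a b = \<delta> b a"
      using sym by (auto simp: \<delta>_def dist_commute split: sum.splits)
    show "\<delta> a b = 0 \<longleftrightarrow> a = b" if "a \<in> X <+> Y" "b \<in> X <+> Y"
      using that zero epos \<eta>(1) by (auto simp: \<delta>_def split: sum.splits) (smt (verit))+
    fix c
    show "\<delta> a c \<le> \<delta> a b + \<delta> b c" if "a \<in> X <+> Y" "b \<in> X <+> Y" "c \<in> X <+> Y"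
      using that by (auto simp: \<delta>_def tri t1 t1' t2 t2' t3 t4 dist_triangle)
  qed
  moreover have "\<exists>\<epsilon>'<\<epsilon>. (\<forall>x\<in>X. \<exists>y\<in>Y. \<delta> (Inl x) (Inr y) < \<epsilon>') \<and>
                (\<forall>y\<in>Y. \<exists>x\<in>X. \<delta> (Inl x) (Inr y) < \<epsilon>') \<and> \<delta> (Inl x0) (Inr y0) < \<epsilon>'"
  proof -
    obtain \<epsilon>' where e': "\<eta> < \<epsilon>'" "\<epsilon>' < \<epsilon>" using \<eta>(2) dense by blast
    have "\<delta> (Inl x) (Inr y) < \<epsilon>'" "x \<in> X" "y \<in> Y" if "(x, y) \<in> R" for x y
      using e_rel[OF that] e' that R by (auto simp: \<delta>_def)
    then show ?thesis using e'(2) totX totY base by meson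
  qed
  ultimately show ?thesis
    unfolding GH_close_def by (intro exI[of _ \<delta>]) (auto simp: \<delta>_def)
qed

section \<open>Isometries of the plane\<close>

text \<open>After subtracting \<open>\<psi> 0\<close> the isometry is linear. It sends
  \<open>\<i>\<close> to a unit vector orthogonal to the image \<open>u\<close> of \<open>1\<close>,
  as the distance of \<open>1\<close> and \<open>\<i>\<close> is kept; so this vector is
  \<open>u * \<i>\<close> or its negative.\<close>

lemma plane_isometry_cases:
  fixes \<psi> :: "complex \<Rightarrow> complex"
  assumes iso: "\<And>z w. cmod (\<psi> z - \<psi> w) = cmod (z - w)"
  obtains u v where "cmod u = 1" "(\<forall>z. \<psi> z = u * z + v) \<or> (\<forall>z. \<psi> z = u * cnj z + v)"
proof -
  define \<theta> where "\<theta> z = \<psi> z - \<psi> 0" for z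
  have "linear \<theta>"
    by (rule isometry_linear) (auto simp: \<theta>_def dist_norm iso)
  have lin: "\<theta> z = Re z *\<^sub>R \<theta> 1 + Im z *\<^sub>R \<theta> \<i>" for z
  proof -
    have "\<theta> z = \<theta> (Re z *\<^sub>R 1 + Im z *\<^sub>R \<i>)"
      by (rule arg_cong[of _ _ \<theta>]) (simp add: complex_eq_iff)
    then show ?thesis
      using \<open>linear \<theta>\<close> by (simp only: linear_add linear_scale)
  qed
  define u where "u = \<theta> 1"
  have u: "cmod u = 1" "cmod (\<theta> \<i>) = 1" "cmod (u - \<theta> \<i>) ^ 2 = 2"
    using iso[of 1 0] iso[of \<i> 0] iso[of 1 \<i>] by (simp_all add: u_def \<theta>_def cmod_def)
  have "cmod (cnj u * \<theta> \<i>) = 1" using u by (simp add: norm_mult)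
  moreover have "Re (cnj u * \<theta> \<i>) = 0"
  proof -
    have "(Re u)\<^sup>2 + (Im u)\<^sup>2 = 1" "(Re (\<theta> \<i>))\<^sup>2 + (Im (\<theta> \<i>))\<^sup>2 = 1"
      "(Re u - Re (\<theta> \<i>))\<^sup>2 + (Im u - Im (\<theta> \<i>))\<^sup>2 = 2"
      using u cmod_power2[of u] cmod_power2[of "\<theta> \<i>"] cmod_power2[of "u - \<theta> \<i>"] by simp_all
    then show ?thesis by (simp add: power2_diff)
  qed
  ultimately have "Im (cnj u * \<theta> \<i>) ^ 2 = 1" by (simp add: cmod_def)
  then have "Im (cnj u * \<theta> \<i>) = 1 \<or> Im (cnj u * \<theta> \<i>) = -1" by (simp add: power2_eq_1_iff)
  with \<open>Re (cnj u * \<theta> \<i>) = 0\<close> have "cnj u * \<theta> \<i> = \<i> \<or> cnj u * \<theta> \<i> = - \<i>"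
    by (simp add: complex_eq_iff)
  moreover have uu: "u * cnj u = 1" using u(1) complex_norm_square[of u] by simp
  ultimately have "\<theta> \<i> = u * \<i> \<or> \<theta> \<i> = u * (- \<i>)"
    by (metis mult.assoc mult.left_neutral)
  then show thesis
  proof
    assume "\<theta> \<i> = u * \<i>"
    then have *: "\<theta> z = Re z *\<^sub>R u + Im z *\<^sub>R (u * \<i>)" for z
      using lin[of z] by (simp only: u_def)
    have **: "\<psi> z - \<psi> 0 = u * z" for z
      unfolding \<theta>_def[symmetric] by (rule trans[OF *]) (simp add: complex_eq_iff)
    have "\<psi> z = u * z + \<psi> 0" for z
      using **[of z] by (simp only: diff_eq_eq)
    then show thesis using that u(1) by blast
  next
    assume "\<theta> \<i> = u * (- \<i>)"
    then have *: "\<theta> z = Re z *\<^sub>R u + Im z *\<^sub>R (u * (- \<i>))" for z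
      using lin[of z] by (simp only: u_def)
    have **: "\<psi> z - \<psi> 0 = u * cnj z" for z
      unfolding \<theta>_def[symmetric] by (rule trans[OF *]) (simp add: complex_eq_iff)
    have "\<psi> z = u * cnj z + \<psi> 0" for z
      using **[of z] by (simp only: diff_eq_eq)
    then show thesis using that u(1) by blast
  qed
qed

text \<open>\<open>Im (cnj (b - a) * (c - a))\<close> is twice the signed area of the triangle. An
  opposite isometry reverses its sign, and a direct one with two fixed points is the
  identity.\<close>

lemma plane_isometry_fixing_triangle:
  fixes \<psi> :: "complex \<Rightarrow> complex"
  assumes iso: "\<And>z w. cmod (\<psi> z - \<psi> w) = cmod (z - w)"
    and fixed: "\<psi> a = a" "\<psi> b = b" "\<psi> c = c" and nc: "Im (cnj (b - a) * (c - a)) \<noteq> 0"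
  shows "\<psi> z = z"
proof -
  obtain u v where u: "cmod u = 1" and uv: "(\<forall>z. \<psi> z = u * z + v) \<or> (\<forall>z. \<psi> z = u * cnj z + v)"
    using plane_isometry_cases[OF iso] by blast
  have ba: "b - a \<noteq> 0" using nc by auto
  from uv show ?thesis
  proof
    assume *: "\<forall>z. \<psi> z = u * z + v"
    have "u * (b - a) = \<psi> b - \<psi> a" using * by (simp add: algebra_simps)
    then have "u = 1" using ba fixed by simp
    moreover from this have "v = 0" using * fixed(1) by simp
    ultimately show ?thesis using * by simp
  next
    assume *: "\<forall>z. \<psi> z = u * cnj z + v"
    have "u * cnj (b - a) = \<psi> b - \<psi> a" "u * cnj (c - a) = \<psi> c - \<psi> a"
      using * by (simp_all add: algebra_simps)
    then have uB: "u * cnj (b - a) = b - a" and uC: "u * cnj (c - a) = c - a"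
      using fixed by simp_all
    define X where "X = cnj (b - a) * (c - a)"
    have "X = cnj (b - a) * (u * cnj (c - a))" by (simp only: uC X_def)
    also have "\<dots> = u * cnj (b - a) * cnj (c - a)" by (simp only: ac_simps)
    also have "\<dots> = cnj X" by (simp only: uB X_def complex_cnj_mult complex_cnj_cnj)
    finally have "Im X = - Im X" by (metis cnj.sel(2))
    then have "Im (cnj (b - a) * (c - a)) = 0" by (simp only: X_def)
    then show ?thesis using nc by simp
  qed
qed

text \<open>Near a point \<open>a\<close> only isometries fixing \<open>a\<close> can have fixed points. Moving on to a nearby
  \<open>b\<close> and then to \<open>c\<close> off the line through \<open>a\<close> and \<open>b\<close>, an isometry fixing \<open>c\<close> fixes a
  triangle.\<close>

lemma trivial_stabilizer_open_dense:
  fixes \<Psi> :: "(complex \<Rightarrow> complex) set"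
  assumes iso: "\<And>\<psi> z w. \<psi> \<in> \<Psi> \<Longrightarrow> cmod (\<psi> z - \<psi> w) = cmod (z - w)"
    and disc: "\<And>z. \<exists>\<rho>>0. \<forall>\<psi>\<in>\<Psi>. cmod (\<psi> z - z) < \<rho> \<longrightarrow> \<psi> z = z"
  defines "U \<equiv> {z. \<forall>\<psi>\<in>\<Psi>. \<psi> z = z \<longrightarrow> (\<forall>w. \<psi> w = w)}"
  shows "open U" "closure U = UNIV"
proof -
  \<comment> \<open>An isometry with a fixed point \<open>w\<close> moves \<open>z\<close> by at
    most \<open>2 * cmod (w - z)\<close>, whence the radius \<open>\<rho> / 2\<close>.\<close>
  have disc': "\<exists>\<rho>>0. \<forall>\<psi>\<in>\<Psi>. \<forall>w. cmod (w - z) < \<rho> \<and> \<psi> w = w \<longrightarrow> \<psi> z = z" for z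
  proof -
    obtain \<rho> where \<rho>: "\<rho> > 0" "\<forall>\<psi>\<in>\<Psi>. cmod (\<psi> z - z) < \<rho> \<longrightarrow> \<psi> z = z" using disc by blast
    have "\<psi> z = z" if "\<psi> \<in> \<Psi>" "cmod (w - z) < \<rho> / 2" "\<psi> w = w" for \<psi> w
    proof -
      have "cmod (\<psi> z - z) \<le> cmod (\<psi> z - \<psi> w) + cmod (w - z)"
        using norm_triangle_ineq[of "\<psi> z - \<psi> w" "w - z"] that(3) by simp
      then have "cmod (\<psi> z - z) < \<rho>"
        using that(2) iso[OF that(1), of z w] by (simp add: norm_minus_commute)
      then show ?thesis using \<rho>(2) that(1) by blast
    qed
    then show ?thesis using \<rho>(1) by (intro exI[of _ "\<rho> / 2"]) auto
  qed
  show "open U"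
    unfolding open_contains_ball
  proof
    fix z assume "z \<in> U"
    obtain \<rho> where \<rho>: "\<rho> > 0" "\<forall>\<psi>\<in>\<Psi>. \<forall>w. cmod (w - z) < \<rho> \<and> \<psi> w = w \<longrightarrow> \<psi> z = z"
      using disc' by blast
    have "ball z \<rho> \<subseteq> U"
    proof
      fix w assume "w \<in> ball z \<rho>"
      then have "cmod (w - z) < \<rho>" by (simp add: dist_norm norm_minus_commute)
      then show "w \<in> U" using \<rho>(2) \<open>z \<in> U\<close> unfolding U_def by blast
    qed
    then show "\<exists>e>0. ball z e \<subseteq> U" using \<rho>(1) by blast
  qed
  show "closure U = UNIV"
  proof -
    have "\<exists>c\<in>U. dist c a < e" if "e > 0" for a e
    proof -
      obtain \<rho> where \<rho>: "\<rho> > 0" "\<forall>\<psi>\<in>\<Psi>. \<forall>w. cmod (w - a) < \<rho> \<and> \<psi> w = w \<longrightarrow> \<psi> a = a"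
        using disc' by blast
      define s where "s = min e \<rho> / 4"
      have s: "0 < s" "2 * s < e" "2 * s < \<rho>" using that \<rho>(1) by (auto simp: s_def)
      define b where "b = a + of_real s"
      obtain \<sigma> where \<sigma>: "\<sigma> > 0" "\<forall>\<psi>\<in>\<Psi>. \<forall>w. cmod (w - b) < \<sigma> \<and> \<psi> w = w \<longrightarrow> \<psi> b = b"
        using disc' by blast
      define h where "h = min s \<sigma> / 2"
      have h: "0 < h" "h < s" "h < \<sigma>" using s(1) \<sigma>(1) by (auto simp: h_def)
      define c where "c = b + \<i> * of_real h"
      have cb: "cmod (c - b) = h" using h by (simp add: c_def norm_mult)
      have "cmod (c - a) \<le> s + h"
        using norm_triangle_ineq[of "c - b" "b - a"] cb s(1) by (simp add: b_def)
      then have ca: "cmod (c - a) < 2 * s" using h by simp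
      have "c \<in> U"
        unfolding U_def
      proof clarify
        fix \<psi> w assume \<psi>: "\<psi> \<in> \<Psi>" "\<psi> c = c"
        have "\<psi> a = a" using \<rho>(2) \<psi> ca s(3) by force
        moreover have "\<psi> b = b" using \<sigma>(2) \<psi> cb h(3) by force
        moreover have "Im (cnj (b - a) * (c - a)) \<noteq> 0"
          using s(1) h(1) by (simp add: b_def c_def)
        ultimately show "\<psi> w = w"
          using plane_isometry_fixing_triangle[OF iso[OF \<psi>(1)]] \<psi>(2) by blast
      qed
      then show ?thesis using ca s(2) by (intro bexI[of _ c]) (auto simp: dist_norm)
    qed
    then show ?thesis by (auto simp: closure_approachable)
  qed
qed

text \<open>Commutators of rotations are translations, so a group of direct isometries with too few
  translations is abelian and, having a common fixed point, not cobounded.\<close>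

lemma cobounded_plane_group_translations:
  fixes S :: "(complex \<times> complex) set"
  assumes unit: "\<And>u v. (u, v) \<in> S \<Longrightarrow> cmod u = 1"
    and comp: "\<And>u v u' v'. (u, v) \<in> S \<Longrightarrow> (u', v') \<in> S \<Longrightarrow> (u * u', u * v' + v) \<in> S"
    and inv: "\<And>u v. (u, v) \<in> S \<Longrightarrow> (inverse u, - v / u) \<in> S"
    and dense: "\<And>z. \<exists>u v. (u, v) \<in> S \<and> cmod (z - v) \<le> r"
  obtains v w where "(1, v) \<in> S" "(1, w) \<in> S" "Im (cnj v * w) \<noteq> 0"
proof (rule ccontr)
  assume neg: "\<not> thesis"
  note obt = that
  have dep: "Im (cnj v * w) = 0" if "(1, v) \<in> S" "(1, w) \<in> S" for v w
    using obt[OF that] neg by blast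
  have nz: "u \<noteq> 0" if "(u, v) \<in> S" for u v using unit[OF that] by auto
  have r0: "r \<ge> 0"
  proof -
    obtain v where "cmod (0 - v) \<le> r" using dense[of 0] by blast
    then show ?thesis using norm_ge_zero[of "0 - v"] by linarith
  qed
  \<comment> \<open>A pair \<open>(u, v)\<close> stands for the map taking z to uz + v; this is the
    commutator of two such maps.\<close>
  have comm: "(1, (1 - u') * v - (1 - u) * v') \<in> S" if "(u, v) \<in> S" "(u', v') \<in> S" for u v u' v'
  proof -
    have "(u * u' * inverse (u' * u), u * u' * (- (u' * v + v') / (u' * u)) + (u * v' + v)) \<in> S"
      by (rule comp[OF comp[OF that] inv[OF comp[OF that(2,1)]]])
    moreover have "u * u' * inverse (u' * u) = 1"
      "u * u' * (- (u' * v + v') / (u' * u)) = - (u' * v + v')"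
      using nz[OF that(1)] nz[OF that(2)] by (simp_all add: field_simps)
    ultimately have "(1, - (u' * v + v') + (u * v' + v)) \<in> S" by simp
    then show ?thesis by (simp add: algebra_simps)
  qed
  show False
  proof (cases "\<exists>t. (1, t) \<in> S \<and> t \<noteq> 0")
    case True
    then obtain t where t: "(1, t) \<in> S" "t \<noteq> 0" by blast
    \<comment> \<open>Conjugating the translation by \<open>t\<close> gives the translation by
      \<open>u * t\<close>, which has to be parallel to \<open>t\<close>.\<close>
    have one: "u = 1 \<or> u = -1" if uv: "(u, v) \<in> S" for u v
    proof -
      have "(u * 1 * inverse u, u * 1 * (- v / u) + (u * t + v)) \<in> S"
        by (rule comp[OF comp[OF uv t(1)] inv[OF uv]])
      then have "(1, u * t) \<in> S" using nz[OF uv] by simp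
      then have "Im (cnj t * (u * t)) = 0" using dep t(1) by blast
      moreover have "cnj t * (u * t) = of_real (cmod t ^ 2) * u"
      proof -
        have "cnj t * (u * t) = t * cnj t * u" by (simp only: ac_simps)
        then show ?thesis by (simp only: complex_norm_square)
      qed
      ultimately have "Im u = 0" using t(2) by simp
      then show ?thesis using unit[OF uv] by (auto simp: cmod_def complex_eq_iff)
    qed
    \<comment> \<open>Up to a factor the component orthogonal to \<open>t\<close>. It vanishes for
      translations and has a common value for all half turns, so it is bounded on the orbit of
      \<open>0\<close>.\<close>
    define l where "l z = Im (cnj t * z)" for z
    have l1: "l v = 0" if "(1, v) \<in> S" for v using dep[OF t(1) that] by (simp add: l_def)
    have l2: "l v = l v'" if "(-1, v) \<in> S" "(-1, v') \<in> S" for v v'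
    proof -
      have "(1, - v' + v) \<in> S" using comp[OF that] by simp
      then show ?thesis using l1 by (fastforce simp: l_def algebra_simps)
    qed
    obtain k where k: "\<And>u v. (u, v) \<in> S \<Longrightarrow> \<bar>l v\<bar> \<le> k" "k \<ge> 0"
    proof (cases "\<exists>v. (-1, v) \<in> S")
      case True
      then obtain v0 where "(-1, v0) \<in> S" by blast
      then have "\<bar>l v\<bar> \<le> \<bar>l v0\<bar>" if "(u, v) \<in> S" for u v
        using one[OF that] l1[of v] l2[of v v0] that by auto
      then show ?thesis using that[of "\<bar>l v0\<bar>"] by simp
    next
      case False
      then have "\<bar>l v\<bar> \<le> 0" if "(u, v) \<in> S" for u v
        using one[OF that] l1[of v] that by auto
      then show ?thesis using that[of 0] by simp
    qed
    \<comment> \<open>Chosen so that \<open>l\<close> at the point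
      \<open>\<i> * of_real m * t\<close> is \<open>r * cmod t + k + 1\<close>; within distance
      \<open>r\<close> it varies by at most \<open>r * cmod t\<close> and cannot drop to
      \<open>k\<close>.\<close>
    define m where "m = (r * cmod t + k + 1) / cmod t ^ 2"
    obtain u v where uv: "(u, v) \<in> S" "cmod (\<i> * of_real m * t - v) \<le> r" using dense by blast
    have "l (\<i> * of_real m * t) = r * cmod t + k + 1"
    proof -
      have "cnj t * (\<i> * of_real m * t) = \<i> * of_real (m * cmod t ^ 2)"
      proof -
        have "cnj t * (\<i> * of_real m * t) = \<i> * of_real m * (t * cnj t)" by (simp only: ac_simps)
        then show ?thesis by (simp only: complex_norm_square of_real_mult mult.assoc)
      qed
      then show ?thesis using t(2) by (simp add: l_def m_def)
    qed
    moreover have "\<bar>l (\<i> * of_real m * t) - l v\<bar> \<le> cmod t * r"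
    proof -
      have "l (\<i> * of_real m * t) - l v = Im (cnj t * (\<i> * of_real m * t - v))"
        by (simp add: l_def algebra_simps)
      also have "\<bar>\<dots>\<bar> \<le> cmod (cnj t * (\<i> * of_real m * t - v))" by (rule abs_Im_le_cmod)
      also have "\<dots> \<le> cmod t * r" using uv(2) by (simp add: norm_mult mult_left_mono)
      finally show ?thesis .
    qed
    ultimately show False using k(1)[OF uv(1)] by (simp add: mult.commute)
  next
    case False
    then have T0: "t = 0" if "(1, t) \<in> S" for t using that by blast
    have c0: "(1 - u') * v = (1 - u) * v'" if "(u, v) \<in> S" "(u', v') \<in> S" for u v u' v'
      using T0[OF comm[OF that]] by simp
    \<comment> \<open>Without translations all elements commute. A proper rotation then shares its
      fixed point with all of them, and the orbit of \<open>0\<close> lies on a circle around it;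
      otherwise the group is trivial.\<close>
    obtain k where k: "\<And>u v. (u, v) \<in> S \<Longrightarrow> cmod v \<le> k"
    proof (cases "\<exists>u v. (u, v) \<in> S \<and> u \<noteq> 1")
      case True
      then obtain u0 v0 where u0: "(u0, v0) \<in> S" "u0 \<noteq> 1" by blast
      have "cmod v \<le> 2 * cmod v0 / cmod (1 - u0)" if "(u, v) \<in> S" for u v
      proof -
        have "v = (1 - u) * v0 / (1 - u0)" using c0[OF that u0(1)] u0(2) by (simp add: field_simps)
        moreover have "cmod (1 - u) \<le> 2"
          using norm_triangle_ineq4[of 1 u] unit[OF that] by simp
        ultimately show ?thesis
          by (simp add: norm_mult norm_divide divide_right_mono mult_right_mono)
      qed
      then show ?thesis using that by blast
    next
      case False
      then show ?thesis using that[of 0] T0 by fastforce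
    qed
    obtain u v where uv: "(u, v) \<in> S" "cmod (of_real (r + \<bar>k\<bar> + 1) - v) \<le> r" using dense by blast
    have "cmod (of_real (r + \<bar>k\<bar> + 1)) - cmod v \<le> r"
      using norm_triangle_ineq2[of "of_real (r + \<bar>k\<bar> + 1)" v] uv(2) by linarith
    then show False using k[OF uv(1)] r0 by (simp only: norm_of_real)
  qed
qed

section \<open>Deck transformations\<close>

text \<open>The vertical and the horizontal part are preserved separately, a condition free of the
  time. \<open>B\<close> and \<open>C\<close> stay fixed; the growth of the metric enters later as
  the factor \<open>m\<close>.\<close>

locale heis_quotient = milnor f for f +
  fixes p :: "real^3 \<Rightarrow> 'm::t2_space" and M :: "'m set" and B C :: real
  assumes cov: "covering_space UNIV p M"
    and deck_smooth: "\<phi> \<in> deck_transformations p \<Longrightarrow> smooth \<phi>"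
    and BC: "B > 0" "C > 0"
    and deck_th1: "\<phi> \<in> deck_transformations p \<Longrightarrow>
       (th1 (\<phi> x) (frechet_derivative \<phi> (at x) u))\<^sup>2 = (th1 x u)\<^sup>2"
    and deck_pt: "\<phi> \<in> deck_transformations p \<Longrightarrow>
       cmod (pt B C (frechet_derivative \<phi> (at x) u)) = cmod (pt B C u)"
begin

abbreviation "P \<equiv> pt B C"
abbreviation "Deck \<equiv> deck_transformations p"

lemma continuous_on_P: "continuous_on S P"
  by (rule linear_continuous_on[OF pt_bounded_linear])

definition lift :: "real \<Rightarrow> complex \<Rightarrow> real^3" where
  "lift r z = Yinv r (Re z / sqrt B) (Im z / sqrt C)"

lemma lift [simp]: "P (lift r z) = z" "y1 (lift r z) = r" "lift (y1 x) (P x) = x"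
  using BC by (simp_all add: lift_def pt_def complex_eq_iff)

lemma eq_of_y1_P: "y1 x = y1 x' \<Longrightarrow> P x = P x' \<Longrightarrow> x = x'"
  by (metis lift(3))

lemma continuous_on_lift: "continuous_on S (\<lambda>(r, z). lift r z)"
proof -
  have "(\<lambda>(r, z). lift r z) = (\<lambda>(r, z). \<chi> i. if i = 1 then Re z / sqrt B * F0 2 $ 1 + Im z / sqrt C * F0 3 $ 1
     else if i = 2 then Re z / sqrt B * F0 2 $ 2 + Im z / sqrt C * F0 3 $ 2
     else r * kap + (Re z / sqrt B * F0 2 $ 1 + Im z / sqrt C * F0 3 $ 1) * (Re z / sqrt B * F0 2 $ 2 + Im z / sqrt C * F0 3 $ 2) / 2
       + F0 2 $ 3 * (Re z / sqrt B) + F0 3 $ 3 * (Im z / sqrt C))"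
    by (rule ext) (simp add: lift_def vec3_eq_iff Yinv_nth split: prod.split)
  moreover have "continuous_on S \<dots>"
    unfolding case_prod_unfold
  proof (rule continuous_on_vec_lambda)
    fix i :: 3
    show "continuous_on S (\<lambda>x. if i = 1 then Re (snd x) / sqrt B * F0 2 $ 1 + Im (snd x) / sqrt C * F0 3 $ 1
     else if i = 2 then Re (snd x) / sqrt B * F0 2 $ 2 + Im (snd x) / sqrt C * F0 3 $ 2
     else fst x * kap + (Re (snd x) / sqrt B * F0 2 $ 1 + Im (snd x) / sqrt C * F0 3 $ 1) * (Re (snd x) / sqrt B * F0 2 $ 2 + Im (snd x) / sqrt C * F0 3 $ 2) / 2
       + F0 2 $ 3 * (Re (snd x) / sqrt B) + F0 3 $ 3 * (Im (snd x) / sqrt C))"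
      using BC by (cases "i = 1"; cases "i = 2") (auto intro!: continuous_intros)
  qed
  ultimately show ?thesis by (simp only:)
qed

lemma deck_image_seg:
  assumes \<phi>: "\<phi> \<in> Deck"
  defines "D \<equiv> \<lambda>s x x'. frechet_derivative \<phi> (at (seg x x' s))
     (vec (seg x x' s) (w1 x x') (th2 x' - th2 x) (th3 x' - th3 x))"
  shows "((\<lambda>s. \<phi> (seg x x' s)) has_vector_derivative D s x x') (at s)"
    and "cmod (P (D s x x')) = cmod (P x' - P x)"
proof -
  have "(\<phi> has_derivative frechet_derivative \<phi> (at (seg x x' s))) (at (seg x x' s))"
    by (rule smooth_imp_C1(1)[OF deck_smooth[OF \<phi>]])
  from diff_chain_at[OF seg_has_vector_derivative[unfolded has_vector_derivative_def] this, unfolded o_def]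
  have "((\<lambda>s. \<phi> (seg x x' s)) has_derivative (\<lambda>t. frechet_derivative \<phi> (at (seg x x' s))
     (t *\<^sub>R vec (seg x x' s) (w1 x x') (th2 x' - th2 x) (th3 x' - th3 x)))) (at s)" .
  then show "((\<lambda>s. \<phi> (seg x x' s)) has_vector_derivative D s x x') (at s)"
    unfolding has_vector_derivative_def D_def
    by (simp only: linear_scale[OF has_derivative_linear[OF smooth_imp_C1(1)[OF deck_smooth[OF \<phi>]]]])
  show "cmod (P (D s x x')) = cmod (P x' - P x)"
    unfolding D_def deck_pt[OF \<phi>] by (rule arg_cong[of _ _ cmod]) (simp add: pt_def complex_eq_iff right_diff_distrib)
qed

text \<open>Deck transformations keep horizontal speed, so the image of a segment projects to a
  curve of length \<open>cmod (P x' - P x)\<close>. In particular points over one point of the plane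
  stay over one point, whence the choice of lift in \<open>plane_map\<close> is immaterial.\<close>

lemma deck_P_contraction:
  assumes \<phi>: "\<phi> \<in> Deck"
  shows "cmod (P (\<phi> x') - P (\<phi> x)) \<le> cmod (P x' - P x)"
proof -
  have d: "((\<lambda>s. P (\<phi> (seg x x' s))) has_vector_derivative P (frechet_derivative \<phi> (at (seg x x' s))
     (vec (seg x x' s) (w1 x x') (th2 x' - th2 x) (th3 x' - th3 x)))) (at s)" for s
    by (rule bounded_linear.has_vector_derivative[OF pt_bounded_linear deck_image_seg(1)[OF \<phi>]])
  have "norm (P (\<phi> (seg x x' 1)) - P (\<phi> (seg x x' 0))) \<le> cmod (P x' - P x) * integral {0..1::real} (\<lambda>_. 1 :: real)"
  proof (rule norm_diff_le_integral_bound[where S="{}" and V="\<lambda>s. P (\<phi> (seg x x' s))"])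
    show "continuous_on {0..1} (\<lambda>s. P (\<phi> (seg x x' s)))"
      by (rule continuous_on_vector_derivative) (rule has_vector_derivative_at_within[OF d])
    fix s :: real
    show "((\<lambda>s. P (\<phi> (seg x x' s))) has_vector_derivative P (frechet_derivative \<phi> (at (seg x x' s))
     (vec (seg x x' s) (w1 x x') (th2 x' - th2 x) (th3 x' - th3 x)))) (at s)" by (rule d)
    show "norm (P (frechet_derivative \<phi> (at (seg x x' s))
     (vec (seg x x' s) (w1 x x') (th2 x' - th2 x) (th3 x' - th3 x)))) \<le> cmod (P x' - P x) * 1"
      by (simp add: deck_image_seg(2)[OF \<phi>])
  qed auto
  then show ?thesis by simp
qed

lemma deck_P_isometry:
  assumes \<phi>: "\<phi> \<in> Deck"
  shows "cmod (P (\<phi> x') - P (\<phi> x)) = cmod (P x' - P x)"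
proof -
  obtain \<psi> where \<psi>: "\<psi> \<in> Deck" "\<And>x. \<psi> (\<phi> x) = x" using deck_transformation_inverse[OF \<phi>] by metis
  have "cmod (P (\<psi> (\<phi> x')) - P (\<psi> (\<phi> x))) \<le> cmod (P (\<phi> x') - P (\<phi> x))"
    by (rule deck_P_contraction[OF \<psi>(1)])
  then show ?thesis using deck_P_contraction[OF \<phi>, of x' x] unfolding \<psi>(2) by linarith
qed

definition plane_map :: "(real^3 \<Rightarrow> real^3) \<Rightarrow> complex \<Rightarrow> complex" where
  "plane_map \<phi> z = P (\<phi> (lift 0 z))"

lemma plane_map: "\<phi> \<in> Deck \<Longrightarrow> P (\<phi> x) = plane_map \<phi> (P x)"
  using deck_P_isometry[of \<phi> x "lift 0 (P x)"] by (simp add: plane_map_def)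

lemma plane_map_isometry: "\<phi> \<in> Deck \<Longrightarrow> cmod (plane_map \<phi> z - plane_map \<phi> w) = cmod (z - w)"
  unfolding plane_map_def by (subst deck_P_isometry) simp_all

text \<open>Horizontal vectors stay horizontal, so \<open>th1\<close> is multiplied by a function
  \<open>e\<close> with \<open>e^2 = 1\<close>. It is continuous on a connected space and takes
  finitely many values, hence it is constant.\<close>

lemma deck_w1_sign:
  assumes \<phi>: "\<phi> \<in> Deck"
  obtains \<epsilon> where "\<epsilon> = 1 \<or> \<epsilon> = -1"
    "\<And>x u. th1 (\<phi> x) (frechet_derivative \<phi> (at x) u) = \<epsilon> * th1 x u"
proof -
  let ?D = "\<lambda>x. frechet_derivative \<phi> (at x)"
  have lin: "linear (?D x)" for x by (rule has_derivative_linear[OF smooth_imp_C1(1)[OF deck_smooth[OF \<phi>]]])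
  define e where "e x = th1 (\<phi> x) (?D x (f 1 x))" for x
  have e2: "(e x)\<^sup>2 = 1" for x unfolding e_def deck_th1[OF \<phi>] by (simp add: th_frame)
  have e: "th1 (\<phi> x) (?D x u) = e x * th1 x u" for x u
  proof -
    have "(th1 (\<phi> x) (?D x (u - th1 x u *\<^sub>R f 1 x)))\<^sup>2 = 0"
      unfolding deck_th1[OF \<phi>] by (simp add: th_linear th_frame)
    then have "th1 (\<phi> x) (?D x u - th1 x u *\<^sub>R ?D x (f 1 x)) = 0"
      by (simp add: linear_diff[OF lin] linear_scale[OF lin])
    then show ?thesis by (simp add: th_linear e_def mult.commute)
  qed
  have f1: "f 1 x = kap *\<^sub>R axis 3 1" for x by (simp add: vec3_eq_iff frame_nth frame1 kap_def)
  have "e = (\<lambda>x. kap * th1 (\<phi> x) (?D x (axis 3 1)))"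
    by (rule ext) (simp only: e_def f1 linear_scale[OF lin] th_linear)
  moreover have "continuous_on UNIV (\<lambda>x. kap * th1 (\<phi> x) (?D x (axis 3 1)))"
  proof -
    have c\<phi>: "continuous_on UNIV \<phi>"
      by (rule continuous_at_imp_continuous_on, rule ballI,
          rule has_derivative_continuous[OF smooth_imp_C1(1)[OF deck_smooth[OF \<phi>]]])
    have cD: "continuous_on UNIV (\<lambda>x. ?D x (axis 3 1))" by (rule smooth_imp_C1(2)[OF deck_smooth[OF \<phi>]])
    note nth = bounded_linear.continuous_on[OF bounded_linear_vec_nth]
    show ?thesis unfolding th1_def
      by (intro continuous_on_mult continuous_on_divide continuous_on_diff continuous_on_const nth c\<phi> cD
          continuous_on_compose2[OF continuous_on_coordinates(2) cD] continuous_on_compose2[OF continuous_on_coordinates(3) cD])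
        (auto simp: kap_nz)
  qed
  ultimately have ce: "continuous_on UNIV e" by (simp only:)
  have "finite (e ` UNIV)"
  proof (rule finite_subset)
    show "e ` UNIV \<subseteq> {1, -1}" using e2 by (auto simp: power2_eq_1_iff)
  qed simp
  then have "e constant_on UNIV"
    using continuous_finite_range_constant[OF connected_UNIV ce] by blast
  then obtain k where k: "\<And>x. e x = k" unfolding constant_on_def by blast
  show thesis
  proof (rule that[of k])
    show "k = 1 \<or> k = -1" using e2[of 0] k[of 0] by (simp add: power2_eq_1_iff)
    show "th1 (\<phi> x) (?D x u) = k * th1 x u" for x u using e[of x u] k[of x] by simp
  qed
qed

text \<open>Deck transformations carry the segments of the coordinates \<open>y\<close> to curves over straight lines,
  along which the vertical displacement has constant speed.\<close>

lemma deck_w1: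
  assumes \<phi>: "\<phi> \<in> Deck"
  obtains \<epsilon> where "\<epsilon> = 1 \<or> \<epsilon> = -1" "\<And>x x'. w1 (\<phi> x) (\<phi> x') = \<epsilon> * w1 x x'"
proof -
  obtain \<epsilon> where \<epsilon>: "\<epsilon> = 1 \<or> \<epsilon> = -1"
    "\<And>x u. th1 (\<phi> x) (frechet_derivative \<phi> (at x) u) = \<epsilon> * th1 x u" by (rule deck_w1_sign[OF \<phi>]) blast
  obtain u v where uv: "(\<forall>z. plane_map \<phi> z = u * z + v) \<or> (\<forall>z. plane_map \<phi> z = u * cnj z + v)"
    using plane_isometry_cases[OF plane_map_isometry[OF \<phi>]] by metis
  have "w1 (\<phi> x) (\<phi> x') = \<epsilon> * w1 x x'" for x x'
  proof -
    let ?\<gamma> = "\<lambda>s. \<phi> (seg x x' s)"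
    define D where "D s = frechet_derivative \<phi> (at (seg x x' s))
     (vec (seg x x' s) (w1 x x') (th2 x' - th2 x) (th3 x' - th3 x))" for s
    have d: "(?\<gamma> has_vector_derivative D s) (at s)" for s
      unfolding D_def by (rule deck_image_seg(1)[OF \<phi>])
    obtain q where q: "\<And>s. P (?\<gamma> s) - P (?\<gamma> 0) = s *\<^sub>R q"
    proof -
      have Ps: "P (seg x x' s) = P x + s *\<^sub>R (P x' - P x)" for s
        by (simp add: pt_def complex_eq_iff coordinates_seg algebra_simps)
      show thesis
        using uv
      proof
        assume *: "\<forall>z. plane_map \<phi> z = u * z + v"
        show thesis
          by (rule that[of "u * (P x' - P x)"]) (simp add: plane_map[OF \<phi>] * Ps distrib_left)
      next
        assume *: "\<forall>z. plane_map \<phi> z = u * cnj z + v"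
        show thesis
          by (rule that[of "u * cnj (P x' - P x)"])
            (simp only: plane_map[OF \<phi>] * Ps, simp add: scaleR_conv_of_real algebra_simps)
      qed
    qed
    have PD: "P (D s) = q" for s
    proof -
      have "((\<lambda>s. P (?\<gamma> s)) has_vector_derivative P (D s)) (at s)"
        by (rule bounded_linear.has_vector_derivative[OF pt_bounded_linear d])
      moreover have "(\<lambda>s. P (?\<gamma> s)) = (\<lambda>s. P (?\<gamma> 0) + s *\<^sub>R q)" using q by (simp add: fun_eq_iff algebra_simps)
      moreover have "((\<lambda>s. P (?\<gamma> 0) + s *\<^sub>R q) has_vector_derivative q) (at s)"
        by (auto intro!: derivative_eq_intros)
      ultimately show ?thesis by (metis vector_derivative_unique_at)
    qed
    have "((\<lambda>s. w1 (?\<gamma> 0) (?\<gamma> s)) has_vector_derivative \<epsilon> * w1 x x') (at s)" for s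
    proof -
      \<comment> \<open>The projected curve is a straight line from \<open>P (?\<gamma> 0)\<close>,
        so it sweeps out no area as seen from there.\<close>
      have "Im (cnj (P (?\<gamma> s - ?\<gamma> 0)) * P (D s)) = 0"
        unfolding pt_linear q PD by (simp add: scaleR_conv_of_real)
      moreover have "th1 (?\<gamma> s) (D s) = \<epsilon> * w1 x x'" by (simp add: D_def \<epsilon>(2))
      ultimately show ?thesis using w1_has_vector_derivative[OF BC d, of "?\<gamma> 0" s] by simp
    qed
    note dd = this
    have "((\<lambda>s. \<epsilon> * w1 x x') has_integral (w1 (?\<gamma> 0) (?\<gamma> 1) - w1 (?\<gamma> 0) (?\<gamma> 0))) {0..1::real}"
      by (rule fundamental_theorem_of_calculus[where f="\<lambda>s. w1 (?\<gamma> 0) (?\<gamma> s)"])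
        (simp, rule has_vector_derivative_at_within[OF dd])
    moreover have "((\<lambda>s. \<epsilon> * w1 x x') has_integral \<epsilon> * w1 x x') {0..1::real}"
      using has_integral_const_real[of "\<epsilon> * w1 x x'" 0 1] by simp
    ultimately have "w1 (?\<gamma> 0) (?\<gamma> 1) - w1 (?\<gamma> 0) (?\<gamma> 0) = \<epsilon> * w1 x x'" by (rule has_integral_unique)
    then show ?thesis by simp
  qed
  then show thesis using that \<epsilon>(1) by blast
qed

text \<open>The sign is \<open>1\<close> for direct isometries, because \<open>w1 x x' + w1 x' x'' - w1 x x''\<close> is the
  oriented area of the projected triangle up to a constant.\<close>

lemma deck_direct:
  assumes \<phi>: "\<phi> \<in> Deck" and u: "cmod u = 1" and uv: "\<And>z. plane_map \<phi> z = u * z + v"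
  shows "y1 (\<phi> x) = y1 x + Im (cnj v * u * P x) / sqrt (B * C) + y1 (\<phi> 0)"
proof -
  define k where "k = sqrt (B * C)"
  have k: "k > 0" using BC by (simp add: k_def)
  obtain \<epsilon> where \<epsilon>: "\<epsilon> = 1 \<or> \<epsilon> = -1" "\<And>x x'. w1 (\<phi> x) (\<phi> x') = \<epsilon> * w1 x x'" by (rule deck_w1[OF \<phi>]) blast
  have w: "w1 x x' = y1 x' - y1 x - Im (cnj (P x) * P x') / k" for x x'
    unfolding w1_def area_pt[OF BC] k_def ..
  have P\<phi>: "P (\<phi> x) = u * P x + v" for x using plane_map[OF \<phi>] uv by simp
  have uu: "cnj u * u = 1" using u complex_norm_square[of u] by (simp add: mult.commute)
  \<comment> \<open>A test triangle over \<open>0\<close>, \<open>1\<close>, \<open>\<i>\<close>,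
    whose oriented area a direct isometry preserves.\<close>
  define x1 where "x1 = lift 0 1"
  define x2 where "x2 = lift 0 \<i>"
  have P0: "P 0 = 0" by (rule pt_linear(4))
  have "w1 0 x1 + w1 x1 x2 - w1 0 x2 = - 1 / k"
    unfolding w x1_def x2_def by (simp add: P0)
  moreover have "w1 (\<phi> 0) (\<phi> x1) + w1 (\<phi> x1) (\<phi> x2) - w1 (\<phi> 0) (\<phi> x2) = - 1 / k"
  proof -
    have "Im (cnj v * (u + v)) + Im (cnj (u + v) * (u * \<i> + v)) - Im (cnj v * (u * \<i> + v)) = Im (cnj u * u * \<i>)"
      by (simp add: algebra_simps)
    also have "\<dots> = 1" by (simp add: uu)
    finally have "(Im (cnj v * (u + v)) + Im (cnj (u + v) * (u * \<i> + v)) - Im (cnj v * (u * \<i> + v))) / k = 1 / k" by simp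
    then show ?thesis
      unfolding w P\<phi> x1_def x2_def lift P0 by (simp add: add_divide_distrib diff_divide_distrib)
  qed
  moreover have "1 / k > 0" using k by simp
  ultimately have "\<epsilon> \<noteq> -1" unfolding \<epsilon>(2) by (intro notI, hypsubst) linarith
  then have "\<epsilon> = 1" using \<epsilon>(1) by blast
  then have "w1 (\<phi> 0) (\<phi> x) = w1 0 x" using \<epsilon>(2) by simp
  moreover have "y1 0 = 0" by (simp add: y1_def th_linear)
  moreover have "Im (cnj v * (u * P x + v)) = Im (cnj v * u * P x)"
    by (simp add: algebra_simps)
  ultimately show ?thesis unfolding w P\<phi> P0 k_def by simp
qed

section \<open>The cobounded plane group and the vertical period\<close>

definition direct :: "(complex \<times> complex) set" where
  "direct = {(u, v). cmod u = 1 \<and> (\<exists>\<phi>\<in>Deck. \<forall>z. plane_map \<phi> z = u * z + v)}"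

lemma plane_map_compose: "\<phi> \<in> Deck \<Longrightarrow> \<psi> \<in> Deck \<Longrightarrow> plane_map (\<phi> \<circ> \<psi>) z = plane_map \<phi> (plane_map \<psi> z)"
  unfolding plane_map_def[of "\<phi> \<circ> \<psi>"] o_apply by (simp add: plane_map)

lemma direct_compose:
  assumes "(u, v) \<in> direct" "(u', v') \<in> direct"
  shows "(u * u', u * v' + v) \<in> direct"
proof -
  obtain \<phi> where \<phi>: "\<phi> \<in> Deck" "\<And>z. plane_map \<phi> z = u * z + v" "cmod u = 1"
    using assms(1) by (auto simp: direct_def)
  obtain \<psi> where \<psi>: "\<psi> \<in> Deck" "\<And>z. plane_map \<psi> z = u' * z + v'" "cmod u' = 1"
    using assms(2) by (auto simp: direct_def)
  have "plane_map (\<phi> \<circ> \<psi>) z = u * u' * z + (u * v' + v)" for z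
    unfolding plane_map_compose[OF \<phi>(1) \<psi>(1)] \<phi>(2) \<psi>(2) by (simp add: algebra_simps)
  then show ?thesis
    using deck_transformation_compose[OF \<phi>(1) \<psi>(1)] \<phi>(3) \<psi>(3) unfolding direct_def
    by (auto simp: norm_mult)
qed

lemma direct_inverse:
  assumes "(u, v) \<in> direct"
  shows "(inverse u, - v / u) \<in> direct"
proof -
  obtain \<phi> where \<phi>: "\<phi> \<in> Deck" "\<And>z. plane_map \<phi> z = u * z + v" "cmod u = 1"
    using assms(1) by (auto simp: direct_def)
  have u: "u \<noteq> 0" using \<phi>(3) by auto
  obtain \<psi> where \<psi>: "\<psi> \<in> Deck" "\<And>x. \<phi> (\<psi> x) = x" using deck_transformation_inverse[OF \<phi>(1)] by metis
  have "u * plane_map \<psi> z + v = z" for z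
  proof -
    have "u * plane_map \<psi> z + v = P (\<phi> (\<psi> (lift 0 z)))"
      unfolding plane_map[OF \<phi>(1)] \<phi>(2) plane_map_def[of \<psi>] ..
    then show ?thesis by (simp add: \<psi>(2))
  qed
  note * = this
  have "plane_map \<psi> z = inverse u * z + (- v / u)" for z
  proof -
    have "plane_map \<psi> z = (u * plane_map \<psi> z + v - v) / u" using u by simp
    then show ?thesis unfolding *[of z] by (simp add: divide_inverse algebra_simps)
  qed
  then show ?thesis using \<psi>(1) \<phi>(3) unfolding direct_def by (auto simp: norm_inverse)
qed

definition shift :: "real \<Rightarrow> real^3 \<Rightarrow> real^3" where
  "shift r x = lift (y1 x + r) (P x)"

lemma shift [simp]: "P (shift r x) = P x" "y1 (shift r x) = y1 x + r"
  by (simp_all add: shift_def)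

lemma shift_shift: "shift r (shift s x) = shift (s + r) x"
  by (rule eq_of_y1_P) simp_all

text \<open>Every point of a compact \<open>M\<close> has a lift in one fixed ball. A deck
  transformation carries such a lift to \<open>lift 0 z\<close>, so \<open>z\<close> is as close to
  an orbit point of \<open>0\<close> as the projection of the lift is to \<open>0\<close>.\<close>

lemma orbit_dense:
  assumes "compact M"
  obtains r where "\<And>z. \<exists>\<phi>\<in>Deck. cmod (z - plane_map \<phi> 0) \<le> r"
proof -
  obtain s where s: "M \<subseteq> p ` ball 0 s" using covering_space_compact_subset[OF cov assms] by blast
  obtain K where K: "\<And>v. cmod (P v) \<le> norm v * K" "K \<ge> 0"
    using bounded_linear.nonneg_bounded[OF pt_bounded_linear] by metis
  show thesis
  proof (rule that[of "s * K"])
    fix z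
    have "p (lift 0 z) \<in> M" using covering_space_imp_surjective[OF cov] by blast
    then obtain x where x: "norm x < s" "p x = p (lift 0 z)" using s by (auto simp: image_iff subset_iff)
    obtain \<phi> where \<phi>: "\<phi> \<in> Deck" "\<phi> x = lift 0 z" using deck_transformation_transitive[OF cov x(2)] by blast
    have "z = plane_map \<phi> (P x)" using plane_map[OF \<phi>(1), of x] \<phi>(2) by simp
    then have "cmod (z - plane_map \<phi> 0) = cmod (P x)" using plane_map_isometry[OF \<phi>(1), of "P x" 0] by simp
    also have "\<dots> \<le> norm x * K" by (rule K(1))
    also have "\<dots> \<le> s * K" using x(1) K(2) by (intro mult_right_mono) auto
    finally show "\<exists>\<phi>\<in>Deck. cmod (z - plane_map \<phi> 0) \<le> s * K" using \<phi>(1) by blast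
  qed
qed

text \<open>Direct isometries have index at most two: composing an opposite isometry with a fixed
  opposite \<open>\<sigma>\<close> makes it direct, at the price of
  \<open>cmod (plane_map \<sigma> 0)\<close> in the radius.\<close>

lemma direct_dense:
  assumes "compact M"
  obtains r where "\<And>z. \<exists>u v. (u, v) \<in> direct \<and> cmod (z - v) \<le> r"
proof -
  obtain r where r: "\<And>z. \<exists>\<phi>\<in>Deck. cmod (z - plane_map \<phi> 0) \<le> r" using orbit_dense[OF assms] by blast
  have cases: "(\<exists>u. (u, plane_map \<phi> 0) \<in> direct) \<or> (\<exists>u. cmod u = 1 \<and> (\<forall>z. plane_map \<phi> z = u * cnj z + plane_map \<phi> 0))"
    if \<phi>: "\<phi> \<in> Deck" for \<phi>
  proof -
    obtain u v where u: "cmod u = 1" and uv: "(\<forall>z. plane_map \<phi> z = u * z + v) \<or> (\<forall>z. plane_map \<phi> z = u * cnj z + v)"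
      using plane_isometry_cases[OF plane_map_isometry[OF \<phi>]] by metis
    from uv show ?thesis
    proof
      assume *: "\<forall>z. plane_map \<phi> z = u * z + v"
      then have "v = plane_map \<phi> 0" by simp
      then have "(u, plane_map \<phi> 0) \<in> direct" using * u \<phi> unfolding direct_def by auto
      then show ?thesis by blast
    next
      assume *: "\<forall>z. plane_map \<phi> z = u * cnj z + v"
      then have "v = plane_map \<phi> 0" by simp
      then show ?thesis using * u by blast
    qed
  qed
  show thesis
  proof (cases "\<exists>\<sigma>\<in>Deck. \<exists>u. cmod u = 1 \<and> (\<forall>z. plane_map \<sigma> z = u * cnj z + plane_map \<sigma> 0)")
    case False
    then have "\<exists>u v. (u, v) \<in> direct \<and> cmod (z - v) \<le> r" for z using r[of z] cases by blast
    then show ?thesis using that by blast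
  next
    case True
    then obtain \<sigma> w where \<sigma>: "\<sigma> \<in> Deck" "cmod w = 1" "\<And>z. plane_map \<sigma> z = w * cnj z + plane_map \<sigma> 0" by blast
    define s where "s = cmod (plane_map \<sigma> 0)"
    have "\<exists>u v. (u, v) \<in> direct \<and> cmod (z - v) \<le> r + s" for z
    proof -
      obtain \<phi> where \<phi>: "\<phi> \<in> Deck" "cmod (z - plane_map \<phi> 0) \<le> r" using r by blast
      from cases[OF \<phi>(1)] show ?thesis
      proof
        assume "\<exists>u. (u, plane_map \<phi> 0) \<in> direct"
        moreover have "cmod (z - plane_map \<phi> 0) \<le> r + s" using \<phi>(2) by (simp add: s_def add_increasing2)
        ultimately show ?thesis by blast
      next
        assume "\<exists>u. cmod u = 1 \<and> (\<forall>z. plane_map \<phi> z = u * cnj z + plane_map \<phi> 0)"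
        then obtain u where u: "cmod u = 1" "\<And>z. plane_map \<phi> z = u * cnj z + plane_map \<phi> 0" by blast
        let ?v = "plane_map \<phi> (plane_map \<sigma> 0)"
        have "plane_map (\<phi> \<circ> \<sigma>) z = (u * cnj w) * z + ?v" for z
          unfolding plane_map_compose[OF \<phi>(1) \<sigma>(1)]
          by (subst \<sigma>(3), subst (1 2) u(2)) (simp add: algebra_simps)
        then have "(u * cnj w, ?v) \<in> direct"
          unfolding direct_def using deck_transformation_compose[OF \<phi>(1) \<sigma>(1)] u(1) \<sigma>(2)
          by (auto simp: norm_mult)
        moreover have "cmod (z - ?v) \<le> r + s"
          using norm_triangle_ineq[of "z - plane_map \<phi> 0" "plane_map \<phi> 0 - ?v"] \<phi>(2)
            plane_map_isometry[OF \<phi>(1), of 0 "plane_map \<sigma> 0"] by (simp add: s_def)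
        ultimately show ?thesis by blast
      qed
    qed
    then show ?thesis using that by blast
  qed
qed

text \<open>Lifts of two independent plane translations \<open>v\<close>, \<open>w\<close> commute
  up to a vertical translation by \<open>2 * Im (cnj v * w) / k\<close>, the area term of their
  parallelogram taken twice. As they are deck transformations, this shift does not change
  \<open>p\<close>.\<close>

lemma vertical_period:
  assumes "compact M"
  obtains K where "K > 0" "\<And>x (n::int). p (shift (of_int n * K) x) = p x"
proof -
  obtain r where "\<And>z. \<exists>u v. (u, v) \<in> direct \<and> cmod (z - v) \<le> r" using direct_dense[OF assms] by blast
  note dense = this
  have unit: "cmod u = 1" if "(u, v) \<in> direct" for u v using that by (simp add: direct_def)
  obtain v w where vw: "(1, v) \<in> direct" "(1, w) \<in> direct" "Im (cnj v * w) \<noteq> 0"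
    by (rule cobounded_plane_group_translations[of direct r, OF unit direct_compose direct_inverse dense])
  obtain \<phi> where \<phi>: "\<phi> \<in> Deck" "\<And>z. plane_map \<phi> z = 1 * z + v" using vw(1) by (auto simp: direct_def)
  obtain \<psi> where \<psi>: "\<psi> \<in> Deck" "\<And>z. plane_map \<psi> z = 1 * z + w" using vw(2) by (auto simp: direct_def)
  define k where "k = sqrt (B * C)"
  have k: "k > 0" using BC by (simp add: k_def)
  define K where "K = 2 * Im (cnj v * w) / k"
  have P\<phi>: "P (\<phi> x) = P x + v" and P\<psi>: "P (\<psi> x) = P x + w" for x
    using plane_map[OF \<phi>(1)] plane_map[OF \<psi>(1)] \<phi>(2) \<psi>(2) by simp_all
  have y\<phi>: "y1 (\<phi> x) = y1 x + Im (cnj v * P x) / k + y1 (\<phi> 0)" for x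
    using deck_direct[OF \<phi>(1) norm_one \<phi>(2), of x] by (simp add: k_def)
  have y\<psi>: "y1 (\<psi> x) = y1 x + Im (cnj w * P x) / k + y1 (\<psi> 0)" for x
    using deck_direct[OF \<psi>(1) norm_one \<psi>(2), of x] by (simp add: k_def)
  have comm: "\<phi> (\<psi> x) = shift K (\<psi> (\<phi> x))" for x
  proof (rule eq_of_y1_P)
    show "P (\<phi> (\<psi> x)) = P (shift K (\<psi> (\<phi> x)))" by (simp add: P\<phi> P\<psi>)
    have "Im (cnj v * (P x + w)) - Im (cnj w * (P x + v)) = Im (cnj v * P x) - Im (cnj w * P x) + 2 * Im (cnj v * w)"
      by (simp add: algebra_simps)
    then have "Im (cnj v * (P x + w)) / k - Im (cnj w * (P x + v)) / k
       = Im (cnj v * P x) / k - Im (cnj w * P x) / k + K"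
      unfolding K_def diff_divide_distrib[symmetric] add_divide_distrib[symmetric] by simp
    then show "y1 (\<phi> (\<psi> x)) = y1 (shift K (\<psi> (\<phi> x)))"
      unfolding shift(2) y\<phi>[of "\<psi> x"] y\<psi>[of "\<phi> x"] y\<psi>[of x] y\<phi>[of x] P\<phi> P\<psi> by linarith
  qed
  have pK: "p (shift K x) = p x" for x
  proof -
    obtain \<phi>' where \<phi>': "\<And>x. \<phi> (\<phi>' x) = x" using deck_transformation_inverse[OF \<phi>(1)] by metis
    obtain \<psi>' where \<psi>': "\<And>x. \<psi> (\<psi>' x) = x" using deck_transformation_inverse[OF \<psi>(1)] by metis
    define z where "z = \<phi>' (\<psi>' x)"
    have "shift K x = \<phi> (\<psi> z)" unfolding comm z_def by (simp add: \<phi>' \<psi>')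
    then have "p (shift K x) = p z"
      by (simp add: deck_transformation_apply[OF \<phi>(1)] deck_transformation_apply[OF \<psi>(1)])
    also have "\<dots> = p (\<psi> (\<phi> z))"
      by (simp add: deck_transformation_apply[OF \<phi>(1)] deck_transformation_apply[OF \<psi>(1)])
    also have "\<dots> = p x" unfolding z_def by (simp add: \<phi>' \<psi>')
    finally show ?thesis .
  qed
  have pn: "p (shift (real n * K) x) = p x" for x and n :: nat
  proof (induction n)
    case 0
    have "shift 0 x = x" by (rule eq_of_y1_P) simp_all
    then show ?case by simp
  next
    case (Suc n)
    have "shift (real (Suc n) * K) x = shift K (shift (real n * K) x)"
      unfolding shift_shift by (simp add: algebra_simps)
    then show ?case using pK Suc by simp
  qed
  have pi: "p (shift (of_int n * K) x) = p x" for n x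
  proof (cases "n \<ge> 0")
    case True
    then show ?thesis using pn[of "nat n" x] by simp
  next
    case False
    have "shift (real (nat (- n)) * K) (shift (of_int n * K) x) = x"
      unfolding shift_shift using False by (intro eq_of_y1_P) simp_all
    then show ?thesis using pn[of "nat (- n)" "shift (of_int n * K) x"] by simp
  qed
  show thesis
  proof (rule that[of "\<bar>K\<bar>"])
    show "\<bar>K\<bar> > 0" using vw(3) k by (simp add: K_def)
    fix x and n :: int
    show "p (shift (of_int n * \<bar>K\<bar>) x) = p x"
      using pi[of n x] pi[of "- n" x] by (cases "K \<ge> 0") simp_all
  qed
qed

section \<open>Discreteness of the plane group and regular points\<close>

lemma shift_period_bound:
  assumes K: "K > 0" "\<And>x (n::int). p (shift (of_int n * K) x) = p x"
  obtains s where "p (shift s x) = p x" "\<bar>t + s\<bar> \<le> K"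
proof (rule that[of "of_int (- \<lfloor>t / K\<rfloor>) * K"])
  show "p (shift (of_int (- \<lfloor>t / K\<rfloor>) * K) x) = p x" by (rule K(2))
  have "t + of_int (- \<lfloor>t / K\<rfloor>) * K = K * frac (t / K)"
    using K(1) by (simp add: frac_def algebra_simps)
  moreover have "0 \<le> frac (t / K)" "frac (t / K) \<le> 1" by (simp_all add: frac_lt_1 less_imp_le)
  ultimately show "\<bar>t + of_int (- \<lfloor>t / K\<rfloor>) * K\<bar> \<le> K"
    using K(1) by (simp add: abs_mult mult_left_le)
qed

text \<open>Discreteness does not pass from the deck group to its plane action for free. If orbit
  points different from \<open>z\<close> accumulated at \<open>z\<close>, vertical periods would
  bring their lifts to bounded height. A convergent subsequence in one fibre of \<open>p\<close> is
  eventually constant, as \<open>p\<close> is locally injective; its projection would then be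
  \<open>z\<close> itself.\<close>

lemma plane_orbit_discrete:
  assumes "compact M"
  shows "\<exists>\<rho>>0. \<forall>\<phi>\<in>Deck. cmod (plane_map \<phi> z - z) < \<rho> \<longrightarrow> plane_map \<phi> z = z"
proof (rule ccontr)
  assume neg: "\<not> ?thesis"
  obtain K where K: "K > 0" "\<And>x (n::int). p (shift (of_int n * K) x) = p x"
    by (rule vertical_period[OF assms]) (rule that; blast)
  define x0 where "x0 = lift 0 z"
  have "\<exists>x. p x = p x0 \<and> \<bar>y1 x\<bar> \<le> K \<and> P x \<noteq> z \<and> cmod (P x - z) < inverse (real (Suc n))" for n
  proof -
    have "inverse (real (Suc n)) > 0" by simp
    then obtain \<phi> where \<phi>: "\<phi> \<in> Deck" "cmod (plane_map \<phi> z - z) < inverse (real (Suc n))" "plane_map \<phi> z \<noteq> z"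
      using neg by blast
    obtain s where s: "p (shift s (\<phi> x0)) = p (\<phi> x0)" "\<bar>y1 (\<phi> x0) + s\<bar> \<le> K"
      by (rule shift_period_bound[OF K])
    have "P (shift s (\<phi> x0)) = plane_map \<phi> z" using plane_map[OF \<phi>(1), of x0] by (simp add: x0_def)
    then show ?thesis
      using \<phi> s deck_transformation_apply[OF \<phi>(1), of x0] by (intro exI[of _ "shift s (\<phi> x0)"]) simp
  qed
  then obtain X where X: "\<And>n. p (X n) = p x0" "\<And>n. \<bar>y1 (X n)\<bar> \<le> K" "\<And>n. P (X n) \<noteq> z"
     "\<And>n. cmod (P (X n) - z) < inverse (real (Suc n))" by metis
  have Pz: "(\<lambda>n. P (X n)) \<longlonglongrightarrow> z"
  proof (rule LIMSEQ_I)
    fix r :: real assume "r > 0"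
    then obtain N where N: "inverse (real (Suc N)) < r" using reals_Archimedean by blast
    have "norm (P (X n) - z) < r" if "n \<ge> N" for n
    proof -
      have "inverse (real (Suc n)) \<le> inverse (real (Suc N))" using that by (simp add: field_simps)
      then show ?thesis using X(4)[of n] N by linarith
    qed
    then show "\<exists>N. \<forall>n\<ge>N. norm (P (X n) - z) < r" by blast
  qed
  have "bounded (range (\<lambda>n. y1 (X n)))" using X(2) by (auto simp: bounded_iff intro!: exI[of _ K])
  then obtain y \<sigma> where \<sigma>: "strict_mono \<sigma>" "(\<lambda>n. y1 (X (\<sigma> n))) \<longlonglongrightarrow> y"
    using bounded_imp_convergent_subsequence[of "\<lambda>n. y1 (X n)"] by (auto simp: o_def)
  have Pz': "(\<lambda>n. P (X (\<sigma> n))) \<longlonglongrightarrow> z"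
    using LIMSEQ_subseq_LIMSEQ[OF Pz \<sigma>(1)] by (simp add: o_def)
  have "(\<lambda>n. case (y1 (X (\<sigma> n)), P (X (\<sigma> n))) of (r, z) \<Rightarrow> lift r z) \<longlonglongrightarrow> (case (y, z) of (r, z) \<Rightarrow> lift r z)"
    by (rule continuous_on_tendsto_compose[OF continuous_on_lift[of UNIV] tendsto_Pair[OF \<sigma>(2) Pz']]) auto
  then have lim: "(\<lambda>n. X (\<sigma> n)) \<longlonglongrightarrow> lift y z" by simp
  obtain V where V: "open V" "lift y z \<in> V" "inj_on p V" by (rule covering_space_locally_inj[OF cov])
  have "eventually (\<lambda>n. X (\<sigma> n) \<in> V) sequentially" using lim V(1,2) by (simp add: topological_tendstoD)
  then obtain N where N: "\<And>n. n \<ge> N \<Longrightarrow> X (\<sigma> n) \<in> V" by (auto simp: eventually_sequentially)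
  have eq: "X (\<sigma> n) = X (\<sigma> N)" if "n \<ge> N" for n
    using inj_onD[OF V(3), of "X (\<sigma> n)" "X (\<sigma> N)"] N[OF that] N[of N] X(1) by simp
  have "(\<lambda>n. P (X (\<sigma> n))) \<longlonglongrightarrow> P (X (\<sigma> N))"
    by (rule tendsto_eventually, rule eventually_sequentiallyI[of N], rule arg_cong[of _ _ P], rule eq)
  then have "P (X (\<sigma> N)) = z" using Pz' LIMSEQ_unique by blast
  then show False using X(3) by blast
qed

definition regular :: "complex set" where
  "regular = {z. \<forall>\<psi>\<in>plane_map ` Deck. \<psi> z = z \<longrightarrow> (\<forall>w. \<psi> w = w)}"

lemma regular_open_dense:
  assumes "compact M"
  shows "open regular" "closure regular = UNIV"
proof -
  have iso: "\<And>\<psi> z w. \<psi> \<in> plane_map ` Deck \<Longrightarrow> cmod (\<psi> z - \<psi> w) = cmod (z - w)"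
    using plane_map_isometry by blast
  have disc: "\<And>z. \<exists>\<rho>>0. \<forall>\<psi>\<in>plane_map ` Deck. cmod (\<psi> z - z) < \<rho> \<longrightarrow> \<psi> z = z"
    using plane_orbit_discrete[OF assms] by (simp only: ball_simps)
  show "open regular" "closure regular = UNIV"
    unfolding regular_def using trivial_stabilizer_open_dense[OF iso disc] by blast+
qed

definition regular_points :: "'m set" where "regular_points = p ` (P -` regular)"

lemma regular_points_open_dense:
  assumes "compact M"
  shows "openin (top_of_set M) regular_points" "M \<subseteq> closure regular_points"
proof -
  have "open (P -` regular)"
    using regular_open_dense(1)[OF assms] continuous_on_P[of UNIV] by (rule open_vimage)
  then show "openin (top_of_set M) regular_points"
    unfolding regular_points_def by (rule covering_space_UNIV_image_open[OF cov])
  \<comment> \<open>The points over \<open>regular\<close> at the height of \<open>x\<close> are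
    already dense among all points of that height.\<close>
  have "x \<in> closure (P -` regular)" for x
  proof -
    have "continuous_on (closure regular) (\<lambda>z. case (y1 x, z) of (r, z) \<Rightarrow> lift r z)"
      by (rule continuous_on_compose2[OF continuous_on_lift[of UNIV]]) (auto intro!: continuous_intros)
    then have "(\<lambda>z. lift (y1 x) z) ` closure regular \<subseteq> closure (P -` regular)"
      by (intro image_closure_subset) (auto intro: closure_subset[THEN subsetD])
    then have "lift (y1 x) (P x) \<in> closure (P -` regular)"
      unfolding regular_open_dense(2)[OF assms] by blast
    then show ?thesis by simp
  qed
  then have "closure (P -` regular) = UNIV" by blast
  moreover have "p ` closure (P -` regular) \<subseteq> closure regular_points"
    unfolding regular_points_def using covering_space_imp_continuous[OF cov]
    by (intro image_closure_subset) (auto intro: closure_subset[THEN subsetD] continuous_on_subset)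
  ultimately show "M \<subseteq> closure regular_points" using covering_space_imp_surjective[OF cov] by simp
qed

text \<open>A left translation acts on the plane as a translation, which has no fixed point unless
  it is trivial.\<close>

lemma regular_points_eq_of_translations:
  assumes "Deck \<subseteq> range heis_mult"
  shows "regular_points = M"
proof -
  have "regular = UNIV"
  proof -
    have "plane_map \<phi> z = z + plane_map \<phi> 0" if "\<phi> \<in> Deck" for \<phi> z
    proof -
      obtain h where h: "\<phi> = heis_mult h" using assms \<open>\<phi> \<in> Deck\<close> by blast
      have "P (heis_mult h x) = P h + P x" for x
        by (simp add: pt_def complex_eq_iff th2_def th3_def heis_mult_affine add_divide_distrib[symmetric])
          (simp add: algebra_simps add_divide_distrib diff_divide_distrib)
      then show ?thesis by (simp add: plane_map_def h)
    qed
    note t = this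
    have "z \<in> regular" for z
      unfolding regular_def
    proof clarify
      fix \<phi> w assume \<phi>: "\<phi> \<in> Deck" and "plane_map \<phi> z = z"
      then have "plane_map \<phi> 0 = 0" using t[OF \<phi>, of z] by simp
      then show "plane_map \<phi> w = w" using t[OF \<phi>, of w] by simp
    qed
    then show ?thesis by blast
  qed
  then show ?thesis using covering_space_imp_surjective[OF cov] by (simp add: regular_points_def)
qed

end

section \<open>Convergence for large times\<close>

text \<open>One time of the flow. The plane is scaled by \<open>m\<close>, so that \<open>P\<close>
  and the plane group are the same for all times; \<open>sqrt a\<close> is the length scale of the
  vertical direction.\<close>

locale heis_metric = heis_quotient f p M B C
  for f and p :: "real^3 \<Rightarrow> 'm::t2_space" and M and B C +
  fixes a m :: real
  assumes am: "a > 0" "m > 0"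
    and pres: "\<phi> \<in> deck_transformations p \<Longrightarrow> preserves \<phi> (diag_metric f a (m\<^sup>2 * B) (m\<^sup>2 * C))"
begin

abbreviation "gm \<equiv> diag_metric f a (m\<^sup>2 * B) (m\<^sup>2 * C)"
abbreviation "d \<equiv> riem_dist p gm"
abbreviation "N \<equiv> NN a (m\<^sup>2 * B) (m\<^sup>2 * C)"

definition lam :: real where "lam = sqrt a / (m\<^sup>2 * sqrt (B * C))"

lemma lam_pos: "lam > 0"
  using am BC by (simp add: lam_def)

lemma pos: "a > 0" "m\<^sup>2 * B > 0" "m\<^sup>2 * C > 0"
  using am BC by simp_all

lemma q: "quadratic gm"
  using pos by (simp add: quadratic_diag_metric)

lemma pt_m: "pt (m\<^sup>2 * B) (m\<^sup>2 * C) x = m *\<^sub>R P x"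
  using am by (simp add: pt_def complex_eq_iff real_sqrt_mult)

lemma N_eq: "N x y = norm (sqrt a * w1 x y, m *\<^sub>R (P y - P x))"
  by (simp add: NN_def pt_m scaleR_diff_right)

lemma w1_P: "w1 x y = y1 y - y1 x - Im (cnj (P x) * P y) / sqrt (B * C)"
  unfolding w1_def area_pt[OF BC] ..

lemma in_M: "p x \<in> M"
  using covering_space_imp_surjective[OF cov] by blast

lemma M_cases: assumes "X \<in> M" obtains x where "X = p x"
  using covering_space_imp_surjective[OF cov] assms by blast

lemma d_approx:
  assumes "d (p x) (p y) < r"
  obtains \<gamma> where "admissible gm \<gamma>" "p (\<gamma> 0) = p x" "p (\<gamma> 1) = p y" "len gm \<gamma> < r"
proof -
  define Z where "Z = {len gm \<gamma> |\<gamma>. admissible gm \<gamma> \<and> p (\<gamma> 0) = p x \<and> p (\<gamma> 1) = p y}"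
  have "Z \<noteq> {}"
    using seg_length(1)[of a "m\<^sup>2 * B" "m\<^sup>2 * C" x y] pos by (auto simp: Z_def intro!: exI[of _ "seg x y"])
  moreover have "Inf Z < r" using assms by (simp add: Z_def riem_dist_eq)
  ultimately obtain l where "l \<in> Z" "l < r" using cInf_lessD by blast
  then show thesis using that unfolding Z_def by blast
qed

lemma d_nonneg: "0 \<le> d (p x) (p y)"
proof (rule ccontr)
  assume "\<not> ?thesis"
  then have "d (p x) (p y) < 0" by simp
  then obtain \<gamma> where "len gm \<gamma> < 0" by (rule d_approx) (rule that; assumption)
  then show False using len_nonneg[OF q, of \<gamma>] by linarith
qed

lemma d_le: "d (p x) (p y) \<le> N x y"
  by (rule riem_dist_le_NN) (use pos in auto)

lemma d_self: "d (p x) (p x) = 0"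
  using d_le[of x x] d_nonneg[of x x] by (simp add: N_eq norm_Pair)

lemma d_sym_le: "d (p x) (p y) \<le> d (p y) (p x)"
proof (rule field_le_epsilon)
  fix e :: real assume "e > 0"
  then have "d (p y) (p x) < d (p y) (p x) + e" by simp
  then obtain \<gamma> where \<gamma>: "admissible gm \<gamma>" "p (\<gamma> 0) = p y" "p (\<gamma> 1) = p x" "len gm \<gamma> < d (p y) (p x) + e"
    by (rule d_approx) (rule that; assumption)
  have "d (p x) (p y) \<le> len gm (reversepath \<gamma>)"
    by (rule riem_dist_le[OF q admissible_reverse(1)[OF q \<gamma>(1)]]) (simp_all add: reversepath_def \<gamma>)
  then show "d (p x) (p y) \<le> d (p y) (p x) + e" using \<gamma>(4) admissible_reverse(2)[OF q \<gamma>(1)] by linarith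
qed

lemma d_sym: "d (p x) (p y) = d (p y) (p x)"
  using d_sym_le[of x y] d_sym_le[of y x] by linarith

text \<open>Two paths that meet in \<open>M\<close> need not meet in the universal cover; a deck
  transformation moves the second to the end of the first without changing its length.\<close>

lemma deck_path:
  assumes \<gamma>: "admissible gm \<gamma>" and x: "p (\<gamma> 0) = p x"
  obtains \<delta> where "admissible gm \<delta>" "\<delta> 0 = x" "p (\<delta> 1) = p (\<gamma> 1)" "len gm \<delta> = len gm \<gamma>"
proof -
  obtain \<phi> where \<phi>: "\<phi> \<in> Deck" "\<phi> (\<gamma> 0) = x" using deck_transformation_transitive[OF cov x] by blast
  show thesis
    using that[of "\<phi> \<circ> \<gamma>"] admissible_isometry[OF deck_smooth[OF \<phi>(1)] pres[OF \<phi>(1)] \<gamma>] \<phi>(2)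
      deck_transformation_apply[OF \<phi>(1)] by simp
qed

lemma d_triangle: "d (p x) (p z) \<le> d (p x) (p y) + d (p y) (p z)"
proof (rule field_le_epsilon)
  fix e :: real assume "e > 0"
  then have l: "d (p x) (p y) < d (p x) (p y) + e / 2" "d (p y) (p z) < d (p y) (p z) + e / 2" by simp_all
  obtain \<gamma> where \<gamma>: "admissible gm \<gamma>" "p (\<gamma> 0) = p x" "p (\<gamma> 1) = p y" "len gm \<gamma> < d (p x) (p y) + e / 2"
    by (rule d_approx[OF l(1)]) (rule that; assumption)
  obtain \<delta> where \<delta>: "admissible gm \<delta>" "p (\<delta> 0) = p y" "p (\<delta> 1) = p z" "len gm \<delta> < d (p y) (p z) + e / 2"
    by (rule d_approx[OF l(2)]) (rule that; assumption)
  have "p (\<delta> 0) = p (\<gamma> 1)" using \<gamma> \<delta> by simp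
  then obtain \<delta>' where \<delta>': "admissible gm \<delta>'" "\<delta>' 0 = \<gamma> 1" "p (\<delta>' 1) = p (\<delta> 1)" "len gm \<delta>' = len gm \<delta>"
    by (rule deck_path[OF \<delta>(1)]) (rule that; assumption)
  have "d (p x) (p z) \<le> len gm (\<gamma> +++ \<delta>')"
    by (rule riem_dist_le[OF q admissible_join(1)[OF q \<gamma>(1) \<delta>'(1) \<delta>'(2)[symmetric]]])
      (simp_all add: joinpaths_def \<gamma> \<delta> \<delta>')
  then show "d (p x) (p z) \<le> d (p x) (p y) + d (p y) (p z) + e"
    using admissible_join(2)[OF q \<gamma>(1) \<delta>'(1) \<delta>'(2)[symmetric]] \<gamma>(4) \<delta>(4) \<delta>'(4) by linarith
qed

text \<open>A nearly minimising path is moved so as to start at \<open>x\<close>; \<open>y'\<close>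
  is its end point, and \<open>path_estimate\<close> bounds both the projected and the full
  displacement.\<close>

lemma d_lift:
  assumes "d (p x) (p y) < r"
  obtains y' where "p y' = p y" "m * cmod (P y' - P x) < r" "N x y' < r + lam * r\<^sup>2"
proof -
  obtain \<gamma> where \<gamma>: "admissible gm \<gamma>" "p (\<gamma> 0) = p x" "p (\<gamma> 1) = p y" "len gm \<gamma> < r"
    by (rule d_approx[OF assms]) (rule that; assumption)
  obtain \<delta> where \<delta>: "admissible gm \<delta>" "\<delta> 0 = x" "p (\<delta> 1) = p (\<gamma> 1)" "len gm \<delta> = len gm \<gamma>"
    by (rule deck_path[OF \<gamma>(1,2)]) (rule that; assumption)
  define l where "l = len gm \<delta>"
  have l: "0 \<le> l" "l < r" using len_nonneg[OF q] \<gamma>(4) \<delta>(4) by (simp_all add: l_def)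
  have lam': "sqrt (a / (m\<^sup>2 * B * (m\<^sup>2 * C))) = lam"
    using am BC by (simp add: lam_def real_sqrt_divide real_sqrt_mult power2_eq_square)
  note e = path_estimate[OF pos \<delta>(1), of 0 1, folded len_def, unfolded \<delta>(2) l_def[symmetric] lam' pt_m, simplified]
  have "m *\<^sub>R P (\<delta> 1) - m *\<^sub>R P x = m *\<^sub>R (P (\<delta> 1) - P x)" by (simp add: scaleR_diff_right)
  then have "m * cmod (P (\<delta> 1) - P x) \<le> l" using e(1) am by simp
  moreover have "lam * l\<^sup>2 \<le> lam * r\<^sup>2" using l lam_pos by (intro mult_left_mono power_mono) auto
  ultimately show thesis
    using that[of "\<delta> 1"] \<delta>(3) \<gamma>(3) e(2) l by simp
qed

lemma tendsto_of_N:
  assumes "(\<lambda>n. N x (Y n)) \<longlonglongrightarrow> 0"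
  shows "Y \<longlonglongrightarrow> x"
proof -
  have "(\<lambda>n. (sqrt a * w1 x (Y n), m *\<^sub>R (P (Y n) - P x))) \<longlonglongrightarrow> 0"
    using assms unfolding N_eq by (rule tendsto_norm_zero_cancel)
  then have "(\<lambda>n. (sqrt a * w1 x (Y n), m *\<^sub>R (P (Y n) - P x))) \<longlonglongrightarrow> (0, 0)" by (simp only: zero_prod_def)
  from tendsto_fst[OF this] tendsto_snd[OF this]
  have 1: "(\<lambda>n. sqrt a * w1 x (Y n)) \<longlonglongrightarrow> 0" and 2: "(\<lambda>n. m *\<^sub>R (P (Y n) - P x)) \<longlonglongrightarrow> 0" by simp_all
  have w: "(\<lambda>n. w1 x (Y n)) \<longlonglongrightarrow> 0"
    using tendsto_mult_right[OF 1, of "inverse (sqrt a)"] am by (simp add: mult.assoc[symmetric] field_simps)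
  have "(\<lambda>n. inverse m *\<^sub>R (m *\<^sub>R (P (Y n) - P x)) + P x) \<longlonglongrightarrow> inverse m *\<^sub>R 0 + P x"
    by (intro tendsto_intros 2)
  then have PY: "(\<lambda>n. P (Y n)) \<longlonglongrightarrow> P x" using am by simp
  have "(\<lambda>n. w1 x (Y n) + y1 x + Im (cnj (P x) * P (Y n)) / sqrt (B * C))
     \<longlonglongrightarrow> 0 + y1 x + Im (cnj (P x) * P x) / sqrt (B * C)"
    by (intro tendsto_intros w PY) (use BC in simp)
  moreover have "Im (cnj (P x) * P x) = 0" by simp
  ultimately have yY: "(\<lambda>n. y1 (Y n)) \<longlonglongrightarrow> y1 x" unfolding w1_P by simp
  have "(\<lambda>n. case (y1 (Y n), P (Y n)) of (r, z) \<Rightarrow> lift r z) \<longlonglongrightarrow> (case (y1 x, P x) of (r, z) \<Rightarrow> lift r z)"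
    by (rule continuous_on_tendsto_compose[OF continuous_on_lift[of UNIV] tendsto_Pair[OF yY PY]]) auto
  then show ?thesis by simp
qed

text \<open>Distance \<open>0\<close> yields points of the fibre over \<open>p y\<close> that
  converge to \<open>x\<close>. Since \<open>p\<close> is continuous and constant on them, limits in
  the Hausdorff space give \<open>p x = p y\<close>.\<close>

lemma d_zero: assumes "d (p x) (p y) = 0" shows "p x = p y"
proof -
  have "\<exists>y'. p y' = p y \<and> N x y' < inverse (real (Suc n)) + lam * (inverse (real (Suc n)))\<^sup>2" for n
  proof -
    have "d (p x) (p y) < inverse (real (Suc n))" using assms by simp
    then show ?thesis by (rule d_lift) blast
  qed
  then obtain Y where Y: "\<And>n. p (Y n) = p y" "\<And>n. N x (Y n) < inverse (real (Suc n)) + lam * (inverse (real (Suc n)))\<^sup>2"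
    by metis
  have "(\<lambda>n. N x (Y n)) \<longlonglongrightarrow> 0"
  proof (rule tendsto_sandwich[OF _ _ tendsto_const])
    show "eventually (\<lambda>n. 0 \<le> N x (Y n)) sequentially" by (simp add: N_eq)
    show "eventually (\<lambda>n. N x (Y n) \<le> inverse (real (Suc n)) + lam * (inverse (real (Suc n)))\<^sup>2) sequentially"
      using Y(2) by (intro always_eventually allI less_imp_le)
    have "(\<lambda>n. inverse (real (Suc n)) + lam * (inverse (real (Suc n)))\<^sup>2) \<longlonglongrightarrow> 0 + lam * 0\<^sup>2"
      by (intro tendsto_intros LIMSEQ_inverse_real_of_nat)
    then show "(\<lambda>n. inverse (real (Suc n)) + lam * (inverse (real (Suc n)))\<^sup>2) \<longlonglongrightarrow> 0" by simp
  qed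
  then have "Y \<longlonglongrightarrow> x" by (rule tendsto_of_N)
  then have "(\<lambda>n. p (Y n)) \<longlonglongrightarrow> p x"
    using covering_space_imp_continuous[OF cov] by (intro continuous_on_tendsto_compose[of UNIV p]) auto
  then have "(\<lambda>n. p y) \<longlonglongrightarrow> p x" by (simp only: Y(1))
  then show ?thesis using LIMSEQ_const_iff by metis
qed

section \<open>Balls of the quotient compared with Euclidean balls\<close>

lemma GH_close_of_correspondence_d:
  fixes Y :: "'b::metric_space set"
  assumes R: "R \<subseteq> {X\<in>M. Q X} \<times> Y" and base: "(p x0, y0) \<in> R"
    and totX: "\<And>x. Q (p x) \<Longrightarrow> \<exists>y. (p x, y) \<in> R" and totY: "\<And>y. y \<in> Y \<Longrightarrow> \<exists>x. (x, y) \<in> R"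
    and dis: "\<And>x y x' y'. (p x, y) \<in> R \<Longrightarrow> (p x', y') \<in> R \<Longrightarrow> \<bar>d (p x) (p x') - dist y y'\<bar> \<le> \<epsilon>"
    and \<epsilon>: "0 < \<epsilon>"
  shows "GH_close \<epsilon> {X\<in>M. Q X} (p x0) d Y y0 dist"
proof (rule GH_close_of_correspondence[where R=R and \<eta>="\<epsilon> / 2"])
  let ?X = "{X\<in>M. Q X}"
  show "R \<subseteq> ?X \<times> Y" "(p x0, y0) \<in> R" "0 < \<epsilon> / 2" "\<epsilon> / 2 < \<epsilon>" using R base \<epsilon> by simp_all
  show "\<exists>y. (X, y) \<in> R" if "X \<in> ?X" for X
    using that totX by (auto elim: M_cases)
  show "\<exists>X. (X, y) \<in> R" if "y \<in> Y" for y by (rule totY[OF that])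
  fix X X' assume "X \<in> ?X" "X' \<in> ?X"
  then obtain x x' where x: "X = p x" "X' = p x'" by (auto elim!: M_cases)
  show "0 \<le> d X X'" unfolding x by (rule d_nonneg)
  show "d X X' = d X' X" unfolding x by (rule d_sym)
  show "d X X' = 0 \<longleftrightarrow> X = X'" unfolding x using d_zero[of x x'] d_self[of x] by auto
  fix Z assume "Z \<in> ?X"
  then obtain z where z: "Z = p z" by (auto elim!: M_cases)
  show "d X Z \<le> d X X' + d X' Z" unfolding x z by (rule d_triangle)
next
  fix X y X' y' assume r: "(X, y) \<in> R" "(X', y') \<in> R"
  then have "X \<in> M" "X' \<in> M" using R by auto
  then obtain x x' where x: "X = p x" "X' = p x'" by (metis M_cases)
  show "\<bar>d X X' - dist y y'\<bar> \<le> 2 * (\<epsilon> / 2)" using dis[of x y x' y'] r unfolding x by simp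
qed

text \<open>A point corresponds to a vector if some lift has its scaled projection \<open>V\<close>
  within \<open>e\<close> of it, where \<open>e = sqrt a * K\<close> bounds the vertical part of a
  suitable segment. The distortion is \<open>2 * e\<close> from this tolerance and \<open>e\<close>
  from the vertical part.\<close>

lemma GH_close_plane:
  assumes K: "K > 0" "\<And>x (n::int). p (shift (of_int n * K) x) = p x"
    and \<rho>: "\<And>x x'. cmod (P x - P x0) < \<rho> \<Longrightarrow> cmod (P x' - P x0) < \<rho> \<Longrightarrow> p x = p x' \<Longrightarrow> P x = P x'"
    and r: "r > 0" "3 * r \<le> m * \<rho>" and \<epsilon>: "0 < \<epsilon>" "sqrt a * K < r" "3 * (sqrt a * K) \<le> \<epsilon>"
  shows "GH_close \<epsilon> {X\<in>M. d (p x0) X < r} (p x0) d {w \<in> (UNIV :: (real^2) set). dist 0 w < r} 0 dist"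
proof -
  define e where "e = sqrt a * K"
  have e: "0 < e" "e < r" "3 * e \<le> \<epsilon>" using am K(1) \<epsilon> by (simp_all add: e_def)
  define J :: "complex \<Rightarrow> real^2" where "J z = vector [Re z, Im z]" for z
  have J: "dist (J z) (J w) = cmod (z - w)" for z w
    by (simp add: J_def dist_vec_def L2_set_def sum_2 dist_real_def cmod_def)
  have J0: "J 0 = 0" by (simp add: J_def vec_eq_iff forall_2)
  have Js: "\<exists>z. w = J z" for w
    by (rule exI[of _ "Complex (w$1) (w$2)"]) (simp add: J_def vec_eq_iff forall_2)
  define V where "V x = m *\<^sub>R (P x - P x0)" for x
  have VV: "cmod (V x - V x') = m * cmod (P x - P x')" for x x'
  proof -
    have "V x - V x' = m *\<^sub>R (P x - P x')" by (simp add: V_def scaleR_diff_right)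
    then show ?thesis using am by simp
  qed
  have V0: "V x0 = 0" by (simp add: V_def)
  have Vn: "cmod (V x) = m * cmod (P x - P x0)" for x using VV[of x x0] V0 by simp
  have upper: "d (p x) (p x') \<le> cmod (V x - V x') + e" for x x'
  proof -
    obtain s where s: "p (shift s x') = p x'" "\<bar>w1 x x' + s\<bar> \<le> K" by (rule shift_period_bound[OF K])
    have "w1 x (shift s x') = w1 x x' + s" by (simp add: w1_P)
    then have "N x (shift s x') \<le> norm (sqrt a * (w1 x x' + s)) + norm (m *\<^sub>R (P x' - P x))"
      unfolding N_eq by (simp only: shift(1)) (rule norm_Pair_le)
    also have "\<dots> \<le> e + cmod (V x - V x')"
    proof (rule add_mono)
      show "norm (sqrt a * (w1 x x' + s)) \<le> e"
        unfolding e_def using s(2) am by (simp add: abs_mult)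
      show "norm (m *\<^sub>R (P x' - P x)) \<le> cmod (V x - V x')"
        using am by (simp add: VV norm_minus_commute)
    qed
    finally show ?thesis using d_le[of x "shift s x'"] unfolding s(1) by linarith
  qed
  have lower: "cmod (V x - V x') \<le> d (p x) (p x')" if x: "cmod (V x) < r" "cmod (V x') < r" for x x'
  proof (rule ccontr)
    assume "\<not> ?thesis"
    then have "d (p x) (p x') < cmod (V x - V x')" by simp
    then obtain y where y: "p y = p x'" "m * cmod (P y - P x) < cmod (V x - V x')"
      by (rule d_lift) (rule that; assumption)
    \<comment> \<open>A lift \<open>y\<close> that is too close to \<open>x\<close> is still within
      \<open>3 * r\<close> of the base point in the scaled plane. There \<open>p\<close> determines
      the projection, so \<open>y\<close> and \<open>x'\<close> have the same one.\<close>
    have c2: "cmod (V x - V x') < 2 * r" using norm_triangle_ineq4[of "V x" "V x'"] x by linarith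
    have "cmod (V y) \<le> cmod (V y - V x) + cmod (V x)" using norm_triangle_ineq[of "V y - V x" "V x"] by simp
    then have "cmod (V y) < 3 * r" using y(2) c2 x(1) by (simp add: VV)
    then have "m * cmod (P y - P x0) < m * \<rho>" "m * cmod (P x' - P x0) < m * \<rho>"
      using r x(2) by (simp_all add: Vn)
    then have "P y = P x'" using \<rho>[of y x'] y(1) am by simp
    then show False using y(2) by (simp add: VV norm_minus_commute)
  qed
  define R where "R = {(X, w). X \<in> M \<and> d (p x0) X < r \<and> dist 0 w < r \<and>
     (\<exists>x. p x = X \<and> cmod (V x) < r \<and> dist w (J (V x)) \<le> e)}"
  show ?thesis
  proof (rule GH_close_of_correspondence_d[where R=R])
    show "R \<subseteq> {X\<in>M. d (p x0) X < r} \<times> {w \<in> UNIV. dist 0 w < r}" by (auto simp: R_def)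
    show "(p x0, 0) \<in> R"
      using r(1) e(1) by (auto simp: R_def d_self in_M V0 J0 intro!: exI[of _ x0])
    show "0 < \<epsilon>" by (rule \<epsilon>(1))
    show "\<exists>w. (p x, w) \<in> R" if xr: "d (p x0) (p x) < r" for x
    proof -
      obtain y where y: "p y = p x" "m * cmod (P y - P x0) < r"
        by (rule d_lift[OF xr]) (rule that; assumption)
      have "dist (J 0) (J (V y)) < r" unfolding J using y(2) by (simp add: Vn)
      then have "(p x, J (V y)) \<in> R"
        using xr y e(1) unfolding R_def J0 by (auto simp: in_M Vn intro!: exI[of _ y])
      then show ?thesis by blast
    qed
    show "\<exists>X. (X, w) \<in> R" if w: "w \<in> {w \<in> UNIV. dist 0 w < r}" for w
    proof -
      obtain z where z: "w = J z" using Js by blast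
      have zr: "cmod z < r" using w J[of 0 z] by (simp add: z J0)
      \<comment> \<open>Shrinking by this factor leaves room \<open>e\<close> for the vertical part,
        so that the point lies in the open ball; it displaces \<open>z\<close> by at most
        \<open>e\<close>.\<close>
      define \<theta> where "\<theta> = 1 - e / r"
      have \<theta>: "0 < \<theta>" "\<theta> \<le> 1" "r * \<theta> = r - e" using e r(1) by (simp_all add: \<theta>_def algebra_simps)
      define x where "x = lift 0 (P x0 + inverse m *\<^sub>R (\<theta> *\<^sub>R z))"
      have Vx: "V x = \<theta> *\<^sub>R z" using am by (simp add: V_def x_def)
      have "cmod (V x) = cmod z * \<theta>" unfolding Vx using \<theta>(1) by simp
      also have "\<dots> < r * \<theta>" using zr \<theta>(1) by (rule mult_strict_right_mono)
      finally have c: "cmod (V x) < r - e" unfolding \<theta>(3) .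
      have "d (p x0) (p x) \<le> cmod (V x0 - V x) + e" by (rule upper)
      then have "d (p x0) (p x) < r" using c by (simp add: V0)
      moreover have "dist w (J (V x)) \<le> e"
      proof -
        have "z - V x = (e / r) *\<^sub>R z" unfolding Vx \<theta>_def by (simp add: scaleR_diff_left)
        then have "dist w (J (V x)) = e / r * cmod z" unfolding z J using e r(1) by simp
        also have "\<dots> \<le> e / r * r" using zr e r(1) by (intro mult_left_mono) auto
        finally show ?thesis using r(1) by simp
      qed
      ultimately have "(p x, w) \<in> R"
        using w c e(1) unfolding R_def by (auto simp: in_M intro!: exI[of _ x])
      then show ?thesis by blast
    qed
    fix x w x' w' assume "(p x, w) \<in> R" "(p x', w') \<in> R"
    then obtain y y' where y: "p y = p x" "cmod (V y) < r" "dist w (J (V y)) \<le> e"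
        "p y' = p x'" "cmod (V y') < r" "dist w' (J (V y')) \<le> e" unfolding R_def by blast
    have "\<bar>dist w w' - cmod (V y - V y')\<bar> \<le> 2 * e"
      using y(3,6) dist_triangle[of w w' "J (V y)"] dist_triangle[of "J (V y)" w' "J (V y')"]
        dist_triangle[of "J (V y)" "J (V y')" w] dist_triangle[of w "J (V y')" w']
      unfolding J[symmetric] by (simp add: dist_commute)
    then show "\<bar>d (p x) (p x') - dist w w'\<bar> \<le> \<epsilon>"
      using upper[of y y'] lower[OF y(2,5)] e(3) unfolding y(1,4) by linarith
  qed
qed

text \<open>For injective \<open>p\<close> the lift in \<open>d_lift\<close> is unique, so
  \<open>N\<close> exceeds \<open>d\<close> by at most \<open>lam * d^2\<close>, while
  \<open>N\<close> and the Euclidean distance differ by the area term. With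
  \<open>\<delta> = lam * r^2\<close> these errors are \<open>4 * \<delta>\<close>, since distances
  in the ball are below \<open>2 * r\<close>, and \<open>\<delta>\<close>. The tolerance of the
  correspondence adds \<open>2 * \<delta>\<close>, which accounts for the factor 7.\<close>

lemma GH_close_space:
  assumes inj: "inj p" and r: "r > 0" "lam * r \<le> 1" and \<epsilon>: "0 < \<epsilon>" "7 * (lam * r\<^sup>2) \<le> \<epsilon>"
  shows "GH_close \<epsilon> {X\<in>M. d (p 0) X < r} (p 0) d {w \<in> (UNIV :: (real^3) set). dist 0 w < r} 0 dist"
proof -
  define F :: "real^3 \<Rightarrow> real^3" where "F x = vector [sqrt a * y1 x, m * Re (P x), m * Im (P x)]" for x
  have y0: "y1 0 = 0" by (simp add: y1_def th_linear)
  have P0: "P 0 = 0" by (rule pt_linear(4))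
  have F0: "F 0 = 0" by (simp add: F_def vec3_eq_iff y0 P0)
  have F: "dist (F x) (F x') = norm (sqrt a * (y1 x' - y1 x), m *\<^sub>R (P x' - P x))" for x x'
  proof -
    have "(dist (F x) (F x'))\<^sup>2 = (sqrt a * y1 x - sqrt a * y1 x')\<^sup>2 + (m * Re (P x) - m * Re (P x'))\<^sup>2
        + (m * Im (P x) - m * Im (P x'))\<^sup>2"
      by (simp add: F_def dist_vec_def L2_set_def sum_3 dist_real_def)
    also have "\<dots> = (norm (sqrt a * (y1 x' - y1 x), m *\<^sub>R (P x' - P x)))\<^sup>2"
    proof -
      have "(sqrt a * y1 x - sqrt a * y1 x')\<^sup>2 = (sqrt a * (y1 x' - y1 x))\<^sup>2"
        "(m * Re (P x) - m * Re (P x'))\<^sup>2 = (Re (m *\<^sub>R (P x' - P x)))\<^sup>2"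
        "(m * Im (P x) - m * Im (P x'))\<^sup>2 = (Im (m *\<^sub>R (P x' - P x)))\<^sup>2"
        by (simp_all add: power2_eq_square algebra_simps)
      then show ?thesis by (simp only: norm_Pair cmod_power2 real_sqrt_pow2 sum_power2_ge_zero real_norm_def power2_abs
            zero_le_power2 add_nonneg_nonneg add.assoc)
    qed
    finally show ?thesis by (simp only: power2_eq_iff_nonneg[OF zero_le_dist norm_ge_zero])
  qed
  have Fs: "\<exists>x. w = F x" for w
    by (rule exI[of _ "lift (w$1 / sqrt a) (Complex (w$2 / m) (w$3 / m))"]) (use am in \<open>simp add: F_def vec3_eq_iff\<close>)
  have FN: "\<bar>N x x' - dist (F x) (F x')\<bar> \<le> sqrt a * (cmod (P x) * cmod (P x') / sqrt (B * C))" for x x'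
  proof -
    define c where "c = Im (cnj (P x) * P x') / sqrt (B * C)"
    let ?V = "(sqrt a * (y1 x' - y1 x), m *\<^sub>R (P x' - P x))"
    have "(sqrt a * w1 x x', m *\<^sub>R (P x' - P x)) = ?V - (sqrt a * c, 0)"
      by (simp add: w1_P c_def algebra_simps)
    then have "\<bar>N x x' - dist (F x) (F x')\<bar> \<le> norm ((?V - (sqrt a * c, 0)) - ?V)"
      unfolding N_eq F by (simp only: norm_triangle_ineq3)
    also have "(?V - (sqrt a * c, 0)) - ?V = (- (sqrt a * c), 0)" by simp
    also have "norm \<dots> = sqrt a * \<bar>c\<bar>" using am by (simp add: norm_Pair abs_mult)
    also have "\<dots> \<le> sqrt a * (cmod (P x) * cmod (P x') / sqrt (B * C))"
    proof (rule mult_left_mono)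
      have "\<bar>Im (cnj (P x) * P x')\<bar> \<le> cmod (P x) * cmod (P x')"
        using abs_Im_le_cmod[of "cnj (P x) * P x'"] by (simp add: norm_mult)
      then show "\<bar>c\<bar> \<le> cmod (P x) * cmod (P x') / sqrt (B * C)"
        using BC by (simp add: c_def abs_divide divide_right_mono)
    qed (use am in simp)
    finally show ?thesis .
  qed
  have FN0: "N 0 x = norm (F x)" for x
    using FN[of 0 x] by (simp add: P0 F0)
  have lo: "N x x' \<le> d (p x) (p x') + lam * (d (p x) (p x'))\<^sup>2" for x x'
  proof -
    let ?D = "d (p x) (p x')"
    have "N x x' \<le> (?D + inverse (real (Suc n))) + lam * (?D + inverse (real (Suc n)))\<^sup>2" for n
    proof -
      have "?D < ?D + inverse (real (Suc n))" by simp
      then obtain y where y: "p y = p x'" "N x y < (?D + inverse (real (Suc n))) + lam * (?D + inverse (real (Suc n)))\<^sup>2"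
        by (rule d_lift) (rule that; assumption)
      then show ?thesis using injD[OF inj y(1)] by simp
    qed
    moreover have "(\<lambda>n. (?D + inverse (real (Suc n))) + lam * (?D + inverse (real (Suc n)))\<^sup>2) \<longlonglongrightarrow> (?D + 0) + lam * (?D + 0)\<^sup>2"
      by (intro tendsto_intros LIMSEQ_inverse_real_of_nat)
    ultimately show ?thesis
      by (intro LIMSEQ_le_const[where a="N x x'"]) auto
  qed
  define \<delta> where "\<delta> = lam * r\<^sup>2"
  have \<delta>: "0 < \<delta>" "7 * \<delta> \<le> \<epsilon>" using lam_pos r \<epsilon> by (simp_all add: \<delta>_def)
  have ball: "m * cmod (P x) < r" "norm (F x) < r + \<delta>" if xr: "d (p 0) (p x) < r" for x
  proof -
    obtain y where y: "p y = p x" "m * cmod (P y - P 0) < r" "N 0 y < r + lam * r\<^sup>2"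
      by (rule d_lift[OF xr]) (rule that; assumption)
    have "y = x" using injD[OF inj y(1)] .
    then show "m * cmod (P x) < r" "norm (F x) < r + \<delta>" using y by (simp_all add: P0 FN0 \<delta>_def)
  qed
  have cross: "sqrt a * (cmod (P x) * cmod (P x') / sqrt (B * C)) \<le> \<delta>"
    if "m * cmod (P x) < r" "m * cmod (P x') < r" for x x'
  proof -
    have "(m * cmod (P x)) * (m * cmod (P x')) \<le> r * r"
      using that am r by (intro mult_mono) auto
    then have "lam * ((m * cmod (P x)) * (m * cmod (P x'))) \<le> lam * (r * r)"
      using lam_pos by (intro mult_left_mono) auto
    moreover have "lam * ((m * cmod (P x)) * (m * cmod (P x'))) = sqrt a * (cmod (P x) * cmod (P x') / sqrt (B * C))"
      using am BC by (simp add: lam_def power2_eq_square)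
    ultimately show ?thesis by (simp add: \<delta>_def power2_eq_square)
  qed
  have est: "\<bar>d (p x) (p x') - dist (F x) (F x')\<bar> \<le> 5 * \<delta>"
    if x: "d (p 0) (p x) < r" "d (p 0) (p x') < r" for x x'
  proof -
    let ?D = "d (p x) (p x')"
    have "?D < 2 * r" using d_triangle[of x x' 0] d_sym[of x 0] x by linarith
    then have "?D\<^sup>2 \<le> (2 * r)\<^sup>2" using d_nonneg[of x x'] by (intro power_mono) auto
    then have "lam * ?D\<^sup>2 \<le> lam * (2 * r)\<^sup>2" using lam_pos by (intro mult_left_mono) auto
    then have "lam * ?D\<^sup>2 \<le> 4 * \<delta>" by (simp add: \<delta>_def power_mult_distrib)
    then show ?thesis
      using lo[of x x'] d_le[of x x'] FN[of x x'] cross[OF ball(1)[OF x(1)] ball(1)[OF x(2)]] \<delta>(1) by linarith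
  qed
  define R where "R = {(X, w). X \<in> M \<and> d (p 0) X < r \<and> dist 0 w < r \<and> (\<exists>x. p x = X \<and> dist w (F x) \<le> \<delta>)}"
  show ?thesis
  proof (rule GH_close_of_correspondence_d[where R=R])
    show "R \<subseteq> {X\<in>M. d (p 0) X < r} \<times> {w \<in> UNIV. dist 0 w < r}" by (auto simp: R_def)
    show "(p 0, 0) \<in> R"
      using r(1) \<delta>(1) by (auto simp: R_def d_self in_M F0 intro!: exI[of _ 0])
    show "0 < \<epsilon>" by (rule \<epsilon>(1))
    show "\<exists>w. (p x, w) \<in> R" if x: "d (p 0) (p x) < r" for x
    proof -
      \<comment> \<open>\<open>F\<close> sends the ball of radius \<open>r\<close> only into the
        ball of radius \<open>r + \<delta>\<close>; scaling by \<open>k\<close> brings it back and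
        displaces points by at most \<open>\<delta>\<close>.\<close>
      define k where "k = 1 / (1 + lam * r)"
      have lr: "0 < lam * r" using lam_pos r(1) by simp
      have k: "0 < k" "k \<le> 1" using lr by (simp_all add: k_def)
      have "r + \<delta> = r * (1 + lam * r)" by (simp add: \<delta>_def power2_eq_square algebra_simps)
      then have k3: "(r + \<delta>) * k = r" using lr by (simp add: k_def)
      define w where "w = k *\<^sub>R F x"
      have "norm w = norm (F x) * k" using k(1) by (simp add: w_def)
      also have "\<dots> < (r + \<delta>) * k" using ball(2)[OF x] k(1) by (rule mult_strict_right_mono)
      finally have "norm w < r" unfolding k3 .
      moreover have "dist w (F x) \<le> \<delta>"
      proof -
        have "dist w (F x) = norm (F x - w)" by (metis dist_commute dist_norm)
        also have "F x - w = (1 - k) *\<^sub>R F x" by (simp add: w_def scaleR_diff_left)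
        also have "norm \<dots> = (1 - k) * norm (F x)" using k by simp
        also have "\<dots> \<le> (1 - k) * (r + \<delta>)" using ball(2)[OF x] k by (intro mult_left_mono) auto
        also have "\<dots> = \<delta>" using k3 by (simp add: algebra_simps)
        finally show ?thesis .
      qed
      ultimately have "(p x, w) \<in> R" using x by (auto simp: R_def in_M)
      then show ?thesis by blast
    qed
    show "\<exists>X. (X, w) \<in> R" if w: "w \<in> {w \<in> UNIV. dist 0 w < r}" for w
    proof -
      obtain x where x: "w = F x" using Fs by blast
      have "d (p 0) (p x) < r" using d_le[of 0 x] w by (simp add: FN0 x)
      then have "(p x, w) \<in> R" using w \<delta>(1) by (auto simp: R_def in_M x)
      then show ?thesis by blast
    qed
    fix x w x' w' assume "(p x, w) \<in> R" "(p x', w') \<in> R"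
    then obtain y y' where y: "p y = p x" "d (p 0) (p x) < r" "dist w (F y) \<le> \<delta>"
        "p y' = p x'" "d (p 0) (p x') < r" "dist w' (F y') \<le> \<delta>" unfolding R_def by blast
    have "\<bar>dist w w' - dist (F y) (F y')\<bar> \<le> 2 * \<delta>"
      using y(3,6) dist_triangle[of w w' "F y"] dist_triangle[of "F y" w' "F y'"]
        dist_triangle[of "F y" "F y'" w] dist_triangle[of w "F y'" w']
      by (simp add: dist_commute)
    moreover have "\<bar>d (p x) (p x') - dist (F y) (F y')\<bar> \<le> 5 * \<delta>"
      using est[of y y'] y unfolding y(1,4) by blast
    ultimately show "\<bar>d (p x) (p x') - dist w w'\<bar> \<le> \<epsilon>" using \<delta>(2) by linarith
  qed
qed

end

context heis_quotient begin

text \<open>A deck transformation relating two points over the small disc moves \<open>P x0\<close>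
  by less than the discreteness radius, hence fixes it; at a regular point it then acts trivially on
  the plane.\<close>

lemma injectivity_radius:
  assumes M: "compact M" and x0: "P x0 \<in> regular"
  obtains \<rho> where "\<rho> > 0"
    "\<And>x x'. cmod (P x - P x0) < \<rho> \<Longrightarrow> cmod (P x' - P x0) < \<rho> \<Longrightarrow> p x = p x' \<Longrightarrow> P x = P x'"
proof -
  obtain \<rho> where \<rho>: "\<rho> > 0" "\<And>\<phi>. \<phi> \<in> Deck \<Longrightarrow> cmod (plane_map \<phi> (P x0) - P x0) < \<rho> \<Longrightarrow> plane_map \<phi> (P x0) = P x0"
    using plane_orbit_discrete[OF M, of "P x0"] by blast
  show thesis
  proof (rule that[of "\<rho> / 2"])
    show "\<rho> / 2 > 0" using \<rho>(1) by simp
    fix x x' assume x: "cmod (P x - P x0) < \<rho> / 2" "cmod (P x' - P x0) < \<rho> / 2" "p x = p x'"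
    obtain \<phi> where \<phi>: "\<phi> \<in> Deck" "\<phi> x = x'" using deck_transformation_transitive[OF cov x(3)] by blast
    have P': "P x' = plane_map \<phi> (P x)" using plane_map[OF \<phi>(1), of x] \<phi>(2) by simp
    have "cmod (plane_map \<phi> (P x0) - P x0) \<le> cmod (plane_map \<phi> (P x0) - plane_map \<phi> (P x)) + cmod (P x' - P x0)"
      using norm_triangle_ineq[of "plane_map \<phi> (P x0) - plane_map \<phi> (P x)" "P x' - P x0"] by (simp add: P')
    also have "\<dots> < \<rho>"
      unfolding plane_map_isometry[OF \<phi>(1)] using x(1,2) by (simp add: norm_minus_commute)
    finally have "plane_map \<phi> (P x0) = P x0" by (rule \<rho>(2)[OF \<phi>(1)])
    then have "plane_map \<phi> (P x) = P x"
      using x0 \<phi>(1) unfolding regular_def by blast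
    then show "P x = P x'" using P' by simp
  qed
qed

text \<open>\<open>K\<close> and \<open>\<rho>\<close> belong to the deck group and do not change
  with time, while \<open>sqrt (a t) * K\<close> tends to \<open>0\<close> and
  \<open>m t * \<rho>\<close> to infinity.\<close>

lemma GH_convergent_plane:
  assumes M: "compact M" and x0: "P x0 \<in> regular"
    and a: "(a \<longlongrightarrow> 0) F" and m: "filterlim m at_top F"
    and g: "eventually (\<lambda>t. heis_metric f p M B C (a t) (m t) \<and> g t = diag_metric f (a t) ((m t)\<^sup>2 * B) ((m t)\<^sup>2 * C)) F"
  shows "pointed_GH_convergent M (p x0) (\<lambda>t. riem_dist p (g t)) (UNIV :: (real^2) set) 0 dist F"
  unfolding pointed_GH_convergent_def
proof (intro allI impI)
  fix r \<epsilon> :: real assume r: "r > 0" and \<epsilon>: "\<epsilon> > 0"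
  obtain K where K: "K > 0" "\<And>x (n::int). p (shift (of_int n * K) x) = p x"
    by (rule vertical_period[OF M]) (rule that; blast)
  obtain \<rho> where \<rho>: "\<rho> > 0"
    "\<And>x x'. cmod (P x - P x0) < \<rho> \<Longrightarrow> cmod (P x' - P x0) < \<rho> \<Longrightarrow> p x = p x' \<Longrightarrow> P x = P x'"
    by (rule injectivity_radius[OF M x0]) (rule that; blast)
  have "((\<lambda>t. sqrt (a t) * K) \<longlongrightarrow> sqrt 0 * K) F" by (intro tendsto_intros a)
  then have l: "((\<lambda>t. sqrt (a t) * K) \<longlongrightarrow> 0) F" by simp
  have "eventually (\<lambda>t. sqrt (a t) * K < r) F" by (rule order_tendstoD(2)[OF l r])
  moreover have "eventually (\<lambda>t. sqrt (a t) * K < \<epsilon> / 3) F"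
    using \<epsilon> by (intro order_tendstoD(2)[OF l]) simp
  moreover have "eventually (\<lambda>t. 3 * r / \<rho> \<le> m t) F" using m by (simp add: filterlim_at_top)
  ultimately show "eventually (\<lambda>t. GH_close \<epsilon> {x\<in>M. riem_dist p (g t) (p x0) x < r} (p x0) (riem_dist p (g t))
      {y \<in> (UNIV :: (real^2) set). dist 0 y < r} 0 dist) F"
    using g
  proof eventually_elim
    case (elim t)
    then interpret heis_metric f p M B C "a t" "m t" by blast
    have gt: "g t = gm" by (rule conjunct2[OF elim(4)])
    have m': "3 * r \<le> m t * \<rho>" using elim(3) unfolding pos_divide_le_eq[OF \<rho>(1)] .
    have e: "3 * (sqrt (a t) * K) \<le> \<epsilon>" using elim(2) by linarith
    show ?case unfolding gt
    proof (rule GH_close_plane[where K=K and \<rho>=\<rho>])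
      show "p (shift (of_int n * K) x) = p x" for x and n :: int by (rule K(2))
      show "P x = P x'" if "cmod (P x - P x0) < \<rho>" "cmod (P x' - P x0) < \<rho>" "p x = p x'" for x x'
        using that by (rule \<rho>(2))
    qed (fact K(1) r m' \<epsilon> elim(1) e)+
  qed
qed

lemma GH_convergent_space:
  assumes inj: "inj p" and a: "(a \<longlongrightarrow> 0) F" and m: "filterlim m at_top F"
    and g: "eventually (\<lambda>t. heis_metric f p M B C (a t) (m t) \<and> g t = diag_metric f (a t) ((m t)\<^sup>2 * B) ((m t)\<^sup>2 * C)) F"
  shows "pointed_GH_convergent M (p 0) (\<lambda>t. riem_dist p (g t)) (UNIV :: (real^3) set) 0 dist F"
  unfolding pointed_GH_convergent_def
proof (intro allI impI)
  fix r \<epsilon> :: real assume r: "r > 0" and \<epsilon>: "\<epsilon> > 0"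
  define lm where "lm t = sqrt (a t) / ((m t)\<^sup>2 * sqrt (B * C))" for t
  have "((\<lambda>t. sqrt (a t) * (inverse (m t))\<^sup>2 * inverse (sqrt (B * C))) \<longlongrightarrow> sqrt 0 * 0\<^sup>2 * inverse (sqrt (B * C))) F"
    by (intro tendsto_intros a filterlim_compose[OF tendsto_inverse_0_at_top m] filterlim_ident)
  then have l: "(lm \<longlongrightarrow> 0) F"
    unfolding lm_def by (simp add: divide_inverse power_inverse mult.assoc)
  have "((\<lambda>t. lm t * r) \<longlongrightarrow> 0 * r) F" "((\<lambda>t. 7 * (lm t * r\<^sup>2)) \<longlongrightarrow> 7 * (0 * r\<^sup>2)) F"
    by (intro tendsto_intros l)+
  then have "eventually (\<lambda>t. lm t * r < 1) F" "eventually (\<lambda>t. 7 * (lm t * r\<^sup>2) < \<epsilon>) F"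
    using \<epsilon> by (auto intro: order_tendstoD(2))
  then show "eventually (\<lambda>t. GH_close \<epsilon> {x\<in>M. riem_dist p (g t) (p 0) x < r} (p 0) (riem_dist p (g t))
      {y \<in> (UNIV :: (real^3) set). dist 0 y < r} 0 dist) F"
    using g
  proof eventually_elim
    case (elim t)
    then interpret heis_metric f p M B C "a t" "m t" by blast
    have gt: "g t = gm" by (rule conjunct2[OF elim(3)])
    have lam: "lam = lm t" by (simp add: lam_def lm_def)
    show ?case unfolding gt
    proof (rule GH_close_space[OF inj r _ \<epsilon>])
      show "lam * r \<le> 1" "7 * (lam * r\<^sup>2) \<le> \<epsilon>" unfolding lam using elim(1,2) by linarith+
    qed
  qed
qed

end

theorem theorem2p2:
  fixes p :: "real^3 \<Rightarrow> 'm::t2_space" and M :: "'m set"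
    and f :: "3 \<Rightarrow> real^3 \<Rightarrow> real^3"
    and A0 B0 C0 T0 :: real
    and g0 :: "real^3 \<Rightarrow> real^3 \<Rightarrow> real^3 \<Rightarrow> real"
    and g gbar :: "real \<Rightarrow> real^3 \<Rightarrow> real^3 \<Rightarrow> real^3 \<Rightarrow> real"
  assumes "A0 > 0" and "B0 > 0" and "C0 > 0"
    and "milnor_frame f"
    and "g0 = diag_metric f A0 B0 C0"
    and "heisenberg_type p M g0"
    and "T0 = B0\<^sup>2 * C0\<^sup>2 / (28 * A0\<^sup>2)"
    and "maximal_neg_xcf_solution p f g0 {- T0<..} g"
    and "\<And>t x u v. gbar t x u v = (1 + t / T0) powr (- 3 / 14) * g t x u v"
  shows
    "(compact M \<longrightarrow>
        (\<exists>U. openin (top_of_set M) U \<and> M \<subseteq> closure U \<and>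
             (deck_transformations p \<subseteq> range heis_mult \<longrightarrow> U = M) \<and>
             (\<forall>x\<in>U. pointed_GH_convergent M x (\<lambda>t. riem_dist p (g t))
                       (UNIV :: (real^2) set) 0 dist at_top)) \<and>
        (\<forall>\<epsilon>>0. eventually (\<lambda>t. \<forall>x u v. u \<noteq> v \<and> independent {u, v} \<longrightarrow>
                   \<bar>sectional_curvature (g t) x u v\<bar> < \<epsilon>) at_top))
     \<and> (inj p \<longrightarrow>
        pointed_GH_convergent M (p 0) (\<lambda>t. riem_dist p (g t))
          (UNIV :: (real^3) set) 0 dist at_top)
     \<and> uniformly_convergent_metrics M (\<lambda>t. riem_dist p (gbar t))
          (subriem_dist p f (1 / B0) (1 / C0)) (at_right (- T0))"
proof -
  note pos = assms(1-3)
  interpret milnor f by unfold_locales (rule assms(4))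
  have T0: "T0 > 0" using pos by (simp add: assms(7))
  have sol: "neg_xcf_solution p f (diag_metric f A0 B0 C0) {- T0<..} g"
    using assms(8) by (simp add: maximal_neg_xcf_solution_def assms(5))
  define s where "s t = 1 + t / T0" for t
  have s: "s t > 0" if "t > - T0" for t using that T0 by (simp add: s_def field_simps)
  define a where "a t = A0 * s t powr (- 1 / 14)" for t
  \<comment> \<open>Half of the exponent of the horizontal coefficients, since \<open>m\<close>
    scales lengths.\<close>
  define m where "m t = s t powr (3 / 28)" for t
  have m2: "(m t)\<^sup>2 = s t powr (3 / 14)" if "t > - T0" for t
    unfolding m_def power2_eq_square powr_add[symmetric] by simp
  have g: "g t = diag_metric f (a t) ((m t)\<^sup>2 * B0) ((m t)\<^sup>2 * C0)" if "t > - T0" for t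
    unfolding neg_xcf_solution_eq[OF sol pos assms(7) that] m2[OF that] a_def s_def
    by (simp only: mult.commute)
  have am: "a t > 0" "m t > 0" if "t > - T0" for t
    using s[OF that] pos by (simp_all add: a_def m_def)
  have desc: "preserves \<phi> (g t)" if "\<phi> \<in> deck_transformations p" "t > - T0" for \<phi> t
    using sol that unfolding neg_xcf_solution_def descends_def by auto
  have cov: "covering_space UNIV p M"
    and sm: "\<And>\<phi>. \<phi> \<in> deck_transformations p \<Longrightarrow> smooth \<phi>"
    using assms(6) by (simp_all add: heisenberg_type_def)
  \<comment> \<open>The ratio of the two invariant forms changes with \<open>t\<close>, hence both are preserved.\<close>
  have inv: "(th1 (\<phi> x) (frechet_derivative \<phi> (at x) u))\<^sup>2 = (th1 x u)\<^sup>2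
     \<and> (cmod (pt B0 C0 (frechet_derivative \<phi> (at x) u)))\<^sup>2 = (cmod (pt B0 C0 u))\<^sup>2"
    if \<phi>: "\<phi> \<in> deck_transformations p" for \<phi> x u
  proof -
    define X X' where "X = (th1 x u)\<^sup>2" and "X' = (th1 (\<phi> x) (frechet_derivative \<phi> (at x) u))\<^sup>2"
    define Q Q' where "Q = (cmod (pt B0 C0 u))\<^sup>2" and "Q' = (cmod (pt B0 C0 (frechet_derivative \<phi> (at x) u)))\<^sup>2"
    have dm: "diag_metric f b (k * B0) (k * C0) z v v = b * (th1 z v)\<^sup>2 + k * (cmod (pt B0 C0 v))\<^sup>2" for b k z v
      using pos by (simp add: diag_metric_eq pt_def cmod_power2 power_mult_distrib) (simp add: power2_eq_square algebra_simps)
    have e: "a t * X' + (m t)\<^sup>2 * Q' = a t * X + (m t)\<^sup>2 * Q" if "t > - T0" for t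
      using desc[OF \<phi> that] unfolding preserves_def g[OF that] X_def X'_def Q_def Q'_def by (simp add: dm[symmetric])
    \<comment> \<open>Times 0 and 1 suffice: in between the vertical coefficient decreases and the
      horizontal factor increases, so the two linear equations for the differences are
      independent.\<close>
    have t0: "a 0 = A0" "m 0 = 1" by (simp_all add: a_def m_def s_def)
    have s1: "s 1 > 1" using T0 by (simp add: s_def)
    have a1: "a 1 < A0" using pos(1) s1 powr_less_mono[of "- 1 / 14" 0 "s 1"] by (simp add: a_def)
    have m1: "(m 1)\<^sup>2 > 1"
      using T0 s1 powr_less_mono[of 0 "3 / 14" "s 1"] m2[of 1] by simp
    have 0: "A0 * (X' - X) = - (Q' - Q)" using e[of 0] T0 t0 by (simp add: algebra_simps)
    have 1: "a 1 * (X' - X) = - ((m 1)\<^sup>2 * (Q' - Q))" using e[of 1] T0 by (simp add: algebra_simps)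
    have "(a 1 - (m 1)\<^sup>2 * A0) * (X' - X) = a 1 * (X' - X) - (m 1)\<^sup>2 * (A0 * (X' - X))" by (simp add: algebra_simps)
    also have "\<dots> = 0" unfolding 0 1 by (simp add: algebra_simps)
    finally have "(a 1 - (m 1)\<^sup>2 * A0) * (X' - X) = 0" .
    moreover have "1 * A0 < (m 1)\<^sup>2 * A0" using m1 pos(1) by (intro mult_strict_right_mono)
    ultimately have "X' = X" using a1 by auto
    then have "Q' = Q" using 0 by simp
    with \<open>X' = X\<close> show ?thesis by (simp add: X_def X'_def Q_def Q'_def)
  qed
  interpret heis_quotient f p M B0 C0
  proof unfold_locales
    fix \<phi> x u assume \<phi>: "\<phi> \<in> deck_transformations p"
    show "(th1 (\<phi> x) (frechet_derivative \<phi> (at x) u))\<^sup>2 = (th1 x u)\<^sup>2" using inv[OF \<phi>] by blast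
    show "cmod (pt B0 C0 (frechet_derivative \<phi> (at x) u)) = cmod (pt B0 C0 u)"
      using inv[OF \<phi>, of x u] by (simp only: power2_eq_iff_nonneg[OF norm_ge_zero norm_ge_zero])
  qed (use cov sm pos in auto)
  have hm: "heis_metric f p M B0 C0 (a t) (m t)" if "t > - T0" for t
    by unfold_locales (use am[OF that] desc[OF _ that] in \<open>simp_all only: g[OF that, symmetric]\<close>)
  have ev: "eventually (\<lambda>t. heis_metric f p M B0 C0 (a t) (m t) \<and>
      g t = diag_metric f (a t) ((m t)\<^sup>2 * B0) ((m t)\<^sup>2 * C0)) at_top"
    using eventually_gt_at_top[of "- T0"] by eventually_elim (use hm g in blast)
  have stop: "filterlim s at_top at_top"
  proof -
    have "filterlim (\<lambda>t. 1 + inverse T0 * t) at_top at_top"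
      using T0 by (intro filterlim_tendsto_add_at_top[OF tendsto_const]
          filterlim_tendsto_pos_mult_at_top[OF tendsto_const] filterlim_ident) simp
    then show ?thesis by (simp add: s_def[abs_def] divide_inverse mult.commute)
  qed
  have "((\<lambda>t. A0 * s t powr (- 1 / 14)) \<longlongrightarrow> A0 * 0) at_top"
    by (intro tendsto_intros tendsto_neg_powr stop) simp
  then have a0: "(a \<longlongrightarrow> 0) at_top" by (simp add: a_def[abs_def])
  have mtop: "filterlim m at_top at_top"
  proof -
    have "((\<lambda>t. s t powr (- (3 / 28))) \<longlongrightarrow> 0) at_top" by (intro tendsto_neg_powr stop) simp
    moreover have "eventually (\<lambda>t. 0 < s t powr (- (3 / 28))) at_top"
      using eventually_gt_at_top[of "- T0"] by eventually_elim (use s in force)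
    ultimately have "filterlim (\<lambda>t. inverse (s t powr (- (3 / 28)))) at_top at_top"
      by (rule filterlim_inverse_at_top)
    then show ?thesis by (simp add: m_def[abs_def] powr_minus)
  qed
  have part1: "\<exists>U. openin (top_of_set M) U \<and> M \<subseteq> closure U \<and>
             (deck_transformations p \<subseteq> range heis_mult \<longrightarrow> U = M) \<and>
             (\<forall>x\<in>U. pointed_GH_convergent M x (\<lambda>t. riem_dist p (g t))
                       (UNIV :: (real^2) set) 0 dist at_top)" if M: "compact M"
  proof (intro exI[of _ regular_points] conjI impI ballI)
    show "openin (top_of_set M) regular_points" "M \<subseteq> closure regular_points" by (rule regular_points_open_dense[OF M])+
    show "regular_points = M" if "deck_transformations p \<subseteq> range heis_mult" by (rule regular_points_eq_of_translations[OF that])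
    fix X assume "X \<in> regular_points"
    then obtain x0 where "X = p x0" "P x0 \<in> regular" unfolding regular_points_def by blast
    then show "pointed_GH_convergent M X (\<lambda>t. riem_dist p (g t)) (UNIV :: (real^2) set) 0 dist at_top"
      using GH_convergent_plane[OF M _ a0 mtop ev] by blast
  qed
  have part2: "eventually (\<lambda>t. \<forall>x u v. u \<noteq> v \<and> independent {u, v} \<longrightarrow>
                   \<bar>sectional_curvature (g t) x u v\<bar> < \<epsilon>) at_top" if "\<epsilon> > 0" for \<epsilon>
  proof -
    have "((\<lambda>t. 3 * (a t * ((inverse (m t))\<^sup>2 * inverse B0 * ((inverse (m t))\<^sup>2 * inverse C0))))
        \<longlongrightarrow> 3 * (0 * (0\<^sup>2 * inverse B0 * (0\<^sup>2 * inverse C0)))) at_top"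
      by (intro tendsto_intros a0 filterlim_compose[OF tendsto_inverse_0_at_top mtop] filterlim_ident)
    then have "eventually (\<lambda>t. 3 * (a t * ((inverse (m t))\<^sup>2 * inverse B0 * ((inverse (m t))\<^sup>2 * inverse C0))) < \<epsilon>) at_top"
      using that by (intro order_tendstoD(2)) simp_all
    then show ?thesis
      using eventually_gt_at_top[of "- T0"]
    proof eventually_elim
      case (elim t)
      have "\<bar>sectional_curvature (g t) x u v\<bar> < \<epsilon>" for x u v
      proof -
        have "\<bar>sectional_curvature (g t) x u v\<bar> \<le> 3 * (a t / ((m t)\<^sup>2 * B0 * ((m t)\<^sup>2 * C0)))"
          unfolding g[OF elim(2)] by (rule sectional_curvature_bound) (use am[OF elim(2)] pos in auto)
        also have "\<dots> < \<epsilon>" using elim(1) by (simp only: divide_inverse power_inverse inverse_mult_distrib)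
        finally show ?thesis .
      qed
      then show ?case by blast
    qed
  qed
  have part3: "uniformly_convergent_metrics M (\<lambda>t. riem_dist p (gbar t))
          (subriem_dist p f (1 / B0) (1 / C0)) (at_right (- T0))"
  proof (rule uniformly_convergent_to_subriem_dist[OF cov pos(2,3)])
    \<comment> \<open>The rescaling cancels the powers in the horizontal coefficients and adds its
      own to the vertical one: 1/14 + 3/14 = 2/7.\<close>
    let ?a = "\<lambda>t. A0 * inverse (s t powr (2 / 7))"
    have "((\<lambda>t. 1 + t / T0) \<longlongrightarrow> 1 + (- T0) / T0) (at_right (- T0))"
      using T0 by (intro tendsto_intros) simp
    then have s0: "(s \<longlongrightarrow> 0) (at_right (- T0))" using T0 by (simp add: s_def[abs_def])
    have ge: "eventually (\<lambda>t. t > - T0) (at_right (- T0))" by (simp add: eventually_at_right_less)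
    have "((\<lambda>t. s t powr (2 / 7)) \<longlongrightarrow> 0) (at_right (- T0))"
    proof (rule tendsto_zero_powrI[OF s0 tendsto_const])
      show "eventually (\<lambda>t. 0 \<le> s t) (at_right (- T0))" using ge by eventually_elim (use s in force)
    qed simp
    moreover have "eventually (\<lambda>t. 0 < s t powr (2 / 7)) (at_right (- T0))"
      using ge by eventually_elim (use s in force)
    ultimately have "filterlim (\<lambda>t. inverse (s t powr (2 / 7))) at_top (at_right (- T0))"
      by (rule filterlim_inverse_at_top)
    then show "filterlim ?a at_top (at_right (- T0))"
      using pos(1) by (intro filterlim_tendsto_pos_mult_at_top[OF tendsto_const])
    show "eventually (\<lambda>t. gbar t = diag_metric f (?a t) B0 C0) (at_right (- T0))"
      using ge
    proof eventually_elim
      case (elim t)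
      have 1: "s t powr (- 3 / 14) * (m t)\<^sup>2 = 1"
        unfolding m2[OF elim] powr_add[symmetric] using s[OF elim] by simp
      have 2: "s t powr (- 3 / 14) * a t = ?a t"
      proof -
        have "s t powr (- 3 / 14) * a t = A0 * s t powr (- (2 / 7))"
          unfolding a_def mult.left_commute[of _ A0] powr_add[symmetric] by simp
        then show ?thesis by (simp only: powr_minus)
      qed
      show ?case
      proof (intro ext)
        fix x u v
        have "gbar t x u v = (s t powr (- 3 / 14) * a t) * th1 x u * th1 x v
          + (s t powr (- 3 / 14) * (m t)\<^sup>2) * (B0 * th2 u * th2 v) + (s t powr (- 3 / 14) * (m t)\<^sup>2) * (C0 * th3 u * th3 v)"
          unfolding assms(9) g[OF elim] diag_metric_eq s_def by (simp add: algebra_simps)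
        then show "gbar t x u v = diag_metric f (?a t) B0 C0 x u v"
          unfolding 1 2 diag_metric_eq by simp
      qed
    qed
  qed
  show ?thesis
    using part1 part2 part3 GH_convergent_space[OF _ a0 mtop ev] by blast
qed

end
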